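(* Let $n\geq 2$ be an integer, let $\mu$ be the normalized surface measure on $S^{n-1}$, let $L>0$, and let $f:S^{n-1}\to\mathbb{R}$ be $L$-Lipschitz with respect to the geodesic distance. Write $\mathbb{E}f=\int_{S^{n-1}} f\,d\mu$. Then for every $t\geq 0$: (a) for all $n\geq 2$, $$\mu(\{f\geq \mathbb{E}f+t\})\ \leq\ e^{-nt^2/(2L^2)};$$ (b) for all $n>2$, $$\mu(\{|f-\mathbb{E}f|\geq t\})\ \leq\ e^{-nt^2/(2L^2)}.$$
   Context: $S^{n-1}$ is the unit Euclidean sphere in $\mathbb{R}^n$, equipped with the geodesic distance $\mathrm{dist}(x,y)=\arccos\langle x,y\rangle$ and the rotation-invariant Borel probability measure $\mu=\mu_n$. *)

theory Defs
  imports "HOL-Probability.Probability"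
begin

definition geodesic_dist :: "real ^ 'n \<Rightarrow> real ^ 'n \<Rightarrow> real" where
  "geodesic_dist x y = arccos (x \<bullet> y)"

definition geodesic_lipschitz :: "real \<Rightarrow> (real ^ 'n \<Rightarrow> real) \<Rightarrow> bool" where
  "geodesic_lipschitz L f \<longleftrightarrow>
     (\<forall>x\<in>sphere 0 1. \<forall>y\<in>sphere 0 1. \<bar>f x - f y\<bar> \<le> L * geodesic_dist x y)"

(* Normalized surface measure, characterised as the rotation-invariant Borel probability
   measure on the unit sphere. Rotations are orthogonal matrices of determinant 1; they act
   transitively on the sphere, so that the measure is unique, only when CARD('n) \<ge> 2. *)
definition is_sphere_measure :: "(real ^ 'n) measure \<Rightarrow> bool" where
  "is_sphere_measure \<mu> \<longleftrightarrow>
     prob_space \<mu> \<and>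
     sets \<mu> = sets (restrict_space borel (sphere 0 1)) \<and>
     (\<forall>Q :: real ^ 'n ^ 'n. rotation_matrix Q \<longrightarrow> distr \<mu> \<mu> (\<lambda>x. Q *v x) = \<mu>)"

end

(* The bounds are first proved for the latitude S = arcsin <x, e>, which has density proportional
   to cos^(n-2) on [-pi/2, pi/2]. The general case is reduced to functions of the latitude by polarization:
   among the 1-Lipschitz functions equidistributed with f, one maximising the correlation with the
   height <x, e> exists by Arzela-Ascoli; since polarization preserves the Lipschitz constant and the
   distribution and raises the correlation, the maximiser is an increasing function of the latitude.
   If psi is such a function and {psi >= E psi + t} = {S >= a}, then t <= E (a - S)_+, so one needs
   P(S >= a) <= exp (- n (E (a - S)_+)^2 / 2).  For n >= 3 this and the two-sided bound follow from
   2 P(S >= x) <= exp (- n x^2 / 2), x >= 0, and moment estimates; for n = 2 it is explicit.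
   The distribution of S is identified through its moments: invariance under rotations in a plane
   gives (k + 1) E[h^k] = (n + k) E[h^(k+2)] for the height h. *)

theory Submission
  imports Defs "HOL-Complex_Analysis.Great_Picard"
begin

section \<open>Elementary inequalities\<close>

text \<open>Deviations are measured from the mean, so the latitude itself is not extremal: for a
  given level set {S >= a} the largest possible deviation is that of min(S, a), which is flat on the
  level set, and it equals E (a - S)_+ = a + E (S - a)_+. Hence every tail estimate is paired with
  an estimate of a mean excess. In (b), adding two one-sided bounds would cost a factor 2. The two
  levels are coupled instead: if psi is t above its mean at a and t below it at -b, the Lipschitz
  condition gives 2t <= a + b, so that a level close to the equator pushes the other one away from
  it. On the circle (b) is false: for the latitude and t = 1.1 the left side is 1 - 2.2/pi > 0.299,
  the right side exp(-1.21) < 0.299. Dimension 3 recurs as a separate case: there the comparison of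
  density ratios fails and the Gaussian bound on the normalization is too weak, but the tail is
  simply (1 - sin x)/2.\<close>

lemma gaussian_integral_le:
  assumes "c > 0" "x \<ge> 0"
  shows "integral {0..x} (\<lambda>s. exp (- (c * s\<^sup>2))) \<le> sqrt (pi / c) / 2"
proof -
  have 1: "((\<lambda>s. indicator {0..} s *\<^sub>R exp (- s\<^sup>2)) has_integral (sqrt pi / 2)) UNIV"
    using gaussian_moment_0 has_integral_integral_lborel[of "\<lambda>s. indicator {0..} s *\<^sub>R exp (- s\<^sup>2) :: real"]
    unfolding has_bochner_integral_iff by (metis (no_types, lifting))
  have 2: "((\<lambda>s. if s \<in> {0..} then exp (- s\<^sup>2) else 0) has_integral (sqrt pi / 2)) UNIV"
    by (rule has_integral_eq[OF _ 1]) (auto simp: indicator_def)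
  have 3: "((\<lambda>s. exp (- s\<^sup>2)) has_integral (sqrt pi / 2)) {0..}"
    using 2 has_integral_restrict_UNIV by blast
  have le: "integral {0..y} (\<lambda>s. exp (- s\<^sup>2)) \<le> sqrt pi / 2" for y :: real
  proof -
    have "integral {0..y} (\<lambda>s. exp (- s\<^sup>2)) \<le> integral {0..} (\<lambda>s. exp (- s\<^sup>2))"
      using 3 by (intro integral_subset_le integrable_continuous_interval continuous_intros)
        (auto simp: has_integral_iff)
    then show ?thesis using 3 by (simp add: integral_unique)
  qed
  have "((\<lambda>s. sqrt c *\<^sub>R exp (- (sqrt c * s)\<^sup>2)) has_integral
           integral {sqrt c * 0..sqrt c * x} (\<lambda>s. exp (- s\<^sup>2))) {0..x}"
    using assms
    by (intro has_integral_substitution[where c=0 and d="sqrt c * x"] continuous_intros)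
       (auto intro!: derivative_eq_intros mult_left_mono)
  then have "integral {0..x} (\<lambda>s. sqrt c *\<^sub>R exp (- (sqrt c * s)\<^sup>2)) \<le> sqrt pi / 2"
    using le by (simp add: has_integral_iff)
  then have "sqrt c * integral {0..x} (\<lambda>s. exp (- (c * s\<^sup>2))) \<le> sqrt pi / 2"
    using assms by (simp add: power_mult_distrib)
  then show ?thesis
    using assms by (simp add: real_sqrt_divide field_simps)
qed

lemma sin_ge_mult_cos:
  fixes x :: real
  assumes "0 \<le> x" "x \<le> pi"
  shows "x * cos x \<le> sin x"
proof -
  have "sin 0 - 0 * cos 0 \<le> sin x - x * cos x"
  proof (rule DERIV_nonneg_imp_nondecreasing[OF assms(1)])
    fix y assume "0 \<le> y" "y \<le> x"
    then have "0 \<le> y * sin y" using assms by (intro mult_nonneg_nonneg sin_ge_zero) auto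
    moreover have "((\<lambda>y. sin y - y * cos y) has_real_derivative y * sin y) (at y)"
      by (auto intro!: derivative_eq_intros)
    ultimately show "\<exists>z. ((\<lambda>y. sin y - y * cos y) has_real_derivative z) (at y) \<and> 0 \<le> z" by blast
  qed
  then show ?thesis by simp
qed

lemma cos_le_exp_neg_square:
  fixes s :: real
  assumes "0 \<le> s" "s \<le> pi/2"
  shows "cos s \<le> exp (- s\<^sup>2 / 2)"
proof -
  have "cos s * exp (s\<^sup>2/2) \<le> cos 0 * exp (0\<^sup>2/2)"
  proof (rule DERIV_nonpos_imp_nonincreasing[OF assms(1)])
    fix x :: real assume x: "0 \<le> x" "x \<le> s"
    have "x * cos x \<le> sin x"
      using x assms by (intro sin_ge_mult_cos) auto
    then have "(- sin x) * exp (x\<^sup>2/2) + cos x * (exp (x\<^sup>2/2) * x) \<le> 0"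
      using mult_right_mono[of "x * cos x" "sin x" "exp (x\<^sup>2/2)"] by (simp add: algebra_simps)
    moreover have "((\<lambda>x. cos x * exp (x\<^sup>2/2)) has_real_derivative
        (- sin x) * exp (x\<^sup>2/2) + cos x * (exp (x\<^sup>2/2) * x)) (at x)"
      by (auto intro!: derivative_eq_intros)
    ultimately show "\<exists>y. ((\<lambda>x. cos x * exp (x\<^sup>2/2)) has_real_derivative y) (at x) \<and> y \<le> 0"
      by blast
  qed
  then show ?thesis
    by (simp add: exp_minus field_simps)
qed

text \<open>The quotient (15 t - t^3) / (15 - 6 t^2) is a Pade approximant of tan. The functions sin
  t - t cos t, (3 - t^2) sin t - 3 t cos t and the difference treated here are t^2 j_1, t^3 j_2 and
  t^4 j_3 for the spherical Bessel functions j_i. All vanish at 0 and each has t times the preceding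
  one as derivative, so nonnegativity on [0, pi] passes up the chain.\<close>

lemma tan_pade_lower:
  fixes t :: real
  assumes "0 \<le> t" "t \<le> pi"
  shows "(15 * t - t^3) * cos t \<le> (15 - 6 * t\<^sup>2) * sin t"
proof -
  have r: "0 \<le> (3 - t\<^sup>2) * sin t - 3 * t * cos t" if "0 \<le> t" "t \<le> pi" for t :: real
  proof -
    have "(3 - 0\<^sup>2) * sin 0 - 3 * 0 * cos 0 \<le> (3 - t\<^sup>2) * sin t - 3 * t * cos t"
    proof (rule DERIV_nonneg_imp_nondecreasing[OF that(1)])
      fix y assume y: "0 \<le> y" "y \<le> t"
      then have "0 \<le> y * (sin y - y * cos y)" using that sin_ge_mult_cos[of y]
        by (intro mult_nonneg_nonneg) auto
      moreover have "((\<lambda>t. (3 - t\<^sup>2) * sin t - 3 * t * cos t) has_real_derivative y * (sin y - y * cos y)) (at y)"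
        by (auto intro!: derivative_eq_intros simp: algebra_simps power2_eq_square)
      ultimately show "\<exists>z. ((\<lambda>t. (3 - t\<^sup>2) * sin t - 3 * t * cos t) has_real_derivative z) (at y) \<and> 0 \<le> z" by blast
    qed
    then show ?thesis by simp
  qed
  have "(15 - 6 * 0\<^sup>2) * sin 0 - (15 * 0 - 0^3) * cos 0 \<le> (15 - 6 * t\<^sup>2) * sin t - (15 * t - t^3) * cos t"
  proof (rule DERIV_nonneg_imp_nondecreasing[OF assms(1)])
    fix y assume y: "0 \<le> y" "y \<le> t"
    then have "0 \<le> y * ((3 - y\<^sup>2) * sin y - 3 * y * cos y)" using assms r[of y]
      by (intro mult_nonneg_nonneg) auto
    moreover have "((\<lambda>t. (15 - 6 * t\<^sup>2) * sin t - (15 * t - t^3) * cos t) has_real_derivative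
        y * ((3 - y\<^sup>2) * sin y - 3 * y * cos y)) (at y)"
      by (auto intro!: derivative_eq_intros simp: algebra_simps power2_eq_square power3_eq_cube)
    ultimately show "\<exists>z. ((\<lambda>t. (15 - 6 * t\<^sup>2) * sin t - (15 * t - t^3) * cos t) has_real_derivative z) (at y) \<and> 0 \<le> z"
      by blast
  qed
  then show ?thesis by simp
qed

lemma pi_half_bounds: "157/100 < pi/2" "pi/2 < 1571/1000"
  using pi_approx by simp_all

text \<open>This is the case \<open>m = 2\<close> of the sign condition in
  \<open>cos_ratio_antimono\<close>. The margin near t = 0.95 is too small for the Taylor polynomial
  of tan of degree 5, hence the Pade bound.\<close>

lemma two_tan_plus_inverse_ge:
  fixes t :: real
  assumes "0 < t" "t < pi/2"
  shows "4 * t \<le> 2 * tan t + 1 / t"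
proof -
  have c: "cos t > 0" using assms by (simp add: cos_gt_zero_pi)
  have "t < 1571/1000" using assms pi_half_bounds by linarith
  then have "t * t < 1571/1000 * (1571/1000)" using assms by (intro mult_strict_mono) auto
  then have w: "15 - 6 * t\<^sup>2 > 0" by (simp add: power2_eq_square)
  have "(15 * t - t^3) / (15 - 6 * t\<^sup>2) \<le> tan t"
    using tan_pade_lower[of t] assms c w by (simp add: tan_def field_simps)
  moreover have "4 * t \<le> 2 * ((15 * t - t^3) / (15 - 6 * t\<^sup>2)) + 1 / t"
  proof -
    \<comment> \<open>After clearing denominators the claim is 22 u^2 - 36 u + 15 >= 0 for u = t^2.
      The discriminant is negative, and the square is completed at u = 9/11.\<close>
    have "0 \<le> 22 * (t\<^sup>2 - 9/11)\<^sup>2 + (15 - 22 * (9/11)\<^sup>2)"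
      by (intro add_nonneg_nonneg mult_nonneg_nonneg) (auto simp: power2_eq_square)
    also have "\<dots> = 22 * (t\<^sup>2)\<^sup>2 - 36 * t\<^sup>2 + 15"
      by (simp add: power2_eq_square algebra_simps)
    finally have "0 \<le> (22 * (t\<^sup>2)\<^sup>2 - 36 * t\<^sup>2 + 15) / (t * (15 - 6 * t\<^sup>2))"
      using w assms by simp
    also have "\<dots> = 2 * ((15 * t - t^3) / (15 - 6 * t\<^sup>2)) + 1 / t - 4 * t"
    proof -
      have nz: "15 - 6 * t\<^sup>2 \<noteq> 0" "t \<noteq> 0" using w assms by auto
      show ?thesis using nz
        by (simp add: divide_simps) (simp add: algebra_simps power2_eq_square power3_eq_cube power4_eq_xxxx)
    qed
    finally show ?thesis by simp
  qed
  ultimately show ?thesis by linarith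
qed

section \<open>The latitude distribution\<close>

lemma sin_ge_cubic:
  fixes x :: real
  assumes "0 \<le> x"
  shows "x - x^3 / 6 \<le> sin x"
proof -
  have c: "1 - y\<^sup>2 / 2 \<le> cos y" if "0 \<le> y" for y :: real
  proof -
    have "cos 0 + 0\<^sup>2 / 2 \<le> cos y + y\<^sup>2 / 2"
    proof (rule DERIV_nonneg_imp_nondecreasing[OF that])
      fix z :: real assume "0 \<le> z"
      then show "\<exists>w. ((\<lambda>y. cos y + y\<^sup>2 / 2) has_real_derivative w) (at z) \<and> 0 \<le> w"
        by (intro exI[of _ "z - sin z"]) (auto intro!: derivative_eq_intros simp: sin_x_le_x)
    qed
    then show ?thesis by simp
  qed
  have "sin 0 - (0 - 0^3/6) \<le> sin x - (x - x^3/6)"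
  proof (rule DERIV_nonneg_imp_nondecreasing[OF assms])
    fix z :: real assume "0 \<le> z"
    then show "\<exists>w. ((\<lambda>x. sin x - (x - x^3/6)) has_real_derivative w) (at z) \<and> 0 \<le> w"
      using c[of z] by (intro exI[of _ "cos z - (1 - z\<^sup>2 / 2)"]) (auto intro!: derivative_eq_intros)
  qed
  then show ?thesis by simp
qed

lemma cos_le_quartic:
  fixes x :: real
  assumes "0 \<le> x"
  shows "cos x \<le> 1 - x\<^sup>2 / 2 + x^4 / 24"
proof -
  have "1 - 0\<^sup>2 / 2 + 0^4 / 24 - cos 0 \<le> 1 - x\<^sup>2 / 2 + x^4 / 24 - cos x"
  proof (rule DERIV_nonneg_imp_nondecreasing[OF assms])
    fix z :: real assume "0 \<le> z"
    then show "\<exists>w. ((\<lambda>x. 1 - x\<^sup>2 / 2 + x^4 / 24 - cos x) has_real_derivative w) (at z) \<and> 0 \<le> w"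
      using sin_ge_cubic[of z]
      by (intro exI[of _ "sin z - (z - z^3 / 6)"]) (auto intro!: derivative_eq_intros)
  qed
  then show ?thesis by simp
qed

text \<open>Multiplied by 1 - sin t, this makes (1 - sin t) exp (3 t^2 / 2) decreasing, which is the
  Gaussian comparison for \<open>m = 1\<close>. Taylor polynomials reduce it to a cubic inequality
  on each of [0, 1] and [1, pi/2].\<close>

lemma three_mult_cos_le:
  fixes t :: real
  assumes "0 \<le> t" "t \<le> pi/2"
  shows "3 * t * cos t \<le> 1 + sin t"
proof -
  have t2: "t\<^sup>2 \<le> 2.5"
  proof -
    have "t \<le> 1571/1000" using assms pi_half_bounds by linarith
    then have "t * t \<le> 1571/1000 * (1571/1000)" using assms by (intro mult_mono) auto
    then show ?thesis by (simp add: power2_eq_square)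
  qed
  have "3 * t * cos t \<le> 3 * t * (1 - t\<^sup>2 / 2 + t^4 / 24)"
    using assms cos_le_quartic[of t] by (intro mult_left_mono) auto
  also have "\<dots> = 3 * t - 3/2 * t^3 + t^5 / 8"
    by (simp add: algebra_simps eval_nat_numeral)
  also have "\<dots> \<le> 1 + (t - t^3 / 6)"
  proof (cases "t \<le> 1")
    case True
    then have "t\<^sup>2 \<le> 1" using assms by (simp add: power_le_one)
    then have "t^3 * (t\<^sup>2 / 8) \<le> t^3 * (1/8)" using assms by (intro mult_left_mono) auto
    also have "t^3 * (t\<^sup>2 / 8) = t^5 / 8" by (simp add: eval_nat_numeral)
    finally have 1: "t^5 / 8 \<le> t^3 / 8" by simp
    \<comment> \<open>With t^5 <= t^3 it remains to show 29/24 t^3 >= 2 t - 1. The cubic t^3 is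
      replaced by its tangent at 743/1000, close to the minimizer sqrt (16/29) of the
      difference.\<close>
    have "0 \<le> (t - 743/1000)\<^sup>2 * (t + 1486/1000)" using assms by simp
    also have "\<dots> = t^3 - 1656147/1000000 * t + 820344814/1000000000"
      by (simp add: power2_eq_square power3_eq_cube field_simps)
    finally have "t^3 \<ge> 1656147/1000000 * t - 820345/1000000" by linarith
    then show ?thesis using 1 assms True by linarith
  next
    case False
    have "t^3 * (t\<^sup>2 / 8) \<le> t^3 * (5/16)" using assms t2 by (intro mult_left_mono) auto
    also have "t^3 * (t\<^sup>2 / 8) = t^5 / 8" by (simp add: eval_nat_numeral)
    finally have 1: "t^5 / 8 \<le> 5/16 * t^3" by simp
    have "0 \<le> (t - 1)\<^sup>2 * (t + 2)" using assms by simp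
    also have "\<dots> = t^3 - 3 * t + 2"
      by (simp add: power2_eq_square power3_eq_cube algebra_simps)
    finally have "t^3 \<ge> 3 * t - 2" by linarith
    then show ?thesis using 1 False by linarith
  qed
  also have "\<dots> \<le> 1 + sin t" using sin_ge_cubic assms by simp
  finally show ?thesis .
qed

section \<open>Cosine-power laws on the latitude interval; the exponent \<open>m\<close> belongs to
  dimension \<open>m + 2\<close>\<close>

definition lat_norm :: "nat \<Rightarrow> real" where
  "lat_norm m = integral {-(pi/2)..pi/2} (\<lambda>s. cos s ^ m)"

definition lat_density :: "nat \<Rightarrow> real \<Rightarrow> real" where
  "lat_density m s = cos s ^ m / lat_norm m"

definition lat_mean :: "nat \<Rightarrow> (real \<Rightarrow> real) \<Rightarrow> real" where
  "lat_mean m \<phi> = integral {-(pi/2)..pi/2} (\<lambda>s. \<phi> s * lat_density m s)"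

definition lat_tail :: "nat \<Rightarrow> real \<Rightarrow> real" where
  "lat_tail m x = integral {x..pi/2} (lat_density m)"

text \<open>The mean of (S - x)_+. By symmetry of the law, \<open>a + lat_excess m a\<close> is the
  mean of (a - S)_+, and it is in this form that the excess enters the deviation bounds.\<close>

definition lat_excess :: "nat \<Rightarrow> real \<Rightarrow> real" where
  "lat_excess m x = integral {x..pi/2} (\<lambda>s. (s - x) * lat_density m s)"

lemma cos_half_pi_nonneg: "x \<in> {-(pi/2)..pi/2} \<Longrightarrow> 0 \<le> cos x"
  by (auto intro: cos_ge_zero)

lemma lat_norm_pos: "lat_norm m > 0"
proof -
  have 1: "continuous_on {-(pi/2)..pi/2} (\<lambda>s::real. cos s ^ m)" by (intro continuous_intros)
  have nn: "0 \<le> cos x ^ m" if "x \<in> {-(pi/2)..pi/2}" for x :: real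
    using that by (intro zero_le_power cos_ge_zero) auto
  have "lat_norm m \<noteq> 0"
  proof
    assume "lat_norm m = 0"
    then have "\<forall>x\<in>{-(pi/2)..pi/2}. cos x ^ m = (0::real)"
      unfolding lat_norm_def using integral_eq_0_iff[OF 1 _ nn] by simp
    then have "cos 0 ^ m = (0::real)" by (rule bspec) auto
    then show False by simp
  qed
  moreover have "0 \<le> lat_norm m" unfolding lat_norm_def
    using 1 by (intro integral_nonneg integrable_continuous_interval) (auto intro: nn)
  ultimately show ?thesis by simp
qed

lemma continuous_on_lat_density [continuous_intros]: "continuous_on S (lat_density m)"
  unfolding lat_density_def[abs_def] using lat_norm_pos[of m] by (intro continuous_intros) auto

lemma lat_density_nonneg: "x \<in> {-(pi/2)..pi/2} \<Longrightarrow> 0 \<le> lat_density m x"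
  unfolding lat_density_def using lat_norm_pos[of m] by (simp add: cos_half_pi_nonneg)

lemma lat_density_minus [simp]: "lat_density m (- x) = lat_density m x"
  by (simp add: lat_density_def)

lemma integral_lat_density: "integral {-(pi/2)..pi/2} (lat_density m) = 1"
proof -
  have "integral {-(pi/2)..pi/2} (lat_density m) = lat_norm m / lat_norm m"
    unfolding lat_density_def[abs_def] lat_norm_def
    by simp
  then show ?thesis using lat_norm_pos[of m] by simp
qed

lemma lat_tail_has_derivative:
  assumes "x \<in> {-(pi/2)..pi/2}"
  shows "(lat_tail m has_real_derivative - lat_density m x) (at x within {-(pi/2)..pi/2})"
  unfolding lat_tail_def[abs_def] using assms
  by (intro integral_has_real_derivative' continuous_intros)

lemma continuous_on_lat_tail: "continuous_on {-(pi/2)..pi/2} (lat_tail m)"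
  by (rule DERIV_continuous_on) (rule lat_tail_has_derivative)

lemma lat_tail_has_derivative_at:
  assumes "-(pi/2) < x" "x < pi/2"
  shows "(lat_tail m has_real_derivative - lat_density m x) (at x)"
  using lat_tail_has_derivative[of x m] assms at_within_Icc_at[of "-(pi/2)" x "pi/2"] by simp

lemma lat_tail_bot [simp]: "lat_tail m (-(pi/2)) = 1"
  by (simp add: lat_tail_def integral_lat_density)

lemma lat_tail_top [simp]: "lat_tail m (pi/2) = 0"
  by (simp add: lat_tail_def)

lemma lat_tail_minus:
  assumes "x \<in> {-(pi/2)..pi/2}"
  shows "lat_tail m (- x) = 1 - lat_tail m x"
proof -
  have "integral {-(pi/2)..-x} (lat_density m) + integral {-x..pi/2} (lat_density m)
      = integral {-(pi/2)..pi/2} (lat_density m)"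
    using assms by (intro Henstock_Kurzweil_Integration.integral_combine integrable_continuous_interval continuous_intros) auto
  moreover have "integral {-(pi/2)..-x} (lat_density m) = integral {x..pi/2} (lat_density m)"
    using Henstock_Kurzweil_Integration.integral_reflect_real[of "pi/2" x "lat_density m"] by simp
  ultimately show ?thesis by (simp add: lat_tail_def integral_lat_density)
qed

lemma lat_tail_zero: "lat_tail m 0 = 1/2"
  using lat_tail_minus[of 0 m] by simp

lemma lat_tail_antimono:
  assumes "-(pi/2) \<le> x" "x \<le> y" "y \<le> pi/2"
  shows "lat_tail m y \<le> lat_tail m x"
  unfolding lat_tail_def using assms
  by (intro integral_subset_le integrable_continuous_interval continuous_intros) (auto intro!: lat_density_nonneg)

lemma lat_tail_nonneg:
  assumes "-(pi/2) \<le> x" "x \<le> pi/2"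
  shows "0 \<le> lat_tail m x"
  using lat_tail_antimono[of x "pi/2" m] assms by simp

section \<open>Comparison of the tail with a Gaussian\<close>

text \<open>The expression is the logarithm of the ratio of cos^m y to y exp (- (m + 2) y^2 / 2),
  which up to constants are the derivatives of the tail and of the Gaussian. For m = 2 its
  derivative is handled by \<open>two_tan_plus_inverse_ge\<close>; a larger m only subtracts (m - 2)
  (tan t - t).\<close>

lemma cos_ratio_antimono:
  fixes m :: nat and x y :: real
  assumes "2 \<le> m" "0 < x" "x \<le> y" "y < pi/2"
  shows "m * ln (cos y) + (m + 2) * y\<^sup>2 / 2 - ln y \<le> m * ln (cos x) + (m + 2) * x\<^sup>2 / 2 - ln x"
proof (rule DERIV_nonpos_imp_nonincreasing[OF assms(3), where f = "\<lambda>y. m * ln (cos y) + (m + 2) * y\<^sup>2 / 2 - ln y"])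
  fix t assume t: "x \<le> t" "t \<le> y"
  then have t': "0 < t" "t < pi/2" using assms by auto
  then have c: "cos t > 0" by (simp add: cos_gt_zero_pi)
  have "t * cos t \<le> sin t" using sin_ge_mult_cos[of t] t' by auto
  then have "t \<le> tan t" using c by (simp add: tan_def field_simps)
  then have "0 \<le> (real m - 2) * (tan t - t)" using assms by (intro mult_nonneg_nonneg) auto
  then have "- (m * tan t) + (m + 2) * t - 1/t \<le> 0"
    using two_tan_plus_inverse_ge[OF t'] by (simp add: algebra_simps)
  moreover have "((\<lambda>y. m * ln (cos y) + (m + 2) * y\<^sup>2 / 2 - ln y) has_real_derivative
      - (m * tan t) + (m + 2) * t - 1/t) (at t)"
    using c t' by (auto intro!: derivative_eq_intros simp: tan_def)
  ultimately show "\<exists>z. ((\<lambda>y. m * ln (cos y) + (m + 2) * y\<^sup>2 / 2 - ln y) has_real_derivative z) (at t) \<and> z \<le> 0"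
    by blast
qed

text \<open>The derivative of \<open>\<kappa> exp (-(m + 2) t\<^sup>2 / 2) - 2 lat_tail m t\<close> changes sign at most once, from plus to
  minus, because the ratio of the two densities is decreasing. For \<open>m = 1\<close> this fails, and
  \<open>2 lat_tail 1 t exp (3 t\<^sup>2 / 2)\<close> itself is decreasing instead.\<close>

lemma lat_tail_gaussian_propagate:
  fixes m :: nat and \<kappa> x x0 :: real
  assumes m: "2 \<le> m" and \<kappa>: "\<kappa> > 0" and x0: "0 \<le> x0"
    and start: "2 * lat_tail m x0 \<le> \<kappa> * exp (- ((m + 2) * x0\<^sup>2 / 2))"
    and x: "x0 \<le> x" "x \<le> pi/2"
  shows "2 * lat_tail m x \<le> \<kappa> * exp (- ((m + 2) * x\<^sup>2 / 2))"
proof (rule ccontr)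
  define F where "F t = \<kappa> * exp (- ((m + 2) * t\<^sup>2 / 2)) - 2 * lat_tail m t" for t :: real
  define F' where "F' t = 2 * lat_density m t - \<kappa> * ((m + 2) * t) * exp (- ((m + 2) * t\<^sup>2 / 2))" for t :: real
  have dF: "(F has_real_derivative F' t) (at t)" if "-(pi/2) < t" "t < pi/2" for t :: real
  proof -
    have e: "((\<lambda>t. - ((m + 2) * t\<^sup>2 / 2)) has_real_derivative - ((m + 2) * t)) (at t)"
      by (auto intro!: derivative_eq_intros)
    have "((\<lambda>t. \<kappa> * exp (- ((m + 2) * t\<^sup>2 / 2)) - 2 * lat_tail m t) has_real_derivative
        \<kappa> * (exp (- ((m + 2) * t\<^sup>2 / 2)) * - ((m + 2) * t)) - 2 * - lat_density m t) (at t)"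
      by (intro DERIV_diff DERIV_cmult DERIV_fun_exp e lat_tail_has_derivative_at that)
    then show ?thesis unfolding F_def[abs_def] F'_def by (simp add: algebra_simps)
  qed
  have cF: "continuous_on {-(pi/2)..pi/2} F"
    unfolding F_def[abs_def] by (intro continuous_intros continuous_on_lat_tail) auto
  \<comment> \<open>A negative value of \<open>F\<close> at x after a nonnegative one at x0 forces
    \<open>F'\<close> to be negative at some \<xi> in between. By the monotone ratio
    \<open>F'\<close> is nonpositive from there on, so \<open>F\<close> would stay negative up to
    pi/2, where the tail vanishes and \<open>F\<close> is positive.\<close>
  assume "\<not> ?thesis"
  then have neg: "F x < 0" by (simp add: F_def)
  have "F (pi/2) > 0" using \<kappa> by (simp add: F_def)
  then have xlt: "x < pi/2" using neg x by (cases "x = pi/2") auto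
  have "F x0 \<ge> 0" using start by (simp add: F_def)
  then have x0lt: "x0 < x" using neg x by (cases "x = x0") auto
  obtain \<xi> where \<xi>: "x0 < \<xi>" "\<xi> < x" "F x - F x0 = (x - x0) * F' \<xi>"
  proof -
    have "(F has_real_derivative F' t) (at t)" if "x0 \<le> t" "t \<le> x" for t
      using that x0 xlt pi_gt_zero by (intro dF) linarith+
    from MVT2[OF x0lt this] show ?thesis using that by blast
  qed
  have "F' \<xi> < 0"
  proof (rule ccontr)
    assume "\<not> F' \<xi> < 0"
    then have "0 \<le> (x - x0) * F' \<xi>" using x0lt by simp
    then show False using \<xi>(3) neg \<open>F x0 \<ge> 0\<close> by linarith
  qed
  have cpos: "cos t > 0" if "0 \<le> t" "t < pi/2" for t :: real using that by (simp add: cos_gt_zero_pi)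
  have key: "F' t \<le> 0 \<longleftrightarrow> m * ln (cos t) + (m + 2) * t\<^sup>2 / 2 - ln t \<le> ln (\<kappa> * (m + 2) * lat_norm m / 2)"
    if "0 < t" "t < pi/2" for t :: real
  proof -
    have c: "cos t > 0" using cpos that by auto
    have W: "lat_norm m > 0" by (rule lat_norm_pos)
    let ?K = "\<kappa> * (m + 2) * lat_norm m / 2"
    have K: "?K > 0" using \<kappa> W by simp
    have "F' t \<le> 0 \<longleftrightarrow> cos t ^ m \<le> ?K * t * exp (- ((m + 2) * t\<^sup>2 / 2))"
      unfolding F'_def lat_density_def using W by (simp add: field_simps)
    also have "\<dots> \<longleftrightarrow> ln (cos t ^ m) \<le> ln (?K * t * exp (- ((m + 2) * t\<^sup>2 / 2)))"
      using c K that by (intro ln_le_cancel_iff[symmetric] zero_less_power mult_pos_pos exp_gt_zero)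
    also have "ln (cos t ^ m) = m * ln (cos t)" using c by (simp add: ln_realpow)
    also have "ln (?K * t * exp (- ((m + 2) * t\<^sup>2 / 2))) = ln ?K + ln t - (m + 2) * t\<^sup>2 / 2"
    proof -
      have "ln (?K * t * exp (- ((m + 2) * t\<^sup>2 / 2))) = ln (?K * t) + ln (exp (- ((m + 2) * t\<^sup>2 / 2)))"
        by (rule ln_mult_pos) (use K that in auto)
      also have "ln (?K * t) = ln ?K + ln t" by (rule ln_mult_pos) (use K that in auto)
      finally show ?thesis by simp
    qed
    finally show ?thesis by (simp add: algebra_simps)
  qed
  have "F' t \<le> 0" if "\<xi> \<le> t" "t < pi/2" for t :: real
    using cos_ratio_antimono[OF m, of \<xi> t] key[of \<xi>] key[of t] that \<open>F' \<xi> < 0\<close> \<xi> x0 by simp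
  then have F'neg: "F' t \<le> 0" if "x < t" "t < pi/2" for t :: real using that \<xi> by simp
  have "F (pi/2) \<le> F x"
  proof (rule DERIV_nonpos_imp_decreasing_open[OF x(2)])
    show "\<exists>z. (F has_real_derivative z) (at t) \<and> z \<le> 0" if "x < t" "t < pi/2" for t :: real
    proof (intro exI conjI)
      have "-(pi/2) < t" using that x x0 pi_gt_zero by linarith
      then show "(F has_real_derivative F' t) (at t)" using that by (intro dF)
    qed (use F'neg that in auto)
    show "continuous_on {x..pi/2} F"
      by (rule continuous_on_subset[OF cF]) (use x x0 pi_gt_zero in auto)
  qed
  with neg \<open>F (pi/2) > 0\<close> show False by simp
qed

lemma lat_norm_1: "lat_norm 1 = 2"
proof -
  have "((\<lambda>s. cos s) has_integral (sin (pi/2) - sin (-(pi/2)))) {-(pi/2)..pi/2}"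
    by (intro fundamental_theorem_of_calculus)
       (auto intro!: derivative_eq_intros simp: has_real_derivative_iff_has_vector_derivative[symmetric])
  then show ?thesis by (simp add: lat_norm_def integral_unique)
qed

lemma lat_tail_1:
  assumes "x \<le> pi/2"
  shows "lat_tail 1 x = (1 - sin x) / 2"
proof -
  have "((\<lambda>s. cos s / 2) has_integral (sin (pi/2) / 2 - sin x / 2)) {x..pi/2}"
    using assms by (intro fundamental_theorem_of_calculus)
       (auto intro!: derivative_eq_intros simp: has_real_derivative_iff_has_vector_derivative[symmetric])
  then show ?thesis
    unfolding lat_tail_def lat_density_def[abs_def] power_one_right lat_norm_1
    by (simp only: integral_unique sin_pi_half diff_divide_distrib)
qed

lemma one_minus_sin_gaussian_antimono:
  fixes x y :: real
  assumes "0 \<le> x" "x \<le> y" "y \<le> pi/2"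
  shows "(1 - sin y) * exp (3 * y\<^sup>2 / 2) \<le> (1 - sin x) * exp (3 * x\<^sup>2 / 2)"
proof (rule DERIV_nonpos_imp_nonincreasing[OF assms(2), where f = "\<lambda>y. (1 - sin y) * exp (3 * y\<^sup>2 / 2)"])
  fix t assume t: "x \<le> t" "t \<le> y"
  then have t': "0 \<le> t" "t \<le> pi/2" using assms by auto
  \<comment> \<open>Multiplying \<open>three_mult_cos_le\<close> by 1 - sin t leaves a factor cos t
    to cancel. It vanishes at pi/2, where both sides are 0.\<close>
  have "3 * t * (1 - sin t) \<le> cos t"
  proof (cases "t = pi/2")
    case False
    then have c: "cos t > 0" using t' by (simp add: cos_gt_zero_pi)
    have "(3 * t * cos t) * (1 - sin t) \<le> (1 + sin t) * (1 - sin t)"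
      using three_mult_cos_le[OF t'] by (intro mult_right_mono) auto
    also have "\<dots> = cos t * cos t"
      using sin_cos_squared_add[of t] by (simp add: power2_eq_square algebra_simps)
    finally have "cos t * (3 * t * (1 - sin t)) \<le> cos t * cos t" by (simp add: algebra_simps)
    then show ?thesis using c by (simp only: mult_le_cancel_left_pos)
  next
    case True
    show ?thesis unfolding True by simp
  qed
  then have "(3 * t * (1 - sin t) - cos t) * exp (3 * t\<^sup>2 / 2) \<le> 0"
    by (intro mult_nonpos_nonneg) auto
  moreover have "((\<lambda>y. (1 - sin y) * exp (3 * y\<^sup>2 / 2)) has_real_derivative
      (3 * t * (1 - sin t) - cos t) * exp (3 * t\<^sup>2 / 2)) (at t)"
    by (auto intro!: derivative_eq_intros simp: algebra_simps)
  ultimately show "\<exists>z. ((\<lambda>y. (1 - sin y) * exp (3 * y\<^sup>2 / 2)) has_real_derivative z) (at t) \<and> z \<le> 0"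
    by blast
qed

lemma lat_tail_1_gaussian_propagate:
  assumes x0: "0 \<le> x0" and start: "2 * lat_tail 1 x0 \<le> \<kappa> * exp (- (3 * x0\<^sup>2 / 2))"
    and x: "x0 \<le> x" "x \<le> pi/2"
  shows "2 * lat_tail 1 x \<le> \<kappa> * exp (- (3 * x\<^sup>2 / 2))"
proof -
  have "(1 - sin x) * exp (3 * x\<^sup>2 / 2) \<le> (1 - sin x0) * exp (3 * x0\<^sup>2 / 2)"
    using assms by (intro one_minus_sin_gaussian_antimono) auto
  also have "\<dots> \<le> \<kappa> * exp (- (3 * x0\<^sup>2 / 2)) * exp (3 * x0\<^sup>2 / 2)"
    using start x lat_tail_1[of x0] by (intro mult_right_mono) (simp_all del: One_nat_def)
  also have "\<dots> = \<kappa>" by (simp add: mult.assoc flip: exp_add)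
  finally have "(1 - sin x) * exp (3 * x\<^sup>2 / 2) * exp (- (3 * x\<^sup>2 / 2)) \<le> \<kappa> * exp (- (3 * x\<^sup>2 / 2))"
    by (intro mult_right_mono) auto
  moreover have "(1 - sin x) * exp (3 * x\<^sup>2 / 2) * exp (- (3 * x\<^sup>2 / 2)) = 1 - sin x"
    by (simp add: mult.assoc flip: exp_add)
  ultimately show ?thesis using lat_tail_1[of x] x by (simp del: One_nat_def)
qed

text \<open>A bound at a single point spreads to all larger latitudes. Two starting points are used:
  the equator, where \<open>\<kappa> = 1\<close> gives equality, and
  \<open>9/25 / sqrt (m + 2)\<close>, from which on the constant 43/50 is available.\<close>

lemma lat_tail_propagate:
  fixes m :: nat and \<kappa> x x0 :: real
  assumes "1 \<le> m" "\<kappa> > 0" "0 \<le> x0"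
    "2 * lat_tail m x0 \<le> \<kappa> * exp (- ((m + 2) * x0\<^sup>2 / 2))"
    "x0 \<le> x" "x \<le> pi/2"
  shows "2 * lat_tail m x \<le> \<kappa> * exp (- ((m + 2) * x\<^sup>2 / 2))"
proof (cases "m = 1")
  case True
  then show ?thesis using lat_tail_1_gaussian_propagate[of x0 \<kappa> x] assms by simp
next
  case False
  then show ?thesis using lat_tail_gaussian_propagate[of m \<kappa> x0 x] assms by simp
qed

lemma lat_tail_le_gaussian:
  fixes m :: nat and x :: real
  assumes "1 \<le> m" "0 \<le> x" "x \<le> pi/2"
  shows "2 * lat_tail m x \<le> exp (- ((m + 2) * x\<^sup>2 / 2))"
  using lat_tail_propagate[of m 1 0 x] assms by (simp add: lat_tail_zero)

lemma lat_norm_le: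
  assumes "1 \<le> m"
  shows "lat_norm m \<le> sqrt (2 * pi / m)"
proof -
  have "integral {0..pi/2} (\<lambda>s. cos s ^ m) / lat_norm m = 1/2"
    using lat_tail_zero[of m] by (simp add: lat_tail_def lat_density_def[abs_def])
  then have "lat_norm m = 2 * integral {0..pi/2} (\<lambda>s. cos s ^ m)"
    using lat_norm_pos[of m] by (simp add: field_simps)
  also have "integral {0..pi/2} (\<lambda>s. cos s ^ m) \<le> integral {0..pi/2} (\<lambda>s. exp (- (m / 2 * s\<^sup>2)))"
  proof (intro integral_le integrable_continuous_interval continuous_intros)
    fix s :: real assume s: "s \<in> {0..pi/2}"
    then have "cos s ^ m \<le> exp (- s\<^sup>2 / 2) ^ m"
      by (intro power_mono cos_le_exp_neg_square cos_ge_zero) auto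
    then show "cos s ^ m \<le> exp (- (m / 2 * s\<^sup>2))"
      by (simp add: exp_of_nat_mult[symmetric])
  qed
  also have "\<dots> \<le> sqrt (pi / (m / 2)) / 2"
    using assms by (intro gaussian_integral_le) auto
  finally show ?thesis by (simp add: mult.commute)
qed

text \<open>Integrates cos^m s >= (1 - s^2/2)^m >= 1 - m s^2/2 from the equator, where the tail is
  1/2. It supplies the starting value for the strict Gaussian bound.\<close>

lemma lat_tail_le_bernoulli:
  assumes "0 \<le> x" "x \<le> 1"
  shows "2 * lat_tail m x \<le> 1 - 2 / lat_norm m * (x - m * x^3 / 6)"
proof -
  have x2: "x \<le> pi/2" using assms pi_half_bounds by linarith
  have 1: "integral {0..x} (\<lambda>s. 1 - m * s\<^sup>2 / 2) = x - m * x^3 / 6"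
  proof -
    have "((\<lambda>s. 1 - m * s\<^sup>2 / 2) has_integral ((x - m * x^3/6) - (0 - real m * 0^3/6))) {0..x}"
      using assms by (intro fundamental_theorem_of_calculus)
       (auto intro!: derivative_eq_intros simp: has_real_derivative_iff_has_vector_derivative[symmetric])
    then show ?thesis by (simp add: integral_unique)
  qed
  have "integral {0..x} (\<lambda>s. 1 - m * s\<^sup>2 / 2) \<le> integral {0..x} (\<lambda>s. cos s ^ m)"
  proof (intro integral_le integrable_continuous_interval continuous_intros)
    fix s :: real assume s: "s \<in> {0..x}"
    then have "s\<^sup>2 \<le> 1" using assms by (simp add: power_le_one)
    then have "1 + m * (- s\<^sup>2 / 2) \<le> (1 + (- s\<^sup>2 / 2)) ^ m"
      by (intro Bernoulli_inequality) simp
    also have "\<dots> \<le> cos s ^ m"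
    proof (intro power_mono)
      have "(sin (s/2))\<^sup>2 \<le> (s/2)\<^sup>2"
        using abs_sin_x_le_abs_x[of "s/2"] by (simp only: abs_le_square_iff)
      then show "1 + - s\<^sup>2 / 2 \<le> cos s" using cos_double_sin[of "s/2"] by (simp add: power_divide)
    qed (use \<open>s\<^sup>2 \<le> 1\<close> in simp)
    finally show "1 - m * s\<^sup>2 / 2 \<le> cos s ^ m" by simp
  qed auto
  moreover have "integral {0..x} (lat_density m) = integral {0..x} (\<lambda>s. cos s ^ m) / lat_norm m"
    by (simp add: lat_density_def[abs_def])
  ultimately have "(x - m * x^3 / 6) / lat_norm m \<le> integral {0..x} (lat_density m)"
    using 1 lat_norm_pos[of m] by (simp add: divide_right_mono)
  moreover have "integral {0..x} (lat_density m) + lat_tail m x = lat_tail m 0"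
    unfolding lat_tail_def using assms x2
    by (intro Henstock_Kurzweil_Integration.integral_combine integrable_continuous_interval continuous_intros) auto
  moreover have "2 / lat_norm m * (x - m * x^3 / 6) = 2 * ((x - m * x^3 / 6) / lat_norm m)" by simp
  ultimately show ?thesis using lat_tail_zero[of m] by linarith
qed

text \<open>The constants serve \<open>lat_tail_two_sided_aux\<close>: 9/25 + 63/100 < 1 keeps the
  level a beyond the starting point there, and 43/50 = 1 - 14/100 <= exp (- 14/100) absorbs a factor
  exp (14/100).\<close>

lemma lat_tail_le_strict_gaussian:
  fixes m :: nat and x :: real
  assumes m: "1 \<le> m" and x: "9/25 / sqrt (m + 2) \<le> x" "x \<le> pi/2"
  shows "2 * lat_tail m x \<le> 43/50 * exp (- ((m + 2) * x\<^sup>2 / 2))"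
proof (rule lat_tail_propagate[OF m _ _ _ x])
  define x0 where "x0 = 9/25 / sqrt (m + 2)"
  have x0: "0 \<le> x0" by (simp add: x0_def)
  have x0sq: "(m + 2) * x0\<^sup>2 = 81/625" 
  proof -
    have nz: "real (m + 2) \<noteq> 0" by linarith
    have g: "r * (c / r) = c" if "r \<noteq> 0" for r c :: real using that by simp
    have "x0\<^sup>2 = 81/625 / real (m + 2)" by (simp add: x0_def power_divide)
    then show ?thesis using g[OF nz] by (simp only:)
  qed
  have "x0\<^sup>2 \<le> 1"
  proof -
    have "1 * x0\<^sup>2 \<le> (m + 2) * x0\<^sup>2" by (intro mult_right_mono) auto
    then show ?thesis using x0sq by simp
  qed
  then have x01: "x0 \<le> 1" by (simp add: abs_square_le_1)
  \<comment> \<open>At the starting point twice the tail must not exceed 43/50 (1 - 81/1250) =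
    0.804272. The linear term and the cubic correction give a decrease from 1 of at least 0.2025 *
    0.9784.\<close>
  have "0.1958 \<le> 2 / lat_norm m * (x0 - m * x0^3 / 6)"
  proof -
    have f: "x0 - m * x0^3 / 6 = x0 * (1 - m * x0\<^sup>2 / 6)"
      by (simp add: algebra_simps power2_eq_square power3_eq_cube)
    have "m * x0\<^sup>2 \<le> (m + 2) * x0\<^sup>2" by (intro mult_right_mono) auto
    then have b: "0.9784 \<le> 1 - m * x0\<^sup>2 / 6" using x0sq by simp
    have W: "lat_norm m > 0" by (rule lat_norm_pos)
    have a: "0.2025 \<le> 2 / lat_norm m * x0"
    \<comment> \<open>For m = 1 the bound \<open>lat_norm_le\<close> would give only about 0.166, so
      the exact norm 2 is used. For m >= 2 the ratio (m + 2)/m is at most 2.\<close>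
    proof (cases "m = 1")
      case True
      have "sqrt 3 \<le> 1.74" by (rule real_le_lsqrt) (auto simp: power2_eq_square)
      then show ?thesis using True by (simp add: x0_def lat_norm_1[simplified] field_simps)
    next
      case False
      have "sqrt (2 * pi / m) * sqrt (m + 2) = sqrt (2 * pi * ((m + 2) / m))"
        by (simp add: real_sqrt_mult[symmetric])
      also have "\<dots> \<le> sqrt (2 * 3.1416 * 2)"
        using m False pi_approx by (intro real_sqrt_le_mono mult_mono) (auto simp: field_simps)
      also have "\<dots> \<le> 3.5499" by (rule real_le_lsqrt) (auto simp: power2_eq_square)
      finally have *: "sqrt (2 * pi / m) * sqrt (m + 2) \<le> 3.5499" .
      have "lat_norm m * sqrt (m + 2) \<le> sqrt (2 * pi / m) * sqrt (m + 2)"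
        using lat_norm_le[OF m] by (intro mult_right_mono) auto
      with * have **: "lat_norm m * sqrt (m + 2) \<le> 3.5499" by linarith
      have "0.2025 \<le> 0.72 / (3.5499::real)" by simp
      also have "0.72 / 3.5499 \<le> 0.72 / (lat_norm m * sqrt (m + 2))"
        using ** W by (intro divide_left_mono) (auto intro!: mult_pos_pos add_nonneg_pos)
      also have "\<dots> = 2 / lat_norm m * x0" by (simp add: x0_def)
      finally show ?thesis .
    qed
    have "0.1958 \<le> 0.2025 * (0.9784::real)" by simp
    also have "\<dots> \<le> (2 / lat_norm m * x0) * (1 - m * x0\<^sup>2 / 6)"
      using a b by (intro mult_mono) auto
    finally show ?thesis unfolding f by simp
  qed
  then have 1: "2 * lat_tail m x0 \<le> 1 - 0.1958"
    using lat_tail_le_bernoulli[OF x0 x01, of m] by linarith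
  have "1 + (- (81/1250)) \<le> exp (- (81/1250::real))" by (rule exp_ge_add_one_self)
  then have "1 - 0.1958 \<le> 43/50 * exp (- ((m + 2) * x0\<^sup>2 / 2))"
    unfolding x0sq by simp
  then show "2 * lat_tail m (9/25 / sqrt (m + 2)) \<le> 43/50 * exp (- ((m + 2) * (9/25 / sqrt (m + 2))\<^sup>2 / 2))"
    using 1 unfolding x0_def by linarith
qed auto

section \<open>Moments and mean excess of the latitude\<close>

text \<open>The function cos^(m+1) sin^(k+1) vanishes at both ends, so its derivative integrates to
  0. With n = m + 2 this is the recursion of \<open>zonal_moment_Suc_Suc\<close>, which identifies
  the two laws; k = 0 gives the exact second moment of sin.\<close>

lemma lat_mean_sin_power_Suc_Suc:
  "(m + 2 + k) * lat_mean m (\<lambda>s. sin s ^ (k + 2)) = (k + 1) * lat_mean m (\<lambda>s. sin s ^ k)"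
proof -
  let ?I = "{-(pi/2)..pi/2}"
  let ?h = "\<lambda>s::real. (k + 1) * (sin s ^ k * cos s ^ m) - (m + 2 + k) * (sin s ^ (k + 2) * cos s ^ m)"
  have "(?h has_integral (cos (pi/2) ^ (m + 1) * sin (pi/2) ^ (k + 1)
      - cos (-(pi/2)) ^ (m + 1) * sin (-(pi/2)) ^ (k + 1))) ?I"
  proof (rule fundamental_theorem_of_calculus)
    fix s :: real assume "s \<in> ?I"
    have c2: "cos s * cos s = 1 - sin s * sin s"
      using sin_cos_squared_add[of s] by (simp add: power2_eq_square algebra_simps)
    have "(real (m + 1) * cos s ^ m * (- sin s)) * sin s ^ (k + 1) + (real (k + 1) * sin s ^ k * cos s) * cos s ^ (m + 1)
        = - (real (m + 1)) * (sin s ^ (k + 2) * cos s ^ m) + real (k + 1) * (sin s ^ k * cos s ^ m) * (cos s * cos s)"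
      by (simp add: algebra_simps)
    also have "\<dots> = ?h s" unfolding c2 by (simp add: algebra_simps)
    finally have e: "?h s = (real (m + 1) * cos s ^ m * (- sin s)) * sin s ^ (k + 1) + (real (k + 1) * sin s ^ k * cos s) * cos s ^ (m + 1)" ..
    have "((\<lambda>s. cos s ^ (m + 1) * sin s ^ (k + 1)) has_real_derivative ?h s) (at s within ?I)"
      unfolding e
      by (rule derivative_eq_intros refl)+ (simp add: algebra_simps)
    then show "((\<lambda>s. cos s ^ (m + 1) * sin s ^ (k + 1)) has_vector_derivative ?h s) (at s within ?I)"
      by (simp only: has_real_derivative_iff_has_vector_derivative)
  qed simp
  then have "integral ?I ?h = 0" by (simp add: integral_unique)
  moreover have "integral ?I ?h = (k + 1) * integral ?I (\<lambda>s. sin s ^ k * cos s ^ m)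
      - (m + 2 + k) * integral ?I (\<lambda>s. sin s ^ (k + 2) * cos s ^ m)"
    by (subst Henstock_Kurzweil_Integration.integral_diff)
       (auto intro!: integrable_continuous_interval continuous_intros)
  ultimately have "(m + 2 + k) * integral ?I (\<lambda>s. sin s ^ (k + 2) * cos s ^ m)
      = (k + 1) * integral ?I (\<lambda>s. sin s ^ k * cos s ^ m)" by linarith
  moreover have "lat_mean m (\<lambda>s. sin s ^ j) = integral ?I (\<lambda>s. sin s ^ j * cos s ^ m) / lat_norm m" for j
    by (simp add: lat_mean_def lat_density_def)
  ultimately show ?thesis by (simp only: times_divide_eq_right of_nat_add of_nat_numeral of_nat_1)
qed

lemma jordan_sin_ge:
  fixes s :: real
  assumes "0 \<le> s" "s \<le> pi/2"
  shows "s \<le> pi/2 * sin s"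
proof (cases "s = 0")
  case False
  then have s: "0 < s" using assms by simp
  have "sin (pi/2) / (pi/2) \<le> sin s / s"
  proof (rule DERIV_nonpos_imp_nonincreasing[OF assms(2), where f = "\<lambda>s. sin s / s"])
    fix t assume t: "s \<le> t" "t \<le> pi/2"
    then have "t * cos t \<le> sin t" using s by (intro sin_ge_mult_cos) auto
    then have "(t * cos t - sin t) / t\<^sup>2 \<le> 0" by (simp add: divide_nonpos_nonneg)
    moreover have "((\<lambda>s. sin s / s) has_real_derivative (t * cos t - sin t) / t\<^sup>2) (at t)"
      using t s by (auto intro!: derivative_eq_intros simp: power2_eq_square algebra_simps)
    ultimately show "\<exists>z. ((\<lambda>s. sin s / s) has_real_derivative z) (at t) \<and> z \<le> 0" by blast
  qed
  then show ?thesis using s by (simp add: field_simps)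
qed simp

text \<open>Jordan's inequality replaces s^2 by (pi/2 sin s)^2, whose mean over the full interval is
  exactly pi^2 / (4 (m + 2)); half of it falls on [0, pi/2].\<close>

lemma lat_second_moment_le:
  "integral {0..pi/2} (\<lambda>s. s\<^sup>2 * lat_density m s) \<le> pi\<^sup>2 / (8 * (m + 2))"
proof -
  let ?g = "\<lambda>s. (sin s)\<^sup>2 * lat_density m s"
  have "integral {0..pi/2} (\<lambda>s. s\<^sup>2 * lat_density m s) \<le> integral {0..pi/2} (\<lambda>s. (pi/2)\<^sup>2 * ?g s)"
  proof (intro integral_le integrable_continuous_interval continuous_intros)
    fix s assume s: "s \<in> {0..pi/2}"
    have "s\<^sup>2 \<le> (pi/2 * sin s)\<^sup>2"
      using s jordan_sin_ge[of s] by (intro power_mono) auto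
    then have "s\<^sup>2 * lat_density m s \<le> (pi/2 * sin s)\<^sup>2 * lat_density m s"
      using s by (intro mult_right_mono lat_density_nonneg) auto
    then show "s\<^sup>2 * lat_density m s \<le> (pi/2)\<^sup>2 * ?g s"
      by (simp only: power_mult_distrib mult.assoc)
  qed
  also have "\<dots> = (pi/2)\<^sup>2 * integral {0..pi/2} ?g" by simp
  also have "integral {0..pi/2} ?g = 1 / (2 * (m + 2))"
  proof -
    have "integral {-(pi/2)..0} ?g + integral {0..pi/2} ?g = integral {-(pi/2)..pi/2} ?g"
      by (intro Henstock_Kurzweil_Integration.integral_combine integrable_continuous_interval continuous_intros) auto
    moreover have "integral {-(pi/2)..0} ?g = integral {0..pi/2} ?g"
      using Henstock_Kurzweil_Integration.integral_reflect_real[of "pi/2" 0 ?g] by simp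
    moreover have "(m + 2) * integral {-(pi/2)..pi/2} ?g = 1"
      using lat_mean_sin_power_Suc_Suc[of m 0] by (simp add: lat_mean_def integral_lat_density numeral_2_eq_2 add.commute)
    ultimately have "(m + 2) * (2 * integral {0..pi/2} ?g) = 1" by simp
    then show ?thesis by (simp add: field_simps)
  qed
  finally show ?thesis by (simp add: power_divide)
qed

lemma lat_excess_nonneg:
  assumes "x \<in> {-(pi/2)..pi/2}"
  shows "0 \<le> lat_excess m x"
  unfolding lat_excess_def using assms
  by (intro integral_nonneg integrable_continuous_interval continuous_intros mult_nonneg_nonneg lat_density_nonneg) auto

lemma lat_excess_antimono:
  assumes "-(pi/2) \<le> x" "x \<le> y" "y \<le> pi/2"
  shows "lat_excess m y \<le> lat_excess m x"
proof -
  have "lat_excess m y \<le> integral {y..pi/2} (\<lambda>s. (s - x) * lat_density m s)"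
    unfolding lat_excess_def using assms
    by (intro integral_le integrable_continuous_interval continuous_intros mult_right_mono lat_density_nonneg) auto
  also have "\<dots> \<le> lat_excess m x"
    unfolding lat_excess_def using assms
    by (intro integral_subset_le integrable_continuous_interval continuous_intros)
       (auto intro!: mult_nonneg_nonneg lat_density_nonneg)
  finally show ?thesis .
qed

text \<open>The excess is convex with slope \<open>- lat_tail m x\<close> at x; this is its
  supporting line there.\<close>

lemma lat_excess_ge_linear:
  assumes "-(pi/2) \<le> x" "x \<le> y" "y \<le> pi/2"
  shows "lat_excess m x - (y - x) * lat_tail m x \<le> lat_excess m y"
proof -
  let ?h = "\<lambda>s. (s - y) * lat_density m s"
  have "lat_excess m x - (y - x) * lat_tail m x = integral {x..pi/2} (\<lambda>s. (s - x) * lat_density m s - (y - x) * lat_density m s)"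
    unfolding lat_excess_def lat_tail_def
    by (subst Henstock_Kurzweil_Integration.integral_diff) (auto intro!: integrable_continuous_interval continuous_intros)
  also have "\<dots> = integral {x..pi/2} ?h" by (simp add: algebra_simps)
  also have "\<dots> = integral {x..y} ?h + integral {y..pi/2} ?h"
    using assms
    by (intro Henstock_Kurzweil_Integration.integral_combine[symmetric] integrable_continuous_interval continuous_intros) auto
  also have "integral {x..y} ?h \<le> integral {x..y} (\<lambda>s. 0)"
    using assms
    by (intro integral_le integrable_continuous_interval continuous_intros mult_nonpos_nonneg lat_density_nonneg) auto
  finally show ?thesis by (simp add: lat_excess_def)
qed

text \<open>Integrate (x - s)_+ = (x - s) + (s - x)_+ and use that the law is symmetric, hence
  centred.\<close>

lemma lat_excess_minus:
  assumes "x \<in> {-(pi/2)..pi/2}"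
  shows "lat_excess m (- x) = x + lat_excess m x"
proof -
  let ?h = "\<lambda>s. (x - s) * lat_density m s"
  have "lat_excess m (- x) = integral {-(pi/2)..x} ?h"
    unfolding lat_excess_def
    using Henstock_Kurzweil_Integration.integral_reflect_real[of x "-(pi/2)" ?h]
    by (simp add: add.commute)
  moreover have "integral {-(pi/2)..x} ?h + integral {x..pi/2} ?h = integral {-(pi/2)..pi/2} ?h"
    using assms by (intro Henstock_Kurzweil_Integration.integral_combine integrable_continuous_interval continuous_intros) auto
  moreover have "integral {x..pi/2} ?h = - lat_excess m x"
    unfolding lat_excess_def
    by (subst Henstock_Kurzweil_Integration.integral_neg[symmetric]) (simp add: algebra_simps)
  moreover have "integral {-(pi/2)..pi/2} ?h = x"
  proof -
    have "integral {-(pi/2)..pi/2} (\<lambda>s. s * lat_density m s) = - integral {-(pi/2)..pi/2} (\<lambda>s. s * lat_density m s)"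
      using Henstock_Kurzweil_Integration.integral_reflect_real[of "pi/2" "-(pi/2)" "\<lambda>s. s * lat_density m s"]
      by simp
    moreover have "integral {-(pi/2)..pi/2} ?h = integral {-(pi/2)..pi/2} (\<lambda>s. x * lat_density m s)
        - integral {-(pi/2)..pi/2} (\<lambda>s. s * lat_density m s)"
      unfolding left_diff_distrib
      by (rule Henstock_Kurzweil_Integration.integral_diff) (auto intro!: integrable_continuous_interval continuous_intros)
    ultimately show ?thesis by (simp add: integral_lat_density)
  qed
  ultimately show ?thesis by simp
qed

text \<open>Cauchy-Schwarz for s - x on {s >= x}, followed by (s - x)^2 <= s^2 and the second moment
  bound. Keeping the tail as a factor is what settles levels below the equator in
  \<open>lat_tail_one_sided\<close>.\<close>

lemma lat_excess_square_le:
  assumes "0 \<le> x" "x \<le> pi/2"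
  shows "(lat_excess m x)\<^sup>2 \<le> lat_tail m x * (pi\<^sup>2 / (8 * (m + 2)))"
proof -
  let ?k = "lat_excess m x" and ?Q = "lat_tail m x" and ?B = "integral {x..pi/2} (\<lambda>s. (s - x)\<^sup>2 * lat_density m s)"
  have sub: "{x..pi/2} \<subseteq> {-(pi/2)..pi/2}" using assms by auto
  \<comment> \<open>This quadratic in c is evaluated at c = \<open>?k / ?Q\<close>. A vanishing tail
    is treated apart: then \<open>kQ\<close> makes the excess vanish too.\<close>
  have quad: "0 \<le> ?B - 2 * c * ?k + c\<^sup>2 * ?Q" for c
  proof -
    have "0 \<le> integral {x..pi/2} (\<lambda>s. (s - x - c)\<^sup>2 * lat_density m s)"
      using sub by (intro integral_nonneg integrable_continuous_interval continuous_intros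
         mult_nonneg_nonneg lat_density_nonneg) auto
    also have "\<dots> = integral {x..pi/2} (\<lambda>s. (s - x)\<^sup>2 * lat_density m s
        - 2 * c * ((s - x) * lat_density m s) + c\<^sup>2 * lat_density m s)"
      by (intro arg_cong[where f="integral _"] ext) (simp add: power2_eq_square algebra_simps)
    also have "\<dots> = ?B - 2 * c * ?k + c\<^sup>2 * ?Q"
      unfolding lat_excess_def lat_tail_def
      by (subst Henstock_Kurzweil_Integration.integral_add Henstock_Kurzweil_Integration.integral_diff;
          (subst Henstock_Kurzweil_Integration.integral_diff)?)
         (auto intro!: integrable_continuous_interval continuous_intros)
    finally show ?thesis .
  qed
  have Q: "0 \<le> ?Q" using assms by (intro lat_tail_nonneg) auto
  have k: "0 \<le> ?k" using assms by (intro lat_excess_nonneg) auto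
  have kQ: "?k \<le> pi/2 * ?Q"
  proof -
    have "?k \<le> integral {x..pi/2} (\<lambda>s. pi/2 * lat_density m s)"
      unfolding lat_excess_def using assms sub
      by (intro integral_le integrable_continuous_interval continuous_intros mult_right_mono lat_density_nonneg) auto
    then show ?thesis by (simp add: lat_tail_def)
  qed
  have "?k\<^sup>2 \<le> ?Q * ?B"
  proof (cases "?Q = 0")
    case True
    then show ?thesis using kQ k by simp
  next
    case False
    then have Qp: "?Q > 0" using Q by simp
    have "0 \<le> ?Q * (?B - 2 * (?k / ?Q) * ?k + (?k / ?Q)\<^sup>2 * ?Q)"
      using quad[of "?k / ?Q"] Q by simp
    also have "\<dots> = ?Q * ?B - ?k\<^sup>2"
      using Qp by (simp add: field_simps power2_eq_square)
    finally show ?thesis by simp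
  qed
  also have "?B \<le> integral {0..pi/2} (\<lambda>s. s\<^sup>2 * lat_density m s)"
  proof -
    have "?B \<le> integral {x..pi/2} (\<lambda>s. s\<^sup>2 * lat_density m s)"
      using assms sub
      by (intro integral_le integrable_continuous_interval continuous_intros mult_right_mono lat_density_nonneg power_mono) auto
    also have "\<dots> \<le> integral {0..pi/2} (\<lambda>s. s\<^sup>2 * lat_density m s)"
      using assms
      by (intro integral_subset_le integrable_continuous_interval continuous_intros)
         (auto intro!: mult_nonneg_nonneg lat_density_nonneg)
    finally show ?thesis .
  qed
  also note lat_second_moment_le
  finally show ?thesis using Q by (simp add: mult_left_mono)
qed

lemma mult_lat_excess_le:
  assumes "0 \<le> x" "x \<le> pi/2"
  shows "x * lat_excess m x \<le> pi\<^sup>2 / (32 * (m + 2))"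
proof -
  have "x * lat_excess m x = integral {x..pi/2} (\<lambda>s. x * ((s - x) * lat_density m s))"
    by (simp add: lat_excess_def)
  also have "\<dots> \<le> integral {x..pi/2} (\<lambda>s. 1/4 * (s\<^sup>2 * lat_density m s))"
  proof (intro integral_le integrable_continuous_interval continuous_intros)
    fix s assume s: "s \<in> {x..pi/2}"
    have "0 \<le> (s - 2 * x)\<^sup>2" by simp
    then have "x * (s - x) \<le> 1/4 * s\<^sup>2" by (simp add: power2_eq_square algebra_simps)
    then have "x * (s - x) * lat_density m s \<le> 1/4 * s\<^sup>2 * lat_density m s"
      using s assms by (intro mult_right_mono lat_density_nonneg) auto
    then show "x * ((s - x) * lat_density m s) \<le> 1/4 * (s\<^sup>2 * lat_density m s)"
      by (simp only: mult.assoc)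
  qed
  also have "\<dots> = 1/4 * integral {x..pi/2} (\<lambda>s. s\<^sup>2 * lat_density m s)" by simp
  also have "\<dots> \<le> 1/4 * integral {0..pi/2} (\<lambda>s. s\<^sup>2 * lat_density m s)"
    using assms
    by (intro mult_left_mono integral_subset_le integrable_continuous_interval continuous_intros)
       (auto intro!: mult_nonneg_nonneg lat_density_nonneg)
  also have "\<dots> \<le> 1/4 * (pi\<^sup>2 / (8 * (m + 2)))"
    by (intro mult_left_mono lat_second_moment_le) auto
  finally show ?thesis by simp
qed

text \<open>Integration by parts turns the mean of s_+ into the integral of the tail over [0, pi/2],
  which the Gaussian bound estimates; 63/100 is sqrt (2 pi) / 4 rounded up.\<close>

lemma lat_excess_zero_le:
  assumes "1 \<le> m"
  shows "lat_excess m 0 \<le> 63/100 / sqrt (m + 2)"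
proof -
  have "((\<lambda>s. lat_tail m s - s * lat_density m s) has_integral
      (pi/2 * lat_tail m (pi/2) - 0 * lat_tail m 0)) {0..pi/2}"
  proof (rule fundamental_theorem_of_calculus)
    fix s assume s: "s \<in> {0..pi/2}"
    then have "(lat_tail m has_real_derivative - lat_density m s) (at s within {0..pi/2})"
      by (intro DERIV_subset[OF lat_tail_has_derivative]) auto
    then have "((\<lambda>s. s * lat_tail m s) has_real_derivative lat_tail m s - s * lat_density m s) (at s within {0..pi/2})"
      by (auto intro!: derivative_eq_intros)
    then show "((\<lambda>s. s * lat_tail m s) has_vector_derivative lat_tail m s - s * lat_density m s) (at s within {0..pi/2})"
      by (simp add: has_real_derivative_iff_has_vector_derivative)
  qed simp
  then have "integral {0..pi/2} (\<lambda>s. lat_tail m s - s * lat_density m s) = 0" by (simp add: integral_unique)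
  moreover have ct: "continuous_on {0..pi/2} (lat_tail m)"
    by (rule continuous_on_subset[OF continuous_on_lat_tail]) auto
  then have "integral {0..pi/2} (\<lambda>s. lat_tail m s - s * lat_density m s) = integral {0..pi/2} (lat_tail m) - lat_excess m 0"
    unfolding lat_excess_def
    by (subst Henstock_Kurzweil_Integration.integral_diff) (auto intro!: integrable_continuous_interval continuous_intros)
  ultimately have "lat_excess m 0 = integral {0..pi/2} (lat_tail m)" by simp
  also have "\<dots> \<le> integral {0..pi/2} (\<lambda>s. 1/2 * exp (- ((m + 2) / 2 * s\<^sup>2)))"
  proof (intro integral_le integrable_continuous_interval continuous_intros ct)
    fix s assume "s \<in> {0..pi/2}"
    then show "lat_tail m s \<le> 1/2 * exp (- ((m + 2) / 2 * s\<^sup>2))"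
      using lat_tail_le_gaussian[OF assms, of s] by simp
  qed
  also have "\<dots> = 1/2 * integral {0..pi/2} (\<lambda>s. exp (- ((m + 2) / 2 * s\<^sup>2)))" by simp
  also have "\<dots> \<le> 1/2 * (sqrt (pi / ((m + 2) / 2)) / 2)"
    by (intro mult_left_mono gaussian_integral_le) auto
  also have "sqrt (pi / ((m + 2) / 2)) = sqrt (2 * pi) / sqrt (m + 2)"
    by (simp add: real_sqrt_divide[symmetric] mult.commute)
  also have "1/2 * (sqrt (2 * pi) / sqrt (m + 2) / 2) = sqrt (2 * pi) / 4 / sqrt (m + 2)" by simp
  also have "\<dots> \<le> 63/100 / sqrt (m + 2)"
  proof (intro divide_right_mono)
    have "sqrt (2 * pi) \<le> 252/100"
      using pi_approx by (intro real_le_lsqrt) (auto simp: power2_eq_square)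
    then show "sqrt (2 * pi) / 4 \<le> 63/100" by simp
  qed simp
  finally show ?thesis .
qed

text \<open>Bounds from below the rate at which the tail decreases, for the case a < 0 of
  \<open>lat_tail_two_sided_aux\<close>. Since (s - x) cos s <= sin s, the excess is at most the
  density divided by m, and (m + 2)/2 <= m from m = 2 on. For m = 1 the excess is explicit, and
  Jordan's inequality with pi/2 <= 5/3 suffices.\<close>

lemma lat_excess_le_density:
  assumes m: "1 \<le> m" and x: "0 \<le> x" "x \<le> pi/2"
  shows "(m + 2) / 2 * lat_excess m x \<le> lat_density m x"
proof (cases "m = 1")
  case True
  have "((\<lambda>s. (s - x) * (cos s / 2)) has_integral
     (((pi/2 - x) * sin (pi/2) + cos (pi/2)) / 2 - ((x - x) * sin x + cos x) / 2)) {x..pi/2}"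
    using x by (intro fundamental_theorem_of_calculus)
       (auto intro!: derivative_eq_intros simp: has_real_derivative_iff_has_vector_derivative[symmetric])
  then have k: "lat_excess 1 x = (pi/2 - x) / 2 - cos x / 2"
    unfolding lat_excess_def lat_density_def power_one_right lat_norm_1
    by (simp only: integral_unique) (simp add: diff_divide_distrib)
  have "pi/2 - x \<le> pi/2 * sin (pi/2 - x)" using x by (intro jordan_sin_ge) auto
  also have "sin (pi/2 - x) = cos x" by (simp add: sin_diff)
  also have "pi/2 * cos x \<le> 5/3 * cos x"
    using x pi_approx by (intro mult_right_mono cos_ge_zero) auto
  finally have "3/2 * (pi/2 - x) / 2 \<le> 5/2 * cos x / 2" by simp
  then show ?thesis using True k by (simp add: lat_density_def lat_norm_1[simplified])
next
  case False
  then have m2: "2 \<le> m" using m by simp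
  obtain j where j: "m = Suc j" using m by (cases m) auto
  have W: "lat_norm m > 0" by (rule lat_norm_pos)
  have "((\<lambda>s. sin s * cos s ^ j / lat_norm m) has_integral
      (- (cos (pi/2) ^ m / lat_norm m / m) - - (cos x ^ m / lat_norm m / m))) {x..pi/2}"
  proof (rule fundamental_theorem_of_calculus)
    fix s :: real
    have "((\<lambda>s. - (cos s ^ m / lat_norm m / m)) has_real_derivative
        - ((m * cos s ^ (m - 1) * - sin s) / lat_norm m / m)) (at s within {x..pi/2})"
      using W m by (auto intro!: derivative_eq_intros)
    moreover have "- ((m * cos s ^ (m - 1) * - sin s) / lat_norm m / m) = sin s * cos s ^ j / lat_norm m"
      
    proof -
      have "- ((r * c * - s) / w / r) = s * c / w" if "r \<noteq> 0" "w \<noteq> 0" for r c s w :: real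
        using that by simp
      from this[of "real m" "lat_norm m" "cos s ^ j" "sin s"] show ?thesis using W m j by simp
    qed
    ultimately show "((\<lambda>s. - (cos s ^ m / lat_norm m / m)) has_vector_derivative sin s * cos s ^ j / lat_norm m) (at s within {x..pi/2})"
      by (simp add: has_real_derivative_iff_has_vector_derivative)
  qed (use x in simp)
  then have I: "integral {x..pi/2} (\<lambda>s. sin s * cos s ^ j / lat_norm m) = lat_density m x / m"
    using m by (simp only: integral_unique) (simp add: lat_density_def)
  have "lat_excess m x \<le> integral {x..pi/2} (\<lambda>s. sin s * cos s ^ j / lat_norm m)"
    unfolding lat_excess_def
  proof (intro integral_le integrable_continuous_interval continuous_intros)
    fix s assume s: "s \<in> {x..pi/2}"
    then have c: "0 \<le> cos s" using x by (intro cos_ge_zero) auto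
    have "(s - x) * cos s \<le> s * cos s" using s x c by (intro mult_right_mono) auto
    also have "\<dots> \<le> sin s" using s x by (intro sin_ge_mult_cos) auto
    finally have "(s - x) * cos s * (cos s ^ j / lat_norm m) \<le> sin s * (cos s ^ j / lat_norm m)"
      using c W by (intro mult_right_mono) auto
    then show "(s - x) * lat_density m s \<le> sin s * cos s ^ j / lat_norm m"
      by (simp add: lat_density_def j)
  qed (use W in auto)
  then have "m * lat_excess m x \<le> lat_density m x" unfolding I using m by (simp add: field_simps)
  moreover have "(m + 2) / 2 * lat_excess m x \<le> m * lat_excess m x"
    using m2 x by (intro mult_right_mono lat_excess_nonneg) auto
  ultimately show ?thesis by (simp add: algebra_simps)
qed

section \<open>Tail estimates at the levels of a monotone function\<close>

lemma exp_add_exp_minus_le: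
  fixes z :: real
  assumes "0 \<le> z"
  shows "exp z + exp (- z) \<le> 2 * exp (z\<^sup>2 / 2)"
proof -
  \<comment> \<open>This is tanh z <= z, and it gives the sign of the derivative of cosh z exp (-
    z^2 / 2) below.\<close>
  have u: "(1 - z) * exp z \<le> (1 + z) * exp (- z)" if "0 \<le> z" for z :: real
  proof -
    have "(1 + 0) * exp (- 0) - (1 - 0) * exp 0 \<le> (1 + z) * exp (- z) - (1 - z) * exp (z::real)"
    proof (rule DERIV_nonneg_imp_nondecreasing[OF that])
      fix y :: real assume y: "0 \<le> y"
      have "((\<lambda>z. (1 + z) * exp (- z) - (1 - z) * exp z) has_real_derivative y * (exp y - exp (- y))) (at y)"
        by (auto intro!: derivative_eq_intros simp: algebra_simps)
      moreover have "0 \<le> y * (exp y - exp (- y))" using y by (intro mult_nonneg_nonneg) auto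
      ultimately show "\<exists>w. ((\<lambda>z. (1 + z) * exp (- z) - (1 - z) * exp z) has_real_derivative w) (at y) \<and> 0 \<le> w"
        by blast
    qed
    then show ?thesis by simp
  qed
  have "(exp z + exp (- z)) * exp (- (z\<^sup>2 / 2)) \<le> (exp 0 + exp (- 0)) * exp (- (0\<^sup>2 / 2))"
  proof (rule DERIV_nonpos_imp_nonincreasing[OF assms, where f = "\<lambda>z. (exp z + exp (- z)) * exp (- (z\<^sup>2 / 2))"])
    fix y :: real assume y: "0 \<le> y"
    have "((\<lambda>z. (exp z + exp (- z)) * exp (- (z\<^sup>2 / 2))) has_real_derivative
        ((1 - y) * exp y - (1 + y) * exp (- y)) * exp (- (y\<^sup>2 / 2))) (at y)"
      by (auto intro!: derivative_eq_intros simp: algebra_simps)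
    moreover have "((1 - y) * exp y - (1 + y) * exp (- y)) * exp (- (y\<^sup>2 / 2)) \<le> 0"
      using u[OF y] by (intro mult_nonpos_nonneg) auto
    ultimately show "\<exists>w. ((\<lambda>z. (exp z + exp (- z)) * exp (- (z\<^sup>2 / 2))) has_real_derivative w) (at y) \<and> w \<le> 0"
      by blast
  qed
  then show ?thesis by (simp add: exp_minus field_simps)
qed

lemma pi_square_less: "pi\<^sup>2 < 987/100"
proof -
  have "pi * pi < 3.1416 * 3.1416" using pi_approx by (intro mult_strict_mono) auto
  then show ?thesis by (simp add: power2_eq_square)
qed

text \<open>Both sides are separated by \<open>exp (- S q)\<close>, with \<open>S\<close> the Taylor polynomial of degree 7 of \<open>- ln (1 - q)\<close>.
  Degree 7 is the least that works: at \<open>q = 1\<close> one needs a harmonic number above \<open>pi\<^sup>2 / 4\<close>.\<close>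

lemma one_minus_le_exp_quartic:
  fixes q :: real
  assumes q: "0 \<le> q" "q \<le> 1"
  shows "1 - q \<le> exp (- (pi\<^sup>2 / 4 * q^4))"
proof -
  define S where "S q = q + q^2/2 + q^3/3 + q^4/4 + q^5/5 + q^6/6 + q^7/7" for q :: real
  have "(1 - q) * exp (S q) \<le> (1 - 0) * exp (S 0)"
  proof (rule DERIV_nonpos_imp_nonincreasing[OF q(1), where f = "\<lambda>q. (1 - q) * exp (S q)"])
    fix y :: real assume y: "0 \<le> y"
    have dS: "(S has_real_derivative (1 + y + y^2 + y^3 + y^4 + y^5 + y^6)) (at y)"
      unfolding S_def[abs_def] by (auto intro!: derivative_eq_intros)
    have "((\<lambda>q. (1 - q) * exp (S q)) has_real_derivative - (y^7) * exp (S y)) (at y)"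
      by (rule derivative_eq_intros dS refl)+ (simp add: algebra_simps eval_nat_numeral)
    moreover have "- (y^7) * exp (S y) \<le> 0" using y by simp
    ultimately show "\<exists>w. ((\<lambda>q. (1 - q) * exp (S q)) has_real_derivative w) (at y) \<and> w \<le> 0" by blast
  qed
  then have 1: "1 - q \<le> exp (- S q)" by (simp add: S_def exp_minus field_simps)
  have "pi\<^sup>2 / 4 * q^4 \<le> S q"
  proof -
    \<comment> \<open>Each of these bounds on a power q^j is q^4 times the tangent at q = 1 of the
      convex function q^(j - 4). With q^5 <= q^4 they add up to \<open>S q\<close> >= (1 + 1/2 + ...
      + 1/7) q^4.\<close>
    have a1: "4 * q^4 - 3 * q^5 \<le> q"
    proof -
      have "0 \<le> q * ((1 - q)\<^sup>2 * (1 + 2 * q + 3 * q\<^sup>2))" using q by (intro mult_nonneg_nonneg add_nonneg_nonneg) auto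
      also have "\<dots> = q - (4 * q^4 - 3 * q^5)" by (simp add: algebra_simps eval_nat_numeral)
      finally show ?thesis by simp
    qed
    have a2: "3 * q^4 - 2 * q^5 \<le> q^2"
    proof -
      have "0 \<le> q^2 * ((1 - q)\<^sup>2 * (1 + 2 * q))" using q by (intro mult_nonneg_nonneg add_nonneg_nonneg) auto
      also have "\<dots> = q^2 - (3 * q^4 - 2 * q^5)" by (simp add: algebra_simps eval_nat_numeral)
      finally show ?thesis by simp
    qed
    have a3: "2 * q^4 - q^5 \<le> q^3"
    proof -
      have "0 \<le> q^3 * (1 - q)\<^sup>2" using q by (intro mult_nonneg_nonneg add_nonneg_nonneg) auto
      also have "\<dots> = q^3 - (2 * q^4 - q^5)" by (simp add: algebra_simps eval_nat_numeral)
      finally show ?thesis by simp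
    qed
    have a6: "2 * q^5 - q^4 \<le> q^6"
    proof -
      have "0 \<le> q^4 * (1 - q)\<^sup>2" using q by (intro mult_nonneg_nonneg add_nonneg_nonneg) auto
      also have "\<dots> = q^6 - (2 * q^5 - q^4)" by (simp add: algebra_simps eval_nat_numeral)
      finally show ?thesis by simp
    qed
    have a7: "3 * q^5 - 2 * q^4 \<le> q^7"
    proof -
      have "0 \<le> q^4 * ((1 - q)\<^sup>2 * (q + 2))" using q by (intro mult_nonneg_nonneg add_nonneg_nonneg) auto
      also have "\<dots> = q^7 - (3 * q^5 - 2 * q^4)" by (simp add: algebra_simps eval_nat_numeral)
      finally show ?thesis by simp
    qed
    have "pi\<^sup>2 / 4 * q^4 \<le> 247/100 * q^4" using pi_square_less q by (intro mult_right_mono) auto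
    moreover have "q^5 \<le> q^4" using q by (intro power_decreasing) auto
    moreover have "0 \<le> q^4" using q by simp
    ultimately show ?thesis using a1 a2 a3 a6 a7 unfolding S_def by linarith
  qed
  then show ?thesis using 1 by (meson exp_le_cancel_iff neg_le_iff_le order_trans)
qed

lemma lat_tail_0:
  assumes "x \<le> pi/2"
  shows "lat_tail 0 x = (pi/2 - x) / pi"
  using assms by (simp add: lat_tail_def lat_density_def[abs_def] lat_norm_def)

lemma lat_excess_0:
  assumes "x \<le> pi/2"
  shows "lat_excess 0 x = (pi/2 - x)\<^sup>2 / (2 * pi)"
proof -
  have "((\<lambda>s. (s - x) * (1 / pi)) has_integral ((pi/2 - x)\<^sup>2 / (2 * pi) - (x - x)\<^sup>2 / (2 * pi))) {x..pi/2}"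
    using assms by (intro fundamental_theorem_of_calculus)
     (auto intro!: derivative_eq_intros simp: has_real_derivative_iff_has_vector_derivative[symmetric] field_simps)
  moreover have "lat_norm 0 = pi" by (simp add: lat_norm_def)
  ultimately show ?thesis
    unfolding lat_excess_def lat_density_def by (simp only: integral_unique power_0) simp
qed

text \<open>The assumption says t <= E (a - S)_+. For a <= 0 the exponent is at most the mass Q
  below the level, and 1 - Q <= exp (- Q) is enough. For a > 0 and n >= 3 the factor 2 in the
  Gaussian tail bound pays for replacing a by t, because the exponent grows by at most pi^2/16 < ln
  2.\<close>

lemma lat_tail_one_sided:
  fixes m :: nat and a t :: real
  assumes a: "a \<in> {-(pi/2)..pi/2}" and t: "0 \<le> t" "t \<le> a + lat_excess m a"
  shows "lat_tail m a \<le> exp (- ((m + 2) * t\<^sup>2 / 2))"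
proof -
  have half: "real (m + 2) / 2 * (lat_excess m x)\<^sup>2 \<le> lat_tail m x * (pi\<^sup>2 / 16)" if "0 \<le> x" "x \<le> pi/2" for x :: real
  proof -
    have "(m + 2) / 2 * (lat_excess m x)\<^sup>2 \<le> (m + 2) / 2 * (lat_tail m x * (pi\<^sup>2 / (8 * (m + 2))))"
      using lat_excess_square_le[OF that] by (intro mult_left_mono) auto
    also have "\<dots> = lat_tail m x * (pi\<^sup>2 / 16)"
    proof -
      have "r / 2 * (c * (d / (8 * r))) = c * (d / 16)" if "r \<noteq> 0" for r c d :: real
        using that by simp
      from this[of "real (m + 2)"] show ?thesis by simp
    qed
    finally show ?thesis .
  qed
  consider "a \<le> 0" | "0 < a" "m = 0" | "0 < a" "1 \<le> m" by fastforce
  then show ?thesis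
  proof cases
    case 1
    define x where "x = - a"
    have x: "0 \<le> x" "x \<le> pi/2" using 1 a by (auto simp: x_def)
    have Q: "lat_tail m a = 1 - lat_tail m x" using lat_tail_minus[of x m] x by (simp add: x_def)
    have k: "lat_excess m x = a + lat_excess m a" using lat_excess_minus[of a m] a by (simp add: x_def)
    have "t\<^sup>2 \<le> (lat_excess m x)\<^sup>2" using t k by (intro power_mono) auto
    then have "(m + 2) / 2 * t\<^sup>2 \<le> (m + 2) / 2 * (lat_excess m x)\<^sup>2" by (intro mult_left_mono) auto
    also have "\<dots> \<le> lat_tail m x * (pi\<^sup>2 / 16)" by (rule half[OF x])
    also have "\<dots> \<le> lat_tail m x * 1"
      using x pi_square_less by (intro mult_left_mono lat_tail_nonneg) auto
    finally have "(m + 2) * t\<^sup>2 / 2 \<le> lat_tail m x" by simp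
    then have "exp (- lat_tail m x) \<le> exp (- ((m + 2) * t\<^sup>2 / 2))" by simp
    moreover have "1 + (- lat_tail m x) \<le> exp (- lat_tail m x)" by (rule exp_ge_add_one_self)
    ultimately show ?thesis using Q by linarith
  next
    case 2
    \<comment> \<open>On the circle S is uniform and q is the mass below a, so that the tail is 1 -
      q and E (a - S)_+ is pi/2 q^2.\<close>
    define q where "q = 1/2 + a/pi"
    have q: "0 \<le> q" "q \<le> 1" using 2 a by (auto simp: q_def field_simps)
    have "a + (pi/2 - a)\<^sup>2 / (2 * pi) = pi/2 * q\<^sup>2"
      by (simp add: q_def power2_eq_square field_simps)
    then have "t \<le> pi/2 * q\<^sup>2"
      using t(2) 2 a lat_excess_0[of a] by simp
    then have "t\<^sup>2 \<le> (pi/2 * q\<^sup>2)\<^sup>2" using t by (intro power_mono) auto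
    also have "\<dots> = pi\<^sup>2 / 4 * q^4" by (simp add: power_mult_distrib power_divide)
    finally have "exp (- (pi\<^sup>2 / 4 * q^4)) \<le> exp (- (t\<^sup>2))" by simp
    moreover have "lat_tail m a = 1 - q" using 2 a by (simp add: lat_tail_0 q_def field_simps)
    ultimately have "lat_tail m a \<le> exp (- (t\<^sup>2))"
      using one_minus_le_exp_quartic[OF q] 2 by (metis order_trans)
    then show ?thesis using 2 by simp
  next
    case 3
    have a': "0 \<le> a" "a \<le> pi/2" using 3 a by auto
    let ?k = "lat_excess m a"
    have n: "real (m + 2) > 0" by simp
    have T: "2 * lat_tail m a \<le> exp (- ((m + 2) * a\<^sup>2 / 2))"
      using lat_tail_le_gaussian[OF 3(2) a'] .
    have "lat_tail m a \<le> 1/2" using lat_tail_antimono[of 0 a m] a' by (simp add: lat_tail_zero)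
    then have "lat_tail m a * (pi\<^sup>2 / 16) \<le> 1/2 * (pi\<^sup>2 / 16)" by (intro mult_right_mono) auto
    then have h1: "(m + 2) / 2 * ?k\<^sup>2 \<le> pi\<^sup>2 / 32" using half[OF a'] by linarith
    have "(m + 2) * (a * ?k) \<le> (m + 2) * (pi\<^sup>2 / (32 * (m + 2)))"
      using mult_lat_excess_le[OF a', of m] by (intro mult_left_mono) auto
    also have "\<dots> = pi\<^sup>2 / 32"
    proof -
      have "r * (d / (32 * r)) = d / 32" if "r \<noteq> 0" for r d :: real using that by simp
      from this[of "real (m + 2)"] show ?thesis by simp
    qed
    finally have h2: "(m + 2) * (a * ?k) \<le> pi\<^sup>2 / 32" .
    have "t\<^sup>2 \<le> (a + ?k)\<^sup>2" using t by (intro power_mono) auto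
    then have "(m + 2) / 2 * t\<^sup>2 \<le> (m + 2) / 2 * (a + ?k)\<^sup>2" by (intro mult_left_mono) auto
    also have "\<dots> = (m + 2) / 2 * a\<^sup>2 + (m + 2) * (a * ?k) + (m + 2) / 2 * ?k\<^sup>2"
      by (simp add: power2_eq_square algebra_simps add_divide_distrib)
    also have "\<dots> \<le> (m + 2) / 2 * a\<^sup>2 + pi\<^sup>2 / 16" using h1 h2 by linarith
    also have "\<dots> \<le> (m + 2) / 2 * a\<^sup>2 + ln 2" using ln2_ge_two_thirds pi_square_less by simp
    finally have "exp (- ((m + 2) / 2 * a\<^sup>2 + ln 2)) \<le> exp (- ((m + 2) / 2 * t\<^sup>2))" by simp
    moreover have "exp (- ((m + 2) / 2 * a\<^sup>2 + ln 2)) = exp (- ((m + 2) * a\<^sup>2 / 2)) / 2"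
      by (simp add: exp_add exp_diff exp_minus)
    ultimately have "lat_tail m a \<le> exp (- ((m + 2) / 2 * t\<^sup>2))" using T by linarith
    then show ?thesis by simp
  qed
qed

text \<open>The points \<open>a\<close> and \<open>- b\<close> bound the region where a monotone function is within \<open>t\<close> of its mean.
  For \<open>a < t\<close>, the larger tail at \<open>a = t - d\<close> has to be compensated by the smaller one at \<open>t + d\<close>;
  the constant 43/50 of the strict Gaussian bound pays for this once \<open>(m + 2) t\<^sup>2 > 1\<close>.\<close>

lemma lat_tail_two_sided_aux:
  fixes m :: nat and a b t :: real
  assumes m: "1 \<le> m" and a: "-(pi/2) \<le> a" and b: "b \<le> pi/2" and t: "0 < t" "t \<le> a + lat_excess m a"
    and ab: "a \<le> b" "2 * t \<le> a + b"
  shows "lat_tail m a + lat_tail m b \<le> exp (- ((m + 2) * t\<^sup>2 / 2))"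
proof -
  define n where "n = real (m + 2)"
  have n: "n > 0" by (simp add: n_def)
  let ?k = "lat_excess m a"
  have aI: "a \<in> {-(pi/2)..pi/2}" using a ab b by auto
  consider "t \<le> a" | "a < 0" | "0 \<le> a" "a < t" by linarith
  then have "lat_tail m a + lat_tail m b \<le> exp (- (n * t\<^sup>2 / 2))"
  proof cases
    case 1
    have "lat_tail m a \<le> lat_tail m t" "lat_tail m b \<le> lat_tail m t"
      using 1 t ab b by (auto intro!: lat_tail_antimono)
    then show ?thesis using lat_tail_le_gaussian[OF m, of t] t 1 ab b by (simp add: n_def)
  next
    case 2
    define x where "x = - a"
    have x: "0 < x" "x \<le> pi/2" using 2 a by (auto simp: x_def)
    have xt: "x + 2 * t \<le> b" using ab by (simp add: x_def)
    \<comment> \<open>It suffices that the mass between x and x + 2 t is at least n t^2 / 2, since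
      then 1 - z <= exp (- z) applies. The density at x + s is at least n/2 times the excess there,
      hence by convexity at least n/2 (E - s Q), with E and Q the excess and the tail at x.
      Integrating over s up to 2 t, with E >= t and Q <= 1/2, leaves n t^2 / 2. \<open>H\<close> is
      the difference of the two sides before E and Q are estimated.\<close>
    define H where "H s = lat_tail m x - lat_tail m (x + s) - n/2 * (s * lat_excess m x - s\<^sup>2 / 2 * lat_tail m x)" for s :: real
    have "H 0 \<le> H (2 * t)"
    proof (rule DERIV_nonneg_imp_increasing_open[where a=0 and b="2*t" and f=H])
      show "0 \<le> 2 * t" using t by simp
      show "\<exists>y. (H has_real_derivative y) (at s) \<and> 0 \<le> y" if s: "0 < s" "s < 2 * t" for s :: real
      proof (intro exI conjI)
        have xs: "-(pi/2) < x + s" "x + s < pi/2" using s x xt b by (auto simp: add_nonneg_pos intro: less_le_trans[of _ 0])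
        have "((\<lambda>s. lat_tail m (x + s)) has_real_derivative - lat_density m (x + s)) (at s)"
          using lat_tail_has_derivative_at[OF xs, of m] DERIV_shift[of "lat_tail m" _ s x]
          by (simp add: add.commute)
        then show "(H has_real_derivative lat_density m (x + s) - n/2 * (lat_excess m x - s * lat_tail m x)) (at s)"
          unfolding H_def[abs_def] by (auto intro!: derivative_eq_intros)
        have "lat_excess m x - s * lat_tail m x \<le> lat_excess m (x + s)"
          using lat_excess_ge_linear[of x "x + s" m] x s xs by simp
        then have "n/2 * (lat_excess m x - s * lat_tail m x) \<le> n/2 * lat_excess m (x + s)"
          using n by (intro mult_left_mono) auto
        also have "\<dots> \<le> lat_density m (x + s)"
          using lat_excess_le_density[OF m, of "x + s"] x s xs by (simp add: n_def add.commute)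
        finally show "0 \<le> lat_density m (x + s) - n/2 * (lat_excess m x - s * lat_tail m x)" by simp
      qed
      have "continuous_on {0..2*t} (\<lambda>s. lat_tail m (x + s))"
        by (rule continuous_on_compose2[OF continuous_on_lat_tail]) (use x xt b in \<open>auto intro!: continuous_intros\<close>)
      then show "continuous_on {0..2*t} H"
        unfolding H_def[abs_def] by (intro continuous_intros) auto
    qed
    then have 1: "n/2 * (2 * t * lat_excess m x - 2 * t\<^sup>2 * lat_tail m x) \<le> lat_tail m x - lat_tail m (x + 2 * t)"
      by (simp add: H_def power_mult_distrib)
    have "lat_excess m x = a + ?k" using lat_excess_minus[of a m] aI by (simp add: x_def)
    then have "2 * t * t \<le> 2 * t * lat_excess m x" using t by (intro mult_left_mono) auto
    moreover have "2 * t\<^sup>2 * lat_tail m x \<le> 2 * t\<^sup>2 * (1/2)"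
      using lat_tail_antimono[of 0 x m] x by (intro mult_left_mono) (auto simp: lat_tail_zero)
    ultimately have "t\<^sup>2 \<le> 2 * t * lat_excess m x - 2 * t\<^sup>2 * lat_tail m x" by (simp add: power2_eq_square)
    then have "n/2 * t\<^sup>2 \<le> n/2 * (2 * t * lat_excess m x - 2 * t\<^sup>2 * lat_tail m x)" using n by (intro mult_left_mono) auto
    with 1 have 2: "n/2 * t\<^sup>2 \<le> lat_tail m x - lat_tail m (x + 2 * t)" by linarith
    have "lat_tail m b \<le> lat_tail m (x + 2 * t)" using xt x t b by (intro lat_tail_antimono) auto
    moreover have "lat_tail m a = 1 - lat_tail m x" using lat_tail_minus[of x m] x by (simp add: x_def)
    moreover have "1 + (- (n * t\<^sup>2 / 2)) \<le> exp (- (n * t\<^sup>2 / 2))" by (rule exp_ge_add_one_self)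
    ultimately show ?thesis using 2 by simp
  next
    case 3
    define d where "d = t - a"
    have d: "0 < d" "d \<le> ?k" using 3 t by (auto simp: d_def)
    have b': "t + d \<le> b" using ab by (simp add: d_def)
    have a': "0 \<le> a" "a \<le> pi/2" using 3 aI by auto
    have Qb: "lat_tail m b \<le> lat_tail m (t + d)" using b' b d t by (intro lat_tail_antimono) auto
    \<comment> \<open>The sum of exp (- n (t - d)^2 / 2) and exp (- n (t + d)^2 / 2) is exp (- n t^2
      / 2) times 2 exp (- n d^2 / 2) cosh (n t d). The condition \<open>f\<close> says that the
      latter factor, times c, is at most 2.\<close>
    have core: "lat_tail m a + lat_tail m b \<le> exp (- (n * t\<^sup>2 / 2))"
      if c: "0 < c" "\<And>x. x \<in> {a, t + d} \<Longrightarrow> 2 * lat_tail m x \<le> c * exp (- (n * x\<^sup>2 / 2))"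
        and f: "c * exp (- (n * d\<^sup>2 / 2)) * (exp (n * t * d) + exp (- (n * t * d))) \<le> 2" for c
    proof -
      have "2 * (lat_tail m a + lat_tail m b) \<le> c * (exp (- (n * (t - d)\<^sup>2 / 2)) + exp (- (n * (t + d)\<^sup>2 / 2)))"
        using c(2)[of a] c(2)[of "t + d"] Qb by (simp add: d_def algebra_simps)
      also have "\<dots> = exp (- (n * t\<^sup>2 / 2)) * (c * exp (- (n * d\<^sup>2 / 2)) * (exp (n * t * d) + exp (- (n * t * d))))"
      proof -
        have "- (n * (t - d)\<^sup>2 / 2) = - (n * t\<^sup>2 / 2) + - (n * d\<^sup>2 / 2) + n * t * d"
          "- (n * (t + d)\<^sup>2 / 2) = - (n * t\<^sup>2 / 2) + - (n * d\<^sup>2 / 2) + - (n * t * d)"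
          by (simp_all add: power2_eq_square algebra_simps add_divide_distrib diff_divide_distrib)
        then show ?thesis by (simp only: exp_add) (simp add: algebra_simps)
      qed
      also have "\<dots> \<le> exp (- (n * t\<^sup>2 / 2)) * 2" using f by (intro mult_left_mono) auto
      finally show ?thesis by simp
    qed
    have td: "t + d \<le> pi/2" using b' b by simp
    show ?thesis
    \<comment> \<open>While n t^2 <= 1, the bound cosh (n t d) <= exp ((n t d)^2 / 2) <= exp (n d^2
      / 2) already suffices with c = 1.\<close>
    proof (cases "n * t\<^sup>2 \<le> 1")
      case True
      show ?thesis
      proof (rule core[of 1])
        show "2 * lat_tail m x \<le> 1 * exp (- (n * x\<^sup>2 / 2))" if "x \<in> {a, t + d}" for x :: real
          using lat_tail_le_gaussian[OF m, of x] that a' td t d by (auto simp: n_def)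
        have "(n * t * d)\<^sup>2 = n * t\<^sup>2 * (n * d\<^sup>2)" by (simp add: power2_eq_square)
        also have "\<dots> \<le> 1 * (n * d\<^sup>2)" using True n by (intro mult_right_mono) auto
        finally have e: "exp ((n * t * d)\<^sup>2 / 2) \<le> exp (n * d\<^sup>2 / 2)" by simp
        have "exp (n * t * d) + exp (- (n * t * d)) \<le> 2 * exp ((n * t * d)\<^sup>2 / 2)"
          using n t d by (intro exp_add_exp_minus_le) auto
        also have "\<dots> \<le> 2 * exp (n * d\<^sup>2 / 2)" using e by simp
        finally have "exp (- (n * d\<^sup>2 / 2)) * (exp (n * t * d) + exp (- (n * t * d))) \<le> exp (- (n * d\<^sup>2 / 2)) * (2 * exp (n * d\<^sup>2 / 2))"
          by (intro mult_left_mono) auto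
        also have "\<dots> = 2" by (simp flip: exp_add)
        finally show "1 * exp (- (n * d\<^sup>2 / 2)) * (exp (n * t * d) + exp (- (n * t * d))) \<le> 2" by simp
      qed simp
    next
      case False
      have k0: "?k \<le> 63/100 / sqrt n"
        using lat_excess_antimono[of 0 a m] lat_excess_zero_le[OF m] a' by (simp add: n_def)
      \<comment> \<open>Here t > 1 / sqrt n while d <= 63/100 / sqrt n, so a = t - d is far enough
        from the equator for the constant 43/50.\<close>
      have big: "9/25 / sqrt n \<le> a"
      proof (rule ccontr)
        assume "\<not> ?thesis"
        then have "t \<le> 9/25 / sqrt n + 63/100 / sqrt n" using d k0 by (simp add: d_def)
        also have "\<dots> = 99/100 / sqrt n" by (simp add: add_divide_distrib[symmetric])
        finally have "t\<^sup>2 \<le> (99/100 / sqrt n)\<^sup>2" using t by (intro power_mono) auto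
        also have "\<dots> \<le> 1 / n" using n by (simp add: power_divide field_simps)
        finally show False using False n by (simp add: field_simps)
      qed
      show ?thesis
      proof (rule core[of "43/50"])
        show "2 * lat_tail m x \<le> 43/50 * exp (- (n * x\<^sup>2 / 2))" if "x \<in> {a, t + d}" for x :: real
          using lat_tail_le_strict_gaussian[OF m, of x] that a' td t d big 3 by (auto simp: n_def)
        \<comment> \<open>As t = a + d, the two exponents n t d - n d^2 / 2 and - n t d - n d^2 / 2
          are y and - y - n d^2. Both parts of y are small: n a d <= pi^2/32 and n d^2 / 2 <
          0.2.\<close>
        define y where "y = n * (a * d) + n * d\<^sup>2 / 2"
        have y0: "0 \<le> y" using n a' d by (simp add: y_def)
        have "n * (a * d) \<le> n * (a * ?k)" using n a' d by (intro mult_left_mono) auto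
        also have "\<dots> \<le> n * (pi\<^sup>2 / (32 * n))"
          using mult_lat_excess_le[OF a', of m] n by (intro mult_left_mono) (auto simp: n_def)
        also have "\<dots> = pi\<^sup>2 / 32" using n by simp
        finally have y1: "n * (a * d) \<le> 309/1000" using pi_square_less by simp
        have "d\<^sup>2 \<le> (63/100 / sqrt n)\<^sup>2" using d k0 by (intro power_mono) auto
        also have "\<dots> = 3969/10000 / n" using n by (simp add: power_divide)
        finally have "n * d\<^sup>2 \<le> n * (3969/10000 / n)" using n by (intro mult_left_mono) auto
        then have "n * d\<^sup>2 \<le> 3969/10000" using n by simp
        with y1 have y2: "y \<le> 51/100" by (simp add: y_def)
        then have "y\<^sup>2 \<le> (51/100)\<^sup>2" using y0 by (intro power_mono) auto
        then have y3: "y\<^sup>2 / 2 \<le> 14/100" by (simp add: power2_eq_square)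
        have "n * t * d = y + n * d\<^sup>2 / 2" by (simp add: y_def d_def power2_eq_square field_simps)
        then have "exp (- (n * d\<^sup>2 / 2)) * (exp (n * t * d) + exp (- (n * t * d))) = exp y + exp (- y - n * d\<^sup>2)"
          by (simp add: distrib_left flip: exp_add)
        also have "\<dots> \<le> exp y + exp (- y)" using n by simp
        also have "\<dots> \<le> 2 * exp (y\<^sup>2 / 2)" by (rule exp_add_exp_minus_le[OF y0])
        also have "\<dots> \<le> 2 * exp (14/100)" using y3 by simp
        finally have 1: "exp (- (n * d\<^sup>2 / 2)) * (exp (n * t * d) + exp (- (n * t * d))) \<le> 2 * exp (14/100)" .
        have "1 + (- (14/100)) \<le> exp (- (14/100::real))" by (rule exp_ge_add_one_self)
        then have "43/50 * exp (14/100) \<le> exp (- (14/100)) * exp (14/100::real)" by (intro mult_right_mono) auto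
        also have "\<dots> = 1" by (simp flip: exp_add)
        finally have "43/50 * (2 * exp (14/100)) \<le> (2::real)" by simp
        then show "43/50 * exp (- (n * d\<^sup>2 / 2)) * (exp (n * t * d) + exp (- (n * t * d))) \<le> 2"
          using 1 by (simp add: mult.assoc)
      qed simp
    qed
  qed
  then show ?thesis by (simp add: n_def)
qed

lemma lat_tail_two_sided:
  fixes m :: nat and a b t :: real
  assumes "1 \<le> m" "a \<in> {-(pi/2)..pi/2}" "b \<in> {-(pi/2)..pi/2}" "0 < t"
    "t \<le> a + lat_excess m a" "t \<le> b + lat_excess m b" "2 * t \<le> a + b"
  shows "lat_tail m a + lat_tail m b \<le> exp (- ((m + 2) * t\<^sup>2 / 2))"
proof (cases "a \<le> b")
  case True
  then show ?thesis using assms by (intro lat_tail_two_sided_aux) auto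
next
  case False
  then show ?thesis using assms lat_tail_two_sided_aux[of m b a t] by auto
qed

section \<open>Deviations of a monotone Lipschitz function of the latitude\<close>

lemma lat_mean_mono:
  assumes "continuous_on {-(pi/2)..pi/2} f" "continuous_on {-(pi/2)..pi/2} g"
    "\<And>s. s \<in> {-(pi/2)..pi/2} \<Longrightarrow> f s \<le> g s"
  shows "lat_mean m f \<le> lat_mean m g"
  unfolding lat_mean_def using assms
  by (intro integral_le integrable_continuous_interval continuous_intros mult_right_mono lat_density_nonneg) auto

lemma lat_mean_const [simp]: "lat_mean m (\<lambda>s. c) = c"
  by (simp add: lat_mean_def integral_lat_density)

lemma lat_mean_add:
  assumes "continuous_on {-(pi/2)..pi/2} f" "continuous_on {-(pi/2)..pi/2} g"
  shows "lat_mean m (\<lambda>s. f s + g s) = lat_mean m f + lat_mean m g"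
  unfolding lat_mean_def distrib_right using assms
  by (intro Henstock_Kurzweil_Integration.integral_add integrable_continuous_interval continuous_intros) auto

lemma lat_mean_diff:
  assumes "continuous_on {-(pi/2)..pi/2} f" "continuous_on {-(pi/2)..pi/2} g"
  shows "lat_mean m (\<lambda>s. f s - g s) = lat_mean m f - lat_mean m g"
  unfolding lat_mean_def left_diff_distrib using assms
  by (intro Henstock_Kurzweil_Integration.integral_diff integrable_continuous_interval continuous_intros) auto

lemma lat_mean_uminus: "lat_mean m (\<lambda>s. - f s) = - lat_mean m f"
  by (simp add: lat_mean_def)

lemma lat_mean_reflect: "lat_mean m (\<lambda>s. f (- s)) = lat_mean m f"
  unfolding lat_mean_def
  using Henstock_Kurzweil_Integration.integral_reflect_real[of "pi/2" "-(pi/2)" "\<lambda>s. f s * lat_density m s"]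
  by simp

lemma lat_mean_pos_part:
  assumes a: "a \<in> {-(pi/2)..pi/2}"
  shows "lat_mean m (\<lambda>s. max 0 (a - s)) = a + lat_excess m a"
proof -
  let ?h = "\<lambda>s. max 0 (a + s) * lat_density m s"
  have "lat_mean m (\<lambda>s. max 0 (a - s)) = lat_mean m (\<lambda>s. max 0 (a + s))"
    using lat_mean_reflect[of m "\<lambda>s. max 0 (a - s)"] by simp
  also have "\<dots> = integral {-(pi/2)..- a} ?h + integral {- a..pi/2} ?h"
    unfolding lat_mean_def using a
    by (intro Henstock_Kurzweil_Integration.integral_combine[symmetric] integrable_continuous_interval continuous_intros) auto
  also have "integral {-(pi/2)..- a} ?h = integral {-(pi/2)..- a} (\<lambda>s. 0)"
    by (intro Henstock_Kurzweil_Integration.integral_cong) auto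
  also have "integral {- a..pi/2} ?h = lat_excess m (- a)"
    unfolding lat_excess_def by (intro Henstock_Kurzweil_Integration.integral_cong) (auto simp: add.commute)
  finally show ?thesis using lat_excess_minus[OF a] by simp
qed

text \<open>Let a be the first point where \<psi> reaches its mean plus t. The Lipschitz condition
  to the left of a and monotonicity to the right give \<psi> s >= \<psi> a - (a - s)_+, and taking
  means bounds t by E (a - S)_+.\<close>

lemma monotone_lipschitz_level:
  fixes \<psi> :: "real \<Rightarrow> real" and m :: nat
  defines "I \<equiv> {-(pi/2)..pi/2}"
  assumes mono: "mono_on I \<psi>" and lip: "1-lipschitz_on I \<psi>"
    and ne: "\<exists>s\<in>I. lat_mean m \<psi> + t \<le> \<psi> s"
  obtains a where "a \<in> I" "lat_mean m \<psi> + t \<le> \<psi> a"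
    "\<And>s. s \<in> I \<Longrightarrow> s < a \<Longrightarrow> \<psi> s < lat_mean m \<psi> + t" "t \<le> a + lat_excess m a"
proof -
  have cont: "continuous_on I \<psi>" by (rule lipschitz_on_continuous_on[OF lip])
  define A where "A = {s \<in> I. lat_mean m \<psi> + t \<le> \<psi> s}"
  have "closed A"
    unfolding A_def using cont by (intro continuous_on_closed_Collect_le continuous_intros) (auto simp: I_def)
  moreover have "A \<noteq> {}" using ne by (auto simp: A_def)
  moreover have bdd: "bdd_below A" by (auto simp: A_def I_def intro!: bdd_belowI[of _ "-(pi/2)"])
  ultimately have aA: "Inf A \<in> A" by (intro closed_contains_Inf)
  define a where "a = Inf A"
  have a: "a \<in> I" "lat_mean m \<psi> + t \<le> \<psi> a" using aA by (auto simp: a_def A_def)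
  have below: "\<psi> s < lat_mean m \<psi> + t" if "s \<in> I" "s < a" for s
  proof (rule ccontr)
    assume "\<not> ?thesis"
    then have "s \<in> A" using that by (auto simp: A_def)
    then show False using cInf_lower[OF _ bdd] that by (force simp: a_def)
  qed
  have "lat_mean m (\<lambda>s. \<psi> a - max 0 (a - s)) \<le> lat_mean m \<psi>"
  proof (rule lat_mean_mono)
    fix s assume s: "s \<in> {-(pi/2)..pi/2}"
    show "\<psi> a - max 0 (a - s) \<le> \<psi> s"
    proof (cases "s \<le> a")
      case True
      then show ?thesis using lipschitz_onD[OF lip, of a s] s a by (auto simp: I_def dist_real_def)
    next
      case False
      then show ?thesis using mono_onD[OF mono, of a s] s a by (auto simp: I_def)
    qed
  qed (use cont in \<open>auto simp: I_def intro!: continuous_intros\<close>)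
  moreover have "lat_mean m (\<lambda>s. \<psi> a - max 0 (a - s)) = \<psi> a - (a + lat_excess m a)"
    using a by (subst lat_mean_diff) (auto simp: lat_mean_pos_part I_def intro!: continuous_intros)
  ultimately have "t \<le> a + lat_excess m a" using a by linarith
  then show ?thesis using that a below by blast
qed

text \<open>Here \<eta> stands in for the indicator of a deviation set, since equidistribution is
  available only for continuous test functions. The lower part is {s <= - b} because b arises as an
  upper level of the reflected function; b = pi/2 gives the one-sided case.\<close>

lemma lat_mean_le_tail_sum:
  assumes a: "a \<in> {-(pi/2)..pi/2}" and b: "b \<in> {-(pi/2)..pi/2}"
    and \<eta>: "continuous_on {-(pi/2)..pi/2} \<eta>" "\<And>s. s \<in> {-(pi/2)..pi/2} \<Longrightarrow> \<eta> s \<le> 1"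
      "\<And>s. s \<in> {-(pi/2)..pi/2} \<Longrightarrow> - b < s \<Longrightarrow> s < a \<Longrightarrow> \<eta> s \<le> 0"
  shows "lat_mean m \<eta> \<le> lat_tail m a + lat_tail m b"
proof -
  let ?I = "{-(pi/2)..pi/2}"
  let ?f = "\<lambda>s. if s \<in> {a..pi/2} then lat_density m s else 0"
  let ?g = "\<lambda>s. if s \<in> {-(pi/2)..-b} then lat_density m s else 0"
  have r: "(\<lambda>s. if s \<in> {c..d} then lat_density m s else 0) integrable_on ?I"
    "integral ?I (\<lambda>s. if s \<in> {c..d} then lat_density m s else 0) = integral {c..d} (lat_density m)"
    if "-(pi/2) \<le> c" "d \<le> pi/2" for c d
  proof -
    have "{c..d} \<inter> ?I = {c..d}" using that by auto
    moreover have "lat_density m integrable_on {c..d}"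
      by (intro integrable_continuous_interval continuous_intros)
    ultimately show "(\<lambda>s. if s \<in> {c..d} then lat_density m s else 0) integrable_on ?I"
      "integral ?I (\<lambda>s. if s \<in> {c..d} then lat_density m s else 0) = integral {c..d} (lat_density m)"
      by (simp_all only: integrable_restrict_Int integral_restrict_Int)
  qed
  have fI: "?f integrable_on ?I" "integral ?I ?f = lat_tail m a"
    unfolding lat_tail_def using r[of a "pi/2"] a by auto
  have "integral {-(pi/2)..-b} (lat_density m) = lat_tail m b"
    using Henstock_Kurzweil_Integration.integral_reflect_real[of "pi/2" b "lat_density m"] by (simp add: lat_tail_def)
  then have gI: "?g integrable_on ?I" "integral ?I ?g = lat_tail m b"
    using r[of "-(pi/2)" "-b"] b by auto
  have "lat_mean m \<eta> \<le> integral ?I (\<lambda>s. ?f s + ?g s)"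
    unfolding lat_mean_def
  proof (rule integral_le)
    show "(\<lambda>s. \<eta> s * lat_density m s) integrable_on ?I"
      by (intro integrable_continuous_interval continuous_intros \<eta>)
    show "(\<lambda>s. ?f s + ?g s) integrable_on ?I"
      by (rule Henstock_Kurzweil_Integration.integrable_add[OF fI(1) gI(1)])
    fix s assume s: "s \<in> ?I"
    have p: "0 \<le> lat_density m s" by (rule lat_density_nonneg[OF s])
    have "\<eta> s * lat_density m s \<le> 1 * lat_density m s"
      using \<eta>(2)[OF s] p by (intro mult_right_mono) auto
    moreover have "\<eta> s * lat_density m s \<le> 0" if "- b < s" "s < a"
      using \<eta>(3)[OF s that] p by (intro mult_nonpos_nonneg) auto
    ultimately show "\<eta> s * lat_density m s \<le> ?f s + ?g s" using s p by auto
  qed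
  also have "\<dots> = lat_tail m a + lat_tail m b"
    using fI gI by (simp only: Henstock_Kurzweil_Integration.integral_add)
  finally show ?thesis .
qed

lemma lat_mean_deviation_upper:
  fixes \<psi> \<eta> :: "real \<Rightarrow> real" and m :: nat and t :: real
  defines "I \<equiv> {-(pi/2)..pi/2}"
  assumes mono: "mono_on I \<psi>" and lip: "1-lipschitz_on I \<psi>" and t: "0 \<le> t"
    and \<eta>: "continuous_on I \<eta>" "\<And>s. s \<in> I \<Longrightarrow> \<eta> s \<le> 1"
      "\<And>s. s \<in> I \<Longrightarrow> \<psi> s < lat_mean m \<psi> + t \<Longrightarrow> \<eta> s \<le> 0"
  shows "lat_mean m \<eta> \<le> exp (- ((m + 2) * t\<^sup>2 / 2))"
proof (cases "\<exists>s\<in>I. lat_mean m \<psi> + t \<le> \<psi> s")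
  case True
  then obtain a where a: "a \<in> I" "\<And>s. s \<in> I \<Longrightarrow> s < a \<Longrightarrow> \<psi> s < lat_mean m \<psi> + t" "t \<le> a + lat_excess m a"
    using monotone_lipschitz_level[of \<psi> m t] mono lip unfolding I_def by metis
  have "lat_mean m \<eta> \<le> lat_tail m a + lat_tail m (pi/2)"
    using a \<eta> unfolding I_def by (intro lat_mean_le_tail_sum) auto
  also have "\<dots> \<le> exp (- ((m + 2) * t\<^sup>2 / 2))"
    using lat_tail_one_sided[of a t m] a t by (simp add: I_def)
  finally show ?thesis .
next
  case False
  then have "lat_mean m \<eta> \<le> lat_mean m (\<lambda>s. 0)"
    using \<eta> unfolding I_def by (intro lat_mean_mono) (auto simp: not_le)
  also have "\<dots> \<le> exp (- ((m + 2) * t\<^sup>2 / 2))" by simp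
  finally show ?thesis .
qed

text \<open>Passing to \<open>\<psi>'\<close> turns deviations below the mean into deviations above
  it. If one of the two sides is never reached, the one-sided bound applies; otherwise \<psi> rises
  by at least 2 t from - b to a, and the Lipschitz condition gives a + b >= 2 t.\<close>

lemma lat_mean_deviation_abs:
  fixes \<psi> \<eta> :: "real \<Rightarrow> real" and m :: nat and t :: real
  defines "I \<equiv> {-(pi/2)..pi/2}"
  assumes m: "1 \<le> m" and mono: "mono_on I \<psi>" and lip: "1-lipschitz_on I \<psi>" and t: "0 < t"
    and \<eta>: "continuous_on I \<eta>" "\<And>s. s \<in> I \<Longrightarrow> \<eta> s \<le> 1"
      "\<And>s. s \<in> I \<Longrightarrow> \<bar>\<psi> s - lat_mean m \<psi>\<bar> < t \<Longrightarrow> \<eta> s \<le> 0"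
  shows "lat_mean m \<eta> \<le> exp (- ((m + 2) * t\<^sup>2 / 2))"
proof -
  define \<psi>' where "\<psi>' s = - \<psi> (- s)" for s
  have I: "- s \<in> I \<longleftrightarrow> s \<in> I" for s by (auto simp: I_def)
  have mean': "lat_mean m \<psi>' = - lat_mean m \<psi>"
    unfolding \<psi>'_def[abs_def] lat_mean_uminus by (simp add: lat_mean_reflect)
  have mono': "mono_on I \<psi>'"
    using mono I by (auto simp: mono_on_def \<psi>'_def)
  have lip': "1-lipschitz_on I \<psi>'"
  proof (rule lipschitz_onI)
    fix x y assume "x \<in> I" "y \<in> I"
    then show "dist (\<psi>' x) (\<psi>' y) \<le> 1 * dist x y"
      using lipschitz_onD[OF lip, of "-x" "-y"] by (simp add: I \<psi>'_def dist_real_def abs_minus_commute)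
  qed simp
  consider "\<forall>s\<in>I. \<psi> s < lat_mean m \<psi> + t" | "\<forall>s\<in>I. \<psi>' s < lat_mean m \<psi>' + t"
    | "\<exists>s\<in>I. lat_mean m \<psi> + t \<le> \<psi> s" "\<exists>s\<in>I. lat_mean m \<psi>' + t \<le> \<psi>' s"
    by (meson not_le)
  then show ?thesis
  proof cases
    case 1
    have "lat_mean m (\<lambda>s. \<eta> (- s)) \<le> exp (- ((m + 2) * t\<^sup>2 / 2))"
    proof (rule lat_mean_deviation_upper[of \<psi>'])
      show "continuous_on {-(pi/2)..pi/2} (\<lambda>s. \<eta> (- s))"
        by (rule continuous_on_compose2[OF \<eta>(1)]) (auto simp: I_def intro!: continuous_intros)
      fix s assume s: "s \<in> {-(pi/2)..pi/2}"
      then have s': "- s \<in> I" by (auto simp: I_def)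
      show "\<eta> (- s) \<le> 1" using \<eta>(2)[OF s'] .
      assume "\<psi>' s < lat_mean m \<psi>' + t"
      then show "\<eta> (- s) \<le> 0" using \<eta>(3)[OF s'] 1 s' by (auto simp: \<psi>'_def mean')
    qed (use mono' lip' t in \<open>auto simp: I_def\<close>)
    then show ?thesis by (simp only: lat_mean_reflect)
  next
    case 2
    show ?thesis
    proof (rule lat_mean_deviation_upper[of \<psi>])
      fix s assume s: "s \<in> {-(pi/2)..pi/2}"
      then have s': "- s \<in> I" "s \<in> I" by (auto simp: I_def)
      show "\<eta> s \<le> 1" using \<eta>(2) s' by blast
      assume "\<psi> s < lat_mean m \<psi> + t"
      moreover have "\<psi>' (- s) < lat_mean m \<psi>' + t" using 2 s' by blast
      ultimately show "\<eta> s \<le> 0" using \<eta>(3)[OF s'(2)] by (auto simp: \<psi>'_def mean')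
    qed (use mono lip t \<eta>(1) in \<open>auto simp: I_def\<close>)
  next
    case 3
    obtain a where a: "a \<in> I" "lat_mean m \<psi> + t \<le> \<psi> a"
      "\<And>s. s \<in> I \<Longrightarrow> s < a \<Longrightarrow> \<psi> s < lat_mean m \<psi> + t" "t \<le> a + lat_excess m a"
      using monotone_lipschitz_level[of \<psi> m t] mono lip 3(1) unfolding I_def by metis
    obtain b where b: "b \<in> I" "lat_mean m \<psi>' + t \<le> \<psi>' b"
      "\<And>s. s \<in> I \<Longrightarrow> s < b \<Longrightarrow> \<psi>' s < lat_mean m \<psi>' + t" "t \<le> b + lat_excess m b"
      using monotone_lipschitz_level[of \<psi>' m t] mono' lip' 3(2) unfolding I_def by metis
    have ab: "2 * t \<le> \<psi> a - \<psi> (- b)" using a(2) b(2) by (simp add: \<psi>'_def mean')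
    have "- b \<le> a"
    proof (rule ccontr)
      assume "\<not> ?thesis"
      then have "\<psi> a \<le> \<psi> (- b)" using mono_onD[OF mono, of a "-b"] a b I by auto
      then show False using ab t by simp
    qed
    then have "2 * t \<le> a + b"
      using ab lipschitz_onD[OF lip, of a "-b"] a b I by (auto simp: dist_real_def)
    moreover have "lat_mean m \<eta> \<le> lat_tail m a + lat_tail m b"
    proof (rule lat_mean_le_tail_sum)
      fix s assume s: "s \<in> {-(pi/2)..pi/2}" "- b < s" "s < a"
      then have "\<psi>' (- s) < lat_mean m \<psi>' + t" "\<psi> s < lat_mean m \<psi> + t"
        using a(3)[of s] b(3)[of "- s"] by (auto simp: I_def)
      then show "\<eta> s \<le> 0" using \<eta>(3)[of s] s by (auto simp: I_def \<psi>'_def mean' abs_less_iff)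
    qed (use a b \<eta> in \<open>auto simp: I_def\<close>)
    ultimately show ?thesis
      using lat_tail_two_sided[OF m, of a b t] a b t by (auto simp: I_def)
  qed
qed

section \<open>Rotation-invariant measures on the sphere\<close>

locale sphere_measure = prob_space \<mu> for \<mu> :: "(real ^ 'n) measure" +
  assumes sphere_measure: "is_sphere_measure \<mu>" and card_ge_2: "2 \<le> CARD('n)"
begin

lemma space_eq [simp]: "space \<mu> = sphere 0 1"
proof -
  have "sets \<mu> = sets (restrict_space borel (sphere 0 1))"
    using sphere_measure by (simp add: is_sphere_measure_def)
  then show ?thesis by (simp add: sets_eq_imp_space_eq space_restrict_space)
qed

lemma sets_eq [measurable_cong]: "sets \<mu> = sets (restrict_space borel (sphere 0 1))"
  using sphere_measure by (simp add: is_sphere_measure_def)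

lemma measurable_continuous:
  assumes "continuous_on (sphere 0 1) \<phi>"
  shows "\<phi> \<in> borel_measurable \<mu>"
  using borel_measurable_continuous_on_restrict[OF assms] measurable_cong_sets[OF sets_eq refl] by blast

lemma measurable_ident_borel: "(\<lambda>x. x) \<in> measurable \<mu> borel"
  by (intro measurable_continuous continuous_intros)

lemma continuous_bound:
  fixes \<phi> :: "real ^ 'n \<Rightarrow> real"
  assumes "continuous_on (sphere 0 1) \<phi>"
  obtains B where "\<And>x. x \<in> sphere 0 1 \<Longrightarrow> \<bar>\<phi> x\<bar> \<le> B"
proof -
  have "compact (\<phi> ` sphere 0 1)" using assms by (intro compact_continuous_image) auto
  then have "bounded (\<phi> ` sphere 0 1)" by (rule compact_imp_bounded)
  then obtain B where "\<forall>y\<in>\<phi> ` sphere 0 1. norm y \<le> B" unfolding bounded_iff by blast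
  then show ?thesis by (intro that[of B]) auto
qed

lemma integrable_continuous:
  fixes \<phi> :: "real ^ 'n \<Rightarrow> real"
  assumes "continuous_on (sphere 0 1) \<phi>"
  shows "integrable \<mu> \<phi>"
proof -
  obtain B where "\<And>x. x \<in> sphere 0 1 \<Longrightarrow> \<bar>\<phi> x\<bar> \<le> B" using continuous_bound[OF assms] by blast
  then show ?thesis
    by (intro integrable_const_bound[of _ B] AE_I2 measurable_continuous assms) auto
qed

lemma rotation_invariant:
  fixes \<phi> :: "real ^ 'n \<Rightarrow> real"
  assumes Q: "rotation_matrix Q" and \<phi>: "continuous_on (sphere 0 1) \<phi>"
  shows "(\<integral>x. \<phi> (Q *v x) \<partial>\<mu>) = (\<integral>x. \<phi> x \<partial>\<mu>)"
proof -
  have orth: "orthogonal_transformation ((*v) Q)"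
    using Q by (simp add: rotation_matrix_def orthogonal_transformation_matrix)
  then have "(\<lambda>x. Q *v x) \<in> measurable \<mu> (restrict_space borel (sphere 0 1))"
    by (intro measurable_restrict_space2 measurable_continuous matrix_vector_mult_linear_continuous_on)
       (auto simp: orthogonal_transformation_norm)
  then have m: "(\<lambda>x. Q *v x) \<in> measurable \<mu> \<mu>"
    using measurable_cong_sets[OF refl sets_eq] by blast
  have "(\<integral>x. \<phi> x \<partial>\<mu>) = (\<integral>x. \<phi> x \<partial>(distr \<mu> \<mu> (\<lambda>x. Q *v x)))"
    using sphere_measure Q by (simp add: is_sphere_measure_def)
  also have "\<dots> = (\<integral>x. \<phi> (Q *v x) \<partial>\<mu>)"
    by (rule integral_distr[OF m measurable_continuous[OF \<phi>]])
  finally show ?thesis ..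
qed

lemma rotation_transitive:
  assumes "a \<in> sphere 0 1" "b \<in> sphere 0 1"
  obtains Q where "rotation_matrix Q" "orthogonal_transformation ((*v) Q)" "Q *v a = (b :: real ^ 'n)"
proof -
  obtain f where f: "orthogonal_transformation f" "det (matrix f) = 1" "f a = b"
    using rotation_exists_1[OF card_ge_2, of a b] assms by auto
  have "linear f" using f(1) by (simp add: orthogonal_transformation_linear)
  then have fQ: "(*v) (matrix f) = f" by (auto simp: matrix_works)
  show ?thesis
  proof (rule that[of "matrix f"])
    show "rotation_matrix (matrix f)"
      using f by (simp add: rotation_matrix_def orthogonal_transformation_matrix)
  qed (simp_all add: fQ f)
qed

lemma continuous_on_rotate:
  fixes Q :: "real ^ 'n ^ 'n"
  assumes "orthogonal_transformation ((*v) Q)" "continuous_on (sphere 0 1) \<phi>"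
  shows "continuous_on (sphere 0 1) (\<lambda>x. \<phi> (Q *v x))"
  by (rule continuous_on_compose2[OF assms(2) matrix_vector_mult_linear_continuous_on])
     (use assms(1) in \<open>auto simp: orthogonal_transformation_norm\<close>)

text \<open>Expresses that \<mu> has full support. If the integral were 0, so would be that of every
  rotate of \<phi>; by compactness finitely many rotates have a sum that is positive everywhere, and
  such a sum cannot integrate to 0.\<close>

lemma integral_pos:
  fixes \<phi> :: "real ^ 'n \<Rightarrow> real"
  assumes \<phi>: "continuous_on (sphere 0 1) \<phi>" "\<And>x. x \<in> sphere 0 1 \<Longrightarrow> 0 \<le> \<phi> x"
    and z: "z \<in> sphere 0 1" "0 < \<phi> z"
  shows "0 < (\<integral>x. \<phi> x \<partial>\<mu>)"
proof (rule ccontr)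
  assume "\<not> ?thesis"
  moreover have "0 \<le> (\<integral>x. \<phi> x \<partial>\<mu>)" using \<phi>(2) by (intro integral_nonneg_AE AE_I2) auto
  ultimately have zero: "(\<integral>x. \<phi> x \<partial>\<mu>) = 0" by simp
  have "\<exists>Q. rotation_matrix Q \<and> orthogonal_transformation ((*v) Q) \<and> Q *v w = z" if "w \<in> sphere 0 1" for w
    using rotation_transitive[OF that z(1)] by metis
  then obtain Q where Q: "\<And>w. w \<in> sphere 0 1 \<Longrightarrow> rotation_matrix (Q w)"
    "\<And>w. w \<in> sphere 0 1 \<Longrightarrow> orthogonal_transformation ((*v) (Q w))"
    "\<And>w. w \<in> sphere 0 1 \<Longrightarrow> Q w *v w = z" by metis
  have sph: "Q w *v x \<in> sphere 0 1" if "w \<in> sphere 0 1" "x \<in> sphere 0 1" for w x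
    using Q(2)[OF that(1)] that(2) by (simp add: orthogonal_transformation_norm)
  have cont: "continuous_on (sphere 0 1) (\<lambda>x. \<phi> (Q w *v x))" if "w \<in> sphere 0 1" for w
    using continuous_on_rotate[OF Q(2)[OF that] \<phi>(1)] .
  have "\<exists>U. open U \<and> U \<inter> sphere 0 1 = (\<lambda>x. \<phi> (Q w *v x)) -` {0<..} \<inter> sphere 0 1" if "w \<in> sphere 0 1" for w
    using cont[OF that] unfolding continuous_on_open_invariant by (metis open_greaterThan)
  then obtain U where U: "\<And>w. w \<in> sphere 0 1 \<Longrightarrow> open (U w)"
    "\<And>w. w \<in> sphere 0 1 \<Longrightarrow> U w \<inter> sphere 0 1 = (\<lambda>x. \<phi> (Q w *v x)) -` {0<..} \<inter> sphere 0 1" by metis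
  have wU: "w \<in> U w" if "w \<in> sphere 0 1" for w
  proof -
    have "w \<in> (\<lambda>x. \<phi> (Q w *v x)) -` {0<..} \<inter> sphere 0 1" using Q(3)[OF that] z that by simp
    then show ?thesis using U(2)[OF that] by blast
  qed
  obtain W where W: "W \<subseteq> sphere 0 1" "finite W" "sphere 0 1 \<subseteq> (\<Union>w\<in>W. U w)"
  proof (rule compactE_image[OF compact_sphere, of "sphere 0 1" U "0 :: real ^ 'n" 1])
    show "open (U w)" if "w \<in> sphere 0 1" for w using U(1)[OF that] .
    show "sphere 0 1 \<subseteq> (\<Union>w\<in>sphere 0 1. U w)" using wU by blast
  qed blast
  define \<Phi> where "\<Phi> x = (\<Sum>w\<in>W. \<phi> (Q w *v x))" for x
  have \<Phi>c: "continuous_on (sphere 0 1) \<Phi>"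
    unfolding \<Phi>_def[abs_def] using cont W by (intro continuous_on_sum) auto
  have pos: "0 < \<Phi> x" if x: "x \<in> sphere 0 1" for x
  proof -
    obtain w where w: "w \<in> W" "x \<in> U w" using W x by blast
    then have "0 < \<phi> (Q w *v x)" using U(2)[of w] W x by blast
    then show ?thesis unfolding \<Phi>_def
      using W w x sph \<phi>(2) by (intro sum_pos2[of _ w]) auto
  qed
  have "(\<integral>x. \<Phi> x \<partial>\<mu>) = (\<Sum>w\<in>W. \<integral>x. \<phi> (Q w *v x) \<partial>\<mu>)"
    unfolding \<Phi>_def using W cont by (intro Bochner_Integration.integral_sum integrable_continuous) auto
  also have "\<dots> = 0"
    using W Q(1) rotation_invariant[OF _ \<phi>(1)] zero by (intro sum.neutral) auto
  finally have "AE x in \<mu>. \<Phi> x = 0"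
    using integral_nonneg_eq_0_iff_AE[OF integrable_continuous[OF \<Phi>c]] pos
    by (metis (no_types, lifting) AE_I2 less_imp_le space_eq)
  then have "AE x in \<mu>. False"
    by (rule AE_mp[OF _ AE_I2]) (use pos in force)
  then show False by simp
qed

end

section \<open>Householder reflections and invariance under them\<close>

definition reflect_along :: "'a::real_inner \<Rightarrow> 'a \<Rightarrow> 'a" where
  "reflect_along u x = x - (2 * (x \<bullet> u)) *\<^sub>R u"

lemma reflect_along_involution [simp]:
  "norm u = 1 \<Longrightarrow> reflect_along u (reflect_along u x) = x"
  by (simp add: reflect_along_def inner_diff_left norm_eq_1)

lemma inner_reflect_along [simp]:
  "norm u = 1 \<Longrightarrow> reflect_along u x \<bullet> reflect_along u y = x \<bullet> y"
  by (simp add: reflect_along_def inner_diff_left inner_diff_right norm_eq_1 inner_commute algebra_simps)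

lemma norm_reflect_along [simp]: "norm u = 1 \<Longrightarrow> norm (reflect_along u x) = norm x"
  by (simp add: norm_eq_sqrt_inner)

lemma reflect_along_diff: "reflect_along u x - reflect_along u y = reflect_along u (x - y)"
  by (simp add: reflect_along_def inner_diff_left algebra_simps)

lemma dist_reflect_along [simp]: "norm u = 1 \<Longrightarrow> dist (reflect_along u x) (reflect_along u y) = dist x y"
  by (simp add: dist_norm reflect_along_diff)

lemma inner_reflect_along_swap: "reflect_along u x \<bullet> y = x \<bullet> reflect_along u y"
  by (simp add: reflect_along_def inner_diff_left inner_diff_right inner_commute)

lemma continuous_on_reflect_along [continuous_intros]:
  "continuous_on S f \<Longrightarrow> continuous_on S (\<lambda>x. reflect_along u (f x))"
  unfolding reflect_along_def by (intro continuous_intros)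

context sphere_measure
begin

text \<open>The tent of radius r is a continuous substitute for the indicator of a cap, so that
  \<open>rotation_invariant\<close> applies to it.\<close>

lemma cap_integral_eq:
  fixes r :: real and z z' :: "real ^ 'n"
  assumes "z \<in> sphere 0 1" "z' \<in> sphere 0 1"
  shows "(\<integral>x. max 0 (r - dist x z) \<partial>\<mu>) = (\<integral>x. max 0 (r - dist x z') \<partial>\<mu>)"
proof -
  obtain Q where Q: "rotation_matrix Q" "orthogonal_transformation ((*v) Q)" "Q *v z = z'"
    using rotation_transitive[OF assms] .
  have "dist (Q *v x) z' = dist x z" for x
    using Q(2,3) unfolding orthogonal_transformation_isometry by metis
  then show ?thesis
    using rotation_invariant[OF Q(1), of "\<lambda>x. max 0 (r - dist x z')"] by (simp add: continuous_intros)
qed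

text \<open>Reflections have determinant -1, so they are not covered by the hypothesis on \<open>\<mu>\<close>. Averaging
  \<open>\<phi>\<close> over small caps, whose measure does not depend on the centre, and exchanging the order of
  integration shows that the image of \<open>\<mu>\<close> under the reflection is \<open>\<mu>\<close>.\<close>

lemma reflection_invariant:
  fixes \<phi> :: "real ^ 'n \<Rightarrow> real"
  assumes u: "norm u = 1" and \<phi>: "continuous_on (sphere 0 1) \<phi>"
  shows "(\<integral>x. \<phi> (reflect_along u x) \<partial>\<mu>) = (\<integral>x. \<phi> x \<partial>\<mu>)"
proof -
  let ?\<sigma> = "reflect_along u"
  have \<sigma>S: "?\<sigma> y \<in> sphere 0 1 \<longleftrightarrow> y \<in> sphere 0 1" for y using u by simp
  have \<phi>\<sigma>: "continuous_on (sphere 0 1) (\<lambda>y. \<phi> (?\<sigma> y))"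
    by (rule continuous_on_compose2[OF \<phi>]) (use u in \<open>auto intro!: continuous_intros\<close>)
  have "\<bar>(\<integral>x. \<phi> (?\<sigma> x) \<partial>\<mu>) - (\<integral>x. \<phi> x \<partial>\<mu>)\<bar> \<le> e" if e: "0 < e" for e
  proof -
    have "uniformly_continuous_on (sphere 0 1) \<phi>"
      by (rule compact_uniformly_continuous[OF \<phi>]) simp
    then obtain r where r: "0 < r" "\<And>x x'. x \<in> sphere 0 1 \<Longrightarrow> x' \<in> sphere 0 1 \<Longrightarrow> dist x' x < r \<Longrightarrow> dist (\<phi> x') (\<phi> x) < e"
      using e unfolding uniformly_continuous_on_def by metis
    define K where "K x z = max 0 (r - dist x z)" for x z :: "real ^ 'n"
    define g where "g = (\<integral>x. K x u \<partial>\<mu>)"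
    have uS: "u \<in> sphere 0 1" using u by simp
    have Kc: "continuous_on S (\<lambda>x. K x z)" for S z unfolding K_def by (intro continuous_intros)
    have Kg: "(\<integral>x. K x z \<partial>\<mu>) = g" if "z \<in> sphere 0 1" for z
      unfolding g_def K_def by (rule cap_integral_eq[OF that uS])
    have gpos: "0 < g"
      unfolding g_def using uS r(1) by (intro integral_pos[of _ u] Kc) (auto simp: K_def)
    \<comment> \<open>The reflection is an isometric involution, so integrating the kernel over y is
      again integrating a tent, now centred at \<open>?\<sigma> x\<close>.\<close>
    have K\<sigma>: "K x (?\<sigma> y) = K y (?\<sigma> x)" for x y
      using dist_reflect_along[OF u, of x "?\<sigma> y"] u by (simp add: K_def dist_commute)
    obtain B where B: "\<And>x. x \<in> sphere 0 1 \<Longrightarrow> \<bar>\<phi> x\<bar> \<le> B" using continuous_bound[OF \<phi>] by blast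
    have Kr: "\<bar>K x z\<bar> \<le> r" for x z using r by (simp add: K_def)
    interpret P: pair_prob_space \<mu> \<mu> ..
    have fst_m: "fst \<in> measurable (\<mu> \<Otimes>\<^sub>M \<mu>) borel" and snd_m: "snd \<in> measurable (\<mu> \<Otimes>\<^sub>M \<mu>) borel"
      using measurable_compose[OF measurable_fst measurable_ident_borel]
        measurable_compose[OF measurable_snd measurable_ident_borel] by auto
    have \<sigma>m: "?\<sigma> \<in> borel_measurable borel"
      by (intro borel_measurable_continuous_onI continuous_intros)
    have "(\<lambda>p. K (fst p) (?\<sigma> (snd p)) * \<phi> (fst p)) \<in> borel_measurable (\<mu> \<Otimes>\<^sub>M \<mu>)"
      unfolding K_def
      by (intro borel_measurable_times borel_measurable_max borel_measurable_const borel_measurable_diff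
          borel_measurable_dist fst_m measurable_compose[OF snd_m \<sigma>m]
          measurable_compose[OF measurable_fst measurable_continuous[OF \<phi>]])
    moreover have "\<bar>K x (?\<sigma> y) * \<phi> x\<bar> \<le> r * B" if "x \<in> sphere 0 1" for x y
      unfolding abs_mult using Kr B[OF that] r by (intro mult_mono) auto
    ultimately have int2: "integrable (\<mu> \<Otimes>\<^sub>M \<mu>) (\<lambda>(x, y). K x (?\<sigma> y) * \<phi> x)"
      by (intro P.integrable_const_bound[of _ "r * B"] AE_I2)
         (auto simp: space_pair_measure split_beta')
    have "(\<integral>y. (\<integral>x. K x (?\<sigma> y) * \<phi> x \<partial>\<mu>) \<partial>\<mu>) = (\<integral>x. (\<integral>y. K x (?\<sigma> y) * \<phi> x \<partial>\<mu>) \<partial>\<mu>)"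
      by (rule P.Fubini_integral[OF int2])
    also have "\<dots> = (\<integral>x. g * \<phi> x \<partial>\<mu>)"
    proof (rule Bochner_Integration.integral_cong[OF refl])
      fix x assume "x \<in> space \<mu>"
      then show "(\<integral>y. K x (?\<sigma> y) * \<phi> x \<partial>\<mu>) = g * \<phi> x"
        using Kg[of "?\<sigma> x"] u unfolding K\<sigma>[of x] by simp
    qed
    finally have B1: "(\<integral>y. (\<integral>x. K x (?\<sigma> y) * \<phi> x \<partial>\<mu>) \<partial>\<mu>) = g * (\<integral>x. \<phi> x \<partial>\<mu>)" by simp
    \<comment> \<open>The tent lives within distance r of \<open>?\<sigma> y\<close>, where \<phi>
      varies by less than e. The factor g is positive by full support and is cancelled at the
      end.\<close>
    have inner: "\<bar>g * \<phi> (?\<sigma> y) - (\<integral>x. K x (?\<sigma> y) * \<phi> x \<partial>\<mu>)\<bar> \<le> e * g" if y: "y \<in> sphere 0 1" for y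
    proof -
      have sy: "?\<sigma> y \<in> sphere 0 1" using y u by simp
      have i1: "integrable \<mu> (\<lambda>x. K x (?\<sigma> y) * \<phi> (?\<sigma> y))" "integrable \<mu> (\<lambda>x. K x (?\<sigma> y) * \<phi> x)"
        "integrable \<mu> (\<lambda>x. e * K x (?\<sigma> y))"
        by (intro integrable_continuous continuous_intros Kc \<phi>)+
      have "g * \<phi> (?\<sigma> y) - (\<integral>x. K x (?\<sigma> y) * \<phi> x \<partial>\<mu>) = (\<integral>x. K x (?\<sigma> y) * \<phi> (?\<sigma> y) - K x (?\<sigma> y) * \<phi> x \<partial>\<mu>)"
        using i1 Kg[OF sy] by simp
      also have "\<bar>\<dots>\<bar> \<le> (\<integral>x. \<bar>K x (?\<sigma> y) * \<phi> (?\<sigma> y) - K x (?\<sigma> y) * \<phi> x\<bar> \<partial>\<mu>)"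
        by (rule integral_abs_bound)
      also have "\<dots> \<le> (\<integral>x. e * K x (?\<sigma> y) \<partial>\<mu>)"
      proof (rule integral_mono)
        fix x assume x: "x \<in> space \<mu>"
        have K0: "0 \<le> K x (?\<sigma> y)" by (simp add: K_def)
        have "\<bar>K x (?\<sigma> y) * \<phi> (?\<sigma> y) - K x (?\<sigma> y) * \<phi> x\<bar> = K x (?\<sigma> y) * \<bar>\<phi> (?\<sigma> y) - \<phi> x\<bar>"
          using K0 by (simp add: abs_mult flip: right_diff_distrib)
        also have "\<dots> \<le> K x (?\<sigma> y) * e"
        proof (cases "dist x (?\<sigma> y) < r")
          case True
          then have "\<bar>\<phi> (?\<sigma> y) - \<phi> x\<bar> \<le> e"
            using r(2)[of x "?\<sigma> y"] x sy by (simp add: dist_real_def dist_commute)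
          then show ?thesis using K0 by (intro mult_left_mono)
        qed (simp add: K_def)
        finally show "\<bar>K x (?\<sigma> y) * \<phi> (?\<sigma> y) - K x (?\<sigma> y) * \<phi> x\<bar> \<le> e * K x (?\<sigma> y)" by (simp add: mult.commute)
      qed (use i1 in auto)
      also have "\<dots> = e * g" using Kg[OF sy] by simp
      finally show ?thesis .
    qed
    have iJ: "integrable \<mu> (\<lambda>y. \<integral>x. K x (?\<sigma> y) * \<phi> x \<partial>\<mu>)"
      using P.integrable_snd[OF int2] .
    have iL: "integrable \<mu> (\<lambda>y. g * \<phi> (?\<sigma> y))" by (intro integrable_continuous continuous_intros \<phi>\<sigma>)
    have "g * (\<integral>x. \<phi> (?\<sigma> x) \<partial>\<mu>) - g * (\<integral>x. \<phi> x \<partial>\<mu>)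
       = (\<integral>y. g * \<phi> (?\<sigma> y) - (\<integral>x. K x (?\<sigma> y) * \<phi> x \<partial>\<mu>) \<partial>\<mu>)"
      using B1 iJ iL by simp
    also have "\<bar>\<dots>\<bar> \<le> (\<integral>y. \<bar>g * \<phi> (?\<sigma> y) - (\<integral>x. K x (?\<sigma> y) * \<phi> x \<partial>\<mu>)\<bar> \<partial>\<mu>)"
      by (rule integral_abs_bound)
    also have "\<dots> \<le> (\<integral>y. e * g \<partial>\<mu>)"
      using inner iJ iL by (intro integral_mono) auto
    also have "\<dots> = e * g" by (simp add: prob_space[simplified])
    finally have "g * \<bar>(\<integral>x. \<phi> (?\<sigma> x) \<partial>\<mu>) - (\<integral>x. \<phi> x \<partial>\<mu>)\<bar> \<le> g * e"
      using gpos by (simp add: abs_mult mult.commute flip: right_diff_distrib)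
    then show ?thesis using gpos by (simp only: mult_le_cancel_left_pos)
  qed
  then have "\<bar>(\<integral>x. \<phi> (?\<sigma> x) \<partial>\<mu>) - (\<integral>x. \<phi> x \<partial>\<mu>)\<bar> \<le> 0"
    by (rule field_le_epsilon) simp
  then show ?thesis by simp
qed

end

section \<open>Moments of the height\<close>

lemma sum_even_powers:
  fixes c :: "nat \<Rightarrow> real"
  shows "(\<Sum>i\<le>2 * l. (if even i then c (i div 2) else 0) * x ^ i) = (\<Sum>j\<le>l. c j * x ^ (2 * j))"
  by (induction l) simp_all

context sphere_measure
begin

text \<open>The index \<open>undefined\<close> serves as an arbitrary coordinate; by
  \<open>integral_inner_rotate\<close> all unit directions have the same moments.\<close>

definition zonal_moment :: "nat \<Rightarrow> real" where
  "zonal_moment k = (\<integral>x. (x $ undefined) ^ k \<partial>\<mu>)"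

lemma integral_inner_rotate:
  fixes h :: "real \<Rightarrow> real"
  assumes "norm v = 1" "norm w = 1" "continuous_on {-1..1} h"
  shows "(\<integral>x. h (x \<bullet> v) \<partial>\<mu>) = (\<integral>x. h (x \<bullet> w) \<partial>\<mu>)"
proof -
  obtain Q where Q: "rotation_matrix Q" "orthogonal_transformation ((*v) Q)" "Q *v v = w"
    using rotation_transitive[of v w] assms by auto
  have c: "continuous_on (sphere 0 1) (\<lambda>x. h (x \<bullet> w))"
  proof (rule continuous_on_compose2[OF assms(3)])
    show "(\<lambda>x. x \<bullet> w) ` sphere 0 1 \<subseteq> {-1..1}"
    proof clarsimp
      fix x :: "real ^ 'n" assume "norm x = 1"
      then show "- 1 \<le> x \<bullet> w \<and> x \<bullet> w \<le> 1"
        using Cauchy_Schwarz_ineq2[of x w] assms(2) by (simp add: abs_le_iff)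
    qed
  qed (intro continuous_intros)
  have "(Q *v x) \<bullet> w = x \<bullet> v" for x
    using Q(2,3) unfolding orthogonal_transformation_def by metis
  then show ?thesis using rotation_invariant[OF Q(1) c] by simp
qed

lemma zonal_moment_inner:
  "(\<integral>x. (x \<bullet> v) ^ k \<partial>\<mu>) = norm v ^ k * zonal_moment k" if "v \<noteq> 0"
proof -
  have "(\<integral>x. (x \<bullet> v) ^ k \<partial>\<mu>) = (\<integral>x. norm v ^ k * (x \<bullet> sgn v) ^ k \<partial>\<mu>)"
    using that by (intro Bochner_Integration.integral_cong refl)
      (simp add: sgn_div_norm power_mult_distrib[symmetric] mult.assoc[symmetric])
  also have "\<dots> = norm v ^ k * (\<integral>x. (x \<bullet> sgn v) ^ k \<partial>\<mu>)" by simp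
  also have "(\<integral>x. (x \<bullet> sgn v) ^ k \<partial>\<mu>) = (\<integral>x. (x \<bullet> axis undefined 1) ^ k \<partial>\<mu>)"
    using that by (intro integral_inner_rotate continuous_intros) (auto simp: norm_sgn norm_axis_1)
  finally show ?thesis by (simp add: zonal_moment_def inner_axis)
qed

text \<open>A rotation carries a direction to its opposite, so both have the same moments.\<close>

lemma zonal_moment_odd:
  assumes "odd k"
  shows "zonal_moment k = 0"
proof -
  have nz: "axis undefined (1::real) \<noteq> (0 :: real ^ 'n)" by (simp add: axis_eq_0_iff)
  have "norm (axis undefined (1::real) :: real ^ 'n) = 1" by (simp add: norm_axis_1)
  then have "zonal_moment k = (\<integral>x. (x \<bullet> (- axis undefined 1)) ^ k \<partial>\<mu>)"
    using zonal_moment_inner[of "- axis undefined 1" k] nz by simp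
  also have "\<dots> = - zonal_moment k"
    using assms by (simp add: inner_axis zonal_moment_def)
  finally show ?thesis by simp
qed

text \<open>Compare the coefficients of \<open>s\<^sup>2\<close> in the moment of order \<open>k + 2\<close> in the direction \<open>v + s w\<close>.\<close>

lemma zonal_mixed_moment:
  fixes v w :: "real ^ 'n"
  assumes v: "norm v = 1" and w: "norm w = 1" and vw: "v \<bullet> w = 0" and k: "even k"
  shows "(k + 1) * (\<integral>x. (x \<bullet> v) ^ k * (x \<bullet> w)\<^sup>2 \<partial>\<mu>) = zonal_moment (k + 2)"
proof -
  obtain j where j: "k = 2 * j" using k by blast
  define l where "l = j + 1"
  have l: "k + 2 = 2 * l" by (simp add: l_def j)
  define c where "c i = (2 * l choose i) * (\<integral>x. (x \<bullet> v) ^ (2 * l - i) * (x \<bullet> w) ^ i \<partial>\<mu>)" for i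
  define d where "d i = (if even i then (l choose (i div 2)) * zonal_moment (2 * l) else 0)" for i
  have "(\<Sum>i\<le>2 * l. c i * s ^ i) = (\<Sum>i\<le>2 * l. d i * s ^ i)" for s :: real
  proof -
    have n2: "(norm (v + s *\<^sub>R w))\<^sup>2 = 1 + s\<^sup>2"
      unfolding power2_norm_eq_inner using v w vw
      by (simp add: inner_add_left inner_add_right inner_commute norm_eq_1 power2_eq_square)
    have nz: "v + s *\<^sub>R w \<noteq> 0"
    proof
      assume "v + s *\<^sub>R w = 0"
      then have "1 + s\<^sup>2 = 0" using n2 by simp
      then show False by (metis add_pos_nonneg zero_le_power2 zero_less_one less_irrefl)
    qed
    have "(\<Sum>i\<le>2 * l. c i * s ^ i) = (\<Sum>i\<le>2 * l. \<integral>x. (2 * l choose i) * (x \<bullet> (s *\<^sub>R w)) ^ i * (x \<bullet> v) ^ (2 * l - i) \<partial>\<mu>)"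
      unfolding c_def
      by (intro sum.cong refl) (simp add: power_mult_distrib mult_ac flip: integral_mult_right_zero integral_mult_left_zero)
    also have "\<dots> = (\<integral>x. (\<Sum>i\<le>2 * l. (2 * l choose i) * (x \<bullet> (s *\<^sub>R w)) ^ i * (x \<bullet> v) ^ (2 * l - i)) \<partial>\<mu>)"
      by (intro Bochner_Integration.integral_sum[symmetric] integrable_continuous continuous_intros)
    also have "\<dots> = (\<integral>x. (x \<bullet> (v + s *\<^sub>R w)) ^ (2 * l) \<partial>\<mu>)"
      by (simp add: inner_add_right add.commute[of "_ \<bullet> v"] binomial_ring)
    also have "\<dots> = norm (v + s *\<^sub>R w) ^ (2 * l) * zonal_moment (2 * l)"
      by (rule zonal_moment_inner[OF nz])
    also have "norm (v + s *\<^sub>R w) ^ (2 * l) = (s\<^sup>2 + 1) ^ l"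
      unfolding power_mult n2 by (simp add: add.commute)
    also have "\<dots> = (\<Sum>j\<le>l. (l choose j) * s ^ (2 * j))"
      by (simp add: binomial_ring power_mult)
    also have "\<dots> * zonal_moment (2 * l) = (\<Sum>j\<le>l. ((l choose j) * zonal_moment (2 * l)) * s ^ (2 * j))"
      by (simp add: sum_distrib_right sum_distrib_left mult_ac)
    also have "\<dots> = (\<Sum>i\<le>2 * l. d i * s ^ i)"
      unfolding d_def by (rule sum_even_powers[symmetric])
    finally show ?thesis .
  qed
  then have "\<forall>s. (\<Sum>i\<le>2 * l. c i * s ^ i) = (\<Sum>i\<le>2 * l. d i * s ^ i)" by blast
  then have "\<forall>i\<le>2 * l. c i = d i" by (simp only: polyfun_eq_coeffs)
  then have "c 2 = d 2" by (simp add: l_def)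
  \<comment> \<open>Since l = k/2 + 1, the binomial coefficient is l (2 l - 1) = l (k + 1), and the
    factor l cancels.\<close>
  then have "(2 * l choose 2) * (\<integral>x. (x \<bullet> v) ^ k * (x \<bullet> w)\<^sup>2 \<partial>\<mu>) = l * zonal_moment (2 * l)"
    using l by (simp add: c_def d_def l_def j)
  moreover have "real (2 * l choose 2) = l * (k + 1)"
    by (simp add: choose_two l_def j)
  ultimately have "real l * ((k + 1) * (\<integral>x. (x \<bullet> v) ^ k * (x \<bullet> w)\<^sup>2 \<partial>\<mu>)) = real l * zonal_moment (2 * l)"
    by (simp only: mult.assoc of_nat_mult)
  then show ?thesis unfolding l using l_def by (simp add: add.commute)
qed

text \<open>Multiply x_i^k by 1, the sum of all x_j^2. The term j = i is the moment of order k + 2,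
  and each of the other n - 1 terms is that moment divided by k + 1.\<close>

lemma zonal_moment_Suc_Suc:
  assumes "even k"
  shows "(CARD('n) + k) * zonal_moment (k + 2) = (k + 1) * zonal_moment k"
proof -
  define i :: 'n where "i = undefined"
  have M: "zonal_moment j = (\<integral>x. (x $ i) ^ j \<partial>\<mu>)" for j by (simp add: zonal_moment_def i_def)
  have ic: "integrable \<mu> (\<lambda>x. (x $ i) ^ a * (x $ j) ^ b)" for a b j
    by (intro integrable_continuous continuous_intros)
  have mix: "(k + 1) * (\<integral>x. (x $ i) ^ k * (x $ j)\<^sup>2 \<partial>\<mu>) = zonal_moment (k + 2)" if "j \<noteq> i" for j
  proof -
    have "axis i (1::real) $ j = 0" using that by (simp add: axis_def)
    then show ?thesis
      using zonal_mixed_moment[of "axis i 1" "axis j 1" k] assms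
      by (simp add: inner_axis norm_axis_1 add.commute)
  qed
  have "(k + 1) * zonal_moment k = (k + 1) * (\<integral>x. (\<Sum>j\<in>UNIV. (x $ i) ^ k * (x $ j)\<^sup>2) \<partial>\<mu>)"
  proof -
    have "(x $ i) ^ k = (\<Sum>j\<in>UNIV. (x $ i) ^ k * (x $ j)\<^sup>2)" if "x \<in> space \<mu>" for x
    proof -
      have "(\<Sum>j\<in>UNIV. (x $ j)\<^sup>2) = x \<bullet> x" by (simp add: inner_vec_def power2_eq_square)
      also have "\<dots> = 1" using that by (simp add: norm_eq_1[symmetric])
      finally show ?thesis by (simp flip: sum_distrib_left)
    qed
    then have "(\<integral>x. (x $ i) ^ k \<partial>\<mu>) = (\<integral>x. (\<Sum>j\<in>UNIV. (x $ i) ^ k * (x $ j)\<^sup>2) \<partial>\<mu>)"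
      by (intro Bochner_Integration.integral_cong refl)
    then show ?thesis unfolding M by simp
  qed
  also have "\<dots> = (\<Sum>j\<in>UNIV. (k + 1) * (\<integral>x. (x $ i) ^ k * (x $ j)\<^sup>2 \<partial>\<mu>))"
    using ic by (subst Bochner_Integration.integral_sum) (auto simp: sum_distrib_left)
  also have "\<dots> = (k + 1) * (\<integral>x. (x $ i) ^ k * (x $ i)\<^sup>2 \<partial>\<mu>) + (\<Sum>j\<in>UNIV - {i}. zonal_moment (k + 2))"
    using mix by (subst sum.remove[of _ i]) auto
  also have "(\<integral>x. (x $ i) ^ k * (x $ i)\<^sup>2 \<partial>\<mu>) = zonal_moment (k + 2)"
    unfolding M by (simp only: power_add)
  also have "(\<Sum>j\<in>UNIV - {i}. zonal_moment (k + 2)) = (real (CARD('n)) - 1) * zonal_moment (k + 2)"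
    using card_ge_2 by (simp add: of_nat_diff)
  finally show ?thesis by (simp add: algebra_simps)
qed

lemma zonal_moment_eq_lat_mean:
  "zonal_moment k = lat_mean (CARD('n) - 2) (\<lambda>s. sin s ^ k)"
proof (cases "odd k")
  case True
  have "lat_mean (CARD('n) - 2) (\<lambda>s. sin s ^ k) = lat_mean (CARD('n) - 2) (\<lambda>s. - (sin s ^ k))"
    using lat_mean_reflect[of "CARD('n) - 2" "\<lambda>s. sin s ^ k"] True by simp
  then show ?thesis using zonal_moment_odd[OF True] by (simp add: lat_mean_uminus)
next
  case False
  then obtain j where "k = 2 * j" by blast
  moreover have "zonal_moment (2 * j) = lat_mean (CARD('n) - 2) (\<lambda>s. sin s ^ (2 * j))"
  proof (induction j)
    case 0
    show ?case by (simp add: zonal_moment_def prob_space[simplified])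
  next
    case (Suc j)
    let ?m = "CARD('n) - 2"
    have e: "real ?m + 2 = real CARD('n)" using card_ge_2 by (simp add: of_nat_diff)
    have "(real CARD('n) + real (2 * j)) * lat_mean ?m (\<lambda>s. sin s ^ (2 * j + 2))
        = (real (2 * j) + 1) * lat_mean ?m (\<lambda>s. sin s ^ (2 * j))"
      using lat_mean_sin_power_Suc_Suc[of ?m "2 * j"] unfolding e .
    moreover have "(real CARD('n) + real (2 * j)) * zonal_moment (2 * j + 2)
        = (real (2 * j) + 1) * zonal_moment (2 * j)"
      using zonal_moment_Suc_Suc[of "2 * j", OF dvd_triv_left] by (simp only: of_nat_add of_nat_1)
    ultimately have "(CARD('n) + 2 * j) * zonal_moment (2 * j + 2) = (CARD('n) + 2 * j) * lat_mean ?m (\<lambda>s. sin s ^ (2 * j + 2))"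
      using Suc by (simp only: of_nat_add)
    moreover have "real (CARD('n) + 2 * j) \<noteq> 0" using card_ge_2 by simp
    ultimately have "zonal_moment (2 * j + 2) = lat_mean ?m (\<lambda>s. sin s ^ (2 * j + 2))"
      by (metis mult_cancel_left)
    then show ?case by simp
  qed
  ultimately show ?thesis by simp
qed

text \<open>Moments determine a law on the compact interval [-1, 1]: replacing h by a polynomial
  within \<epsilon>/2 of it, as the Weierstrass theorem allows, changes either side by at most
  \<epsilon>/2.\<close>

lemma integral_zonal:
  fixes h :: "real \<Rightarrow> real" and e :: "real ^ 'n"
  assumes e: "norm e = 1" and h: "continuous_on {-1..1} h"
  shows "(\<integral>x. h (x \<bullet> e) \<partial>\<mu>) = lat_mean (CARD('n) - 2) (\<lambda>s. h (sin s))"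
proof -
  let ?m = "CARD('n) - 2"
  have rng: "x \<bullet> e \<in> {-1..1}" if "x \<in> sphere 0 1" for x
    using Cauchy_Schwarz_ineq2[of x e] e that by (auto simp: abs_le_iff)
  have cin: "continuous_on (sphere 0 1) (\<lambda>x. g (x \<bullet> e))" if "continuous_on {-1..1} g" for g :: "real \<Rightarrow> real"
    by (rule continuous_on_compose2[OF that]) (use rng in \<open>auto intro!: continuous_intros\<close>)
  have csin: "continuous_on S (\<lambda>s. g (sin s))" if "continuous_on {-1..1} g" for g :: "real \<Rightarrow> real" and S
    by (rule continuous_on_compose2[OF that]) (auto intro!: continuous_intros)
  have "\<bar>(\<integral>x. h (x \<bullet> e) \<partial>\<mu>) - lat_mean ?m (\<lambda>s. h (sin s))\<bar> \<le> 0 + \<epsilon>" if eps: "0 < \<epsilon>" for \<epsilon>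
  proof -
    obtain g where g: "real_polynomial_function g" "\<And>x. x \<in> {-1..1} \<Longrightarrow> \<bar>h x - g x\<bar> < \<epsilon>/2"
      using Stone_Weierstrass_real_polynomial_function[OF compact_Icc h half_gt_zero[OF eps]] by blast
    obtain a n where a: "g = (\<lambda>x. \<Sum>i\<le>n. a i * x ^ i)"
      using g(1) real_polynomial_function_iff_sum by blast
    have gc: "continuous_on S g" for S unfolding a by (intro continuous_intros)
    have "(\<integral>x. g (x \<bullet> e) \<partial>\<mu>) = (\<Sum>i\<le>n. a i * (\<integral>x. (x \<bullet> e) ^ i \<partial>\<mu>))"
      unfolding a by (subst Bochner_Integration.integral_sum)
        (auto intro!: integrable_continuous continuous_intros)
    also have "\<dots> = (\<Sum>i\<le>n. a i * lat_mean ?m (\<lambda>s. sin s ^ i))"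
      using e by (subst zonal_moment_inner) (auto simp: zonal_moment_eq_lat_mean)
    also have "\<dots> = lat_mean ?m (\<lambda>s. g (sin s))"
      unfolding a lat_mean_def sum_distrib_right
      by (subst Henstock_Kurzweil_Integration.integral_sum)
         (auto intro!: integrable_continuous_interval continuous_intros simp: mult.assoc)
    finally have eq: "(\<integral>x. g (x \<bullet> e) \<partial>\<mu>) = lat_mean ?m (\<lambda>s. g (sin s))" .
    have gs: "h (sin s) \<le> g (sin s) + \<epsilon>/2" "g (sin s) \<le> h (sin s) + \<epsilon>/2" for s
      using g(2)[of "sin s"] unfolding abs_less_iff by simp_all
    have "\<bar>(\<integral>x. h (x \<bullet> e) \<partial>\<mu>) - (\<integral>x. g (x \<bullet> e) \<partial>\<mu>)\<bar> \<le> \<epsilon>/2"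
    proof -
      have i: "integrable \<mu> (\<lambda>x. h (x \<bullet> e))" "integrable \<mu> (\<lambda>x. g (x \<bullet> e))"
        by (intro integrable_continuous cin h gc)+
      have "\<bar>(\<integral>x. h (x \<bullet> e) \<partial>\<mu>) - (\<integral>x. g (x \<bullet> e) \<partial>\<mu>)\<bar> = \<bar>\<integral>x. h (x \<bullet> e) - g (x \<bullet> e) \<partial>\<mu>\<bar>"
        using i by simp
      also have "\<dots> \<le> (\<integral>x. \<bar>h (x \<bullet> e) - g (x \<bullet> e)\<bar> \<partial>\<mu>)" by (rule integral_abs_bound)
      also have "\<dots> \<le> (\<integral>x. \<epsilon>/2 \<partial>\<mu>)"
        using i g(2) rng by (intro integral_mono) (auto intro: less_imp_le)
      finally show ?thesis by (simp add: prob_space[simplified])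
    qed
    moreover have "\<bar>lat_mean ?m (\<lambda>s. h (sin s)) - lat_mean ?m (\<lambda>s. g (sin s))\<bar> \<le> \<epsilon>/2"
    proof -
      have "lat_mean ?m (\<lambda>s. h (sin s)) \<le> lat_mean ?m (\<lambda>s. g (sin s) + \<epsilon>/2)"
        by (intro lat_mean_mono csin[OF h] csin[OF gc] continuous_intros gs)
      moreover have "lat_mean ?m (\<lambda>s. g (sin s)) \<le> lat_mean ?m (\<lambda>s. h (sin s) + \<epsilon>/2)"
        by (intro lat_mean_mono csin[OF h] csin[OF gc] continuous_intros gs)
      ultimately have "lat_mean ?m (\<lambda>s. h (sin s)) \<le> lat_mean ?m (\<lambda>s. g (sin s)) + \<epsilon>/2"
        "lat_mean ?m (\<lambda>s. g (sin s)) \<le> lat_mean ?m (\<lambda>s. h (sin s)) + \<epsilon>/2"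
        by (simp_all add: lat_mean_add csin[OF h] csin[OF gc])
      then show ?thesis by (intro abs_leI) linarith+
    qed
    ultimately show ?thesis using eq by linarith
  qed
  then have "\<bar>(\<integral>x. h (x \<bullet> e) \<partial>\<mu>) - lat_mean ?m (\<lambda>s. h (sin s))\<bar> \<le> 0"
    by (rule field_le_epsilon)
  then show ?thesis by simp
qed

end

section \<open>Polarization and monotone rearrangement\<close>

lemma inner_unit_bounds:
  assumes "x \<in> sphere 0 1" "y \<in> sphere 0 1"
  shows "- 1 \<le> x \<bullet> y" "x \<bullet> y \<le> 1"
  using Cauchy_Schwarz_ineq2[of x y] assms by (auto simp: abs_le_iff)

lemma geodesic_dist_le_pi:
  assumes "x \<in> sphere 0 1" "y \<in> sphere 0 1"
  shows "geodesic_dist x y \<le> pi"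
  using inner_unit_bounds[OF assms] by (simp add: geodesic_dist_def arccos_ubound)

lemma geodesic_dist_small:
  assumes x: "x \<in> sphere 0 1" and e: "0 < e"
  obtains d where "0 < d" "\<And>y. y \<in> sphere 0 1 \<Longrightarrow> norm (x - y) < d \<Longrightarrow> geodesic_dist x y < e"
proof -
  have "continuous_on (sphere 0 1) (\<lambda>y. geodesic_dist x y)"
    unfolding geodesic_dist_def
    by (rule continuous_on_compose2[OF continuous_on_arccos'])
       (use inner_unit_bounds[OF x] in \<open>auto intro!: continuous_intros\<close>)
  moreover have "geodesic_dist x x = 0" using x by (simp add: geodesic_dist_def norm_eq_1)
  ultimately obtain d where d: "0 < d" "\<And>y. y \<in> sphere 0 1 \<Longrightarrow> dist y x < d \<Longrightarrow> dist (geodesic_dist x y) 0 < e"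
    using x e unfolding continuous_on_iff by metis
  show ?thesis
  proof (rule that[OF d(1)])
    fix y assume "y \<in> sphere 0 1" "norm (x - y) < d"
    then have "dist (geodesic_dist x y) 0 < e" by (intro d(2)) (auto simp: dist_norm norm_minus_commute)
    then show "geodesic_dist x y < e" by (simp add: dist_real_def)
  qed
qed

lemma geodesic_lipschitzD:
  assumes "geodesic_lipschitz 1 f" "x \<in> sphere 0 1" "y \<in> sphere 0 1"
  shows "\<bar>f x - f y\<bar> \<le> geodesic_dist x y"
  using assms by (simp add: geodesic_lipschitz_def)

lemma geodesic_lipschitz_continuous:
  fixes f :: "real ^ 'n \<Rightarrow> real"
  assumes f: "geodesic_lipschitz 1 f"
  shows "continuous_on (sphere 0 1) f"
  unfolding continuous_on_iff
proof (intro ballI allI impI)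
  fix x :: "real ^ 'n" and e :: real assume x: "x \<in> sphere 0 1" and e: "0 < e"
  obtain d where d: "0 < d" "\<And>y. y \<in> sphere 0 1 \<Longrightarrow> norm (x - y) < d \<Longrightarrow> geodesic_dist x y < e"
    using geodesic_dist_small[OF x e] by blast
  show "\<exists>d>0. \<forall>x'\<in>sphere 0 1. dist x' x < d \<longrightarrow> dist (f x') (f x) < e"
  proof (intro exI[of _ d] conjI ballI impI d(1))
    fix y assume y: "y \<in> sphere 0 1" "dist y x < d"
    then have "geodesic_dist x y < e" by (intro d(2)) (auto simp: dist_norm norm_minus_commute)
    then show "dist (f y) (f x) < e"
      using geodesic_lipschitzD[OF f x y(1)] by (simp add: dist_real_def abs_minus_commute)
  qed
qed

text \<open>Also known as two-point symmetrization. On the mirror itself both branches return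
  \<open>f x\<close>.\<close>

definition polarize :: "real ^ 'n \<Rightarrow> (real ^ 'n \<Rightarrow> real) \<Rightarrow> real ^ 'n \<Rightarrow> real" where
  "polarize u f x = (if 0 \<le> x \<bullet> u then max (f x) (f (reflect_along u x)) else min (f x) (f (reflect_along u x)))"

lemma reflect_along_inner_self: "norm u = 1 \<Longrightarrow> reflect_along u x \<bullet> u = - (x \<bullet> u)"
  by (simp add: reflect_along_def inner_diff_left norm_eq_1)

lemma reflect_along_fixed: "x \<bullet> u = 0 \<Longrightarrow> reflect_along u x = x"
  by (simp add: reflect_along_def)

text \<open>For points on the same side of the mirror, two maxima or two minima are compared, and
  the distance of x and y equals that of their images. For points on opposite sides, reflecting one
  of them brings it closer to the other, so all four differences of values are at most the distance
  of x and y.\<close>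

lemma polarize_geodesic_lipschitz:
  fixes u :: "real ^ 'n"
  assumes f: "geodesic_lipschitz 1 f" and u: "norm u = 1"
  shows "geodesic_lipschitz 1 (polarize u f)"
  unfolding geodesic_lipschitz_def
proof (intro ballI)
  fix x y :: "real ^ 'n" assume x: "x \<in> sphere 0 1" and y: "y \<in> sphere 0 1"
  let ?s = "reflect_along u"
  have s: "?s x \<in> sphere 0 1" "?s y \<in> sphere 0 1" using x y u by auto
  have d: "geodesic_dist (?s x) (?s y) = geodesic_dist x y" "geodesic_dist (?s x) y = geodesic_dist x (?s y)"
    using u by (simp_all add: geodesic_dist_def inner_reflect_along_swap)
  have 1: "\<bar>f x - f y\<bar> \<le> geodesic_dist x y" "\<bar>f (?s x) - f (?s y)\<bar> \<le> geodesic_dist x y"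
    "\<bar>f x - f (?s y)\<bar> \<le> geodesic_dist x (?s y)" "\<bar>f (?s x) - f y\<bar> \<le> geodesic_dist x (?s y)"
    using geodesic_lipschitzD[OF f] x y s d by metis+
  have 2: "geodesic_dist x (?s y) \<le> geodesic_dist x y" if "(x \<bullet> u) * (y \<bullet> u) \<le> 0"
  proof -
    have "x \<bullet> y \<le> x \<bullet> ?s y"
      using that by (simp add: reflect_along_def inner_diff_right mult.commute)
    then show ?thesis
      unfolding geodesic_dist_def using inner_unit_bounds[OF x y] inner_unit_bounds[OF x s(2)]
      by (intro arccos_le_mono[THEN iffD2]) auto
  qed
  show "\<bar>polarize u f x - polarize u f y\<bar> \<le> 1 * geodesic_dist x y"
  proof (cases "0 \<le> x \<bullet> u \<longleftrightarrow> 0 \<le> y \<bullet> u")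
    case True
    then show ?thesis using 1(1,2) unfolding polarize_def max_def min_def by auto
  next
    case False
    then have "(x \<bullet> u) * (y \<bullet> u) \<le> 0" by (auto simp: mult_le_0_iff)
    from False 1 2[OF this] show ?thesis unfolding polarize_def max_def min_def by (auto split: if_splits)
  qed
qed

text \<open>The values on a mirror pair are kept or exchanged, so the sum over the pair of any
  function of the value is unchanged. Equidistribution follows by symmetrizing the integral.\<close>

lemma polarize_pair:
  fixes u :: "real ^ 'n"
  assumes "norm u = 1"
  shows "(polarize u f x = f x \<and> polarize u f (reflect_along u x) = f (reflect_along u x)) \<or>
         (polarize u f x = f (reflect_along u x) \<and> polarize u f (reflect_along u x) = f x)"
  using assms by (cases "x \<bullet> u = 0")
    (auto simp: polarize_def reflect_along_inner_self reflect_along_fixed max_def min_def)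

context sphere_measure
begin

text \<open>Equality in law, tested on continuous functions only: in this form it passes directly to
  the uniform limits produced by the Arzela-Ascoli theorem.\<close>

definition equidistributed :: "(real ^ 'n \<Rightarrow> real) \<Rightarrow> (real ^ 'n \<Rightarrow> real) \<Rightarrow> bool" where
  "equidistributed f g \<longleftrightarrow> (\<forall>\<phi> :: real \<Rightarrow> real. continuous_on UNIV \<phi> \<longrightarrow> (\<integral>x. \<phi> (f x) \<partial>\<mu>) = (\<integral>x. \<phi> (g x) \<partial>\<mu>))"

definition correlation :: "real ^ 'n \<Rightarrow> (real ^ 'n \<Rightarrow> real) \<Rightarrow> real" where
  "correlation e f = (\<integral>x. f x * (x \<bullet> e) \<partial>\<mu>)"

lemma continuous_on_reflected:
  fixes \<phi> :: "real ^ 'n \<Rightarrow> real"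
  assumes "norm u = 1" "continuous_on (sphere 0 1) \<phi>"
  shows "continuous_on (sphere 0 1) (\<lambda>x. \<phi> (reflect_along u x))"
  by (rule continuous_on_compose2[OF assms(2)]) (use assms(1) in \<open>auto intro!: continuous_intros\<close>)

lemma integral_symmetrize:
  fixes \<phi> :: "real ^ 'n \<Rightarrow> real"
  assumes u: "norm u = 1" and \<phi>: "continuous_on (sphere 0 1) \<phi>"
  shows "(\<integral>x. \<phi> x + \<phi> (reflect_along u x) \<partial>\<mu>) = 2 * (\<integral>x. \<phi> x \<partial>\<mu>)"
  using reflection_invariant[OF u \<phi>] integrable_continuous[OF \<phi>]
    integrable_continuous[OF continuous_on_reflected[OF u \<phi>]] by simp

lemma polarize_equidistributed:
  assumes f: "geodesic_lipschitz 1 f" and u: "norm u = 1"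
  shows "equidistributed f (polarize u f)"
  unfolding equidistributed_def
proof (intro allI impI)
  fix \<phi> :: "real \<Rightarrow> real" assume \<phi>: "continuous_on UNIV \<phi>"
  have c: "continuous_on (sphere 0 1) (\<lambda>x. \<phi> (g x))" if "geodesic_lipschitz 1 g" for g :: "real ^ 'n \<Rightarrow> real"
    by (rule continuous_on_compose2[OF \<phi> geodesic_lipschitz_continuous[OF that]]) simp
  have "2 * (\<integral>x. \<phi> (f x) \<partial>\<mu>) = (\<integral>x. \<phi> (f x) + \<phi> (f (reflect_along u x)) \<partial>\<mu>)"
    using integral_symmetrize[OF u c[OF f]] by simp
  also have "\<dots> = (\<integral>x. \<phi> (polarize u f x) + \<phi> (polarize u f (reflect_along u x)) \<partial>\<mu>)"
  proof (intro Bochner_Integration.integral_cong refl)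
    fix x
    show "\<phi> (f x) + \<phi> (f (reflect_along u x)) = \<phi> (polarize u f x) + \<phi> (polarize u f (reflect_along u x))"
      using polarize_pair[OF u, of f x] by auto
  qed
  also have "\<dots> = 2 * (\<integral>x. \<phi> (polarize u f x) \<partial>\<mu>)"
    using integral_symmetrize[OF u c[OF polarize_geodesic_lipschitz[OF f u]]] by simp
  finally show "(\<integral>x. \<phi> (f x) \<partial>\<mu>) = (\<integral>x. \<phi> (polarize u f x) \<partial>\<mu>)" by simp
qed

lemma equidistributed_mean:
  assumes "equidistributed f g"
  shows "(\<integral>x. f x \<partial>\<mu>) = (\<integral>x. g x \<partial>\<mu>)"
  using assms[unfolded equidistributed_def, rule_format, of "\<lambda>y. y"] by (simp add: continuous_on_id)

lemma geodesic_lipschitz_near_mean: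
  assumes f: "geodesic_lipschitz 1 f" and x: "x \<in> sphere 0 1"
  shows "\<bar>f x - (\<integral>y. f y \<partial>\<mu>)\<bar> \<le> pi"
proof -
  have i: "integrable \<mu> f" by (intro integrable_continuous geodesic_lipschitz_continuous f)
  have "\<bar>f x - (\<integral>y. f y \<partial>\<mu>)\<bar> = \<bar>\<integral>y. f x - f y \<partial>\<mu>\<bar>"
    using i by (simp add: prob_space[simplified])
  also have "\<dots> \<le> (\<integral>y. \<bar>f x - f y\<bar> \<partial>\<mu>)" by (rule integral_abs_bound)
  also have "\<dots> \<le> (\<integral>y. pi \<partial>\<mu>)"
    using i geodesic_lipschitzD[OF f x] geodesic_dist_le_pi[OF x]
    by (intro integral_mono) (auto intro: order_trans)
  finally show ?thesis by (simp add: prob_space[simplified])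
qed

section \<open>Maximizers of the correlation with the height\<close>

lemma correlation_maximizer_exists:
  assumes f: "geodesic_lipschitz 1 f" and e: "norm e = 1"
  obtains g where "geodesic_lipschitz 1 g" "equidistributed f g"
    "\<And>h. geodesic_lipschitz 1 h \<Longrightarrow> equidistributed f h \<Longrightarrow> correlation e h \<le> correlation e g"
proof -
  define F where "F = {h. geodesic_lipschitz 1 h \<and> equidistributed f h}"
  \<comment> \<open>Equidistribution fixes the mean and the sphere has diameter pi, so the whole
    class is uniformly bounded.\<close>
  define B where "B = \<bar>\<integral>x. f x \<partial>\<mu>\<bar> + pi"
  have FB: "\<bar>h x\<bar> \<le> B" if "h \<in> F" "x \<in> sphere 0 1" for h x
    using geodesic_lipschitz_near_mean[of h x] equidistributed_mean[of f h] that
    unfolding F_def B_def by auto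
  have Fc: "continuous_on (sphere 0 1) h" if "h \<in> F" for h
    using that geodesic_lipschitz_continuous by (auto simp: F_def)
  have eb: "\<bar>x \<bullet> e\<bar> \<le> 1" if "x \<in> sphere 0 1" for x
    using inner_unit_bounds[OF that, of e] e by (auto simp: abs_le_iff)
  have B0: "0 \<le> B" by (simp add: B_def)
  have wB: "\<bar>h x * (x \<bullet> e)\<bar> \<le> B" if "h \<in> F" "x \<in> sphere 0 1" for h x
  proof -
    have "\<bar>h x\<bar> * \<bar>x \<bullet> e\<bar> \<le> B * 1" using FB[OF that] eb[OF that(2)] B0 by (intro mult_mono) auto
    then show ?thesis by (simp add: abs_mult)
  qed
  have "f \<in> F" using f by (simp add: F_def equidistributed_def)
  then have ne: "correlation e ` F \<noteq> {}" by auto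
  have bdd: "bdd_above (correlation e ` F)"
  proof (rule bdd_aboveI2)
    fix h assume h: "h \<in> F"
    have "correlation e h \<le> (\<integral>x. B \<partial>\<mu>)"
      unfolding correlation_def using wB[OF h] Fc[OF h]
      by (intro integral_mono integrable_continuous continuous_intros) (auto simp: abs_le_iff)
    then show "correlation e h \<le> B" by (simp add: prob_space[simplified])
  qed
  define s where "s = Sup (correlation e ` F)"
  have "\<exists>h\<in>F. s - 1 / (real n + 1) < correlation e h" for n
    using less_cSup_iff[OF ne bdd, of "s - 1 / (real n + 1)"] by (auto simp: s_def)
  then obtain h where h: "\<And>n. h n \<in> F" "\<And>n. s - 1 / (real n + 1) < correlation e (h n)" by metis
  obtain g k where g: "continuous_on (sphere 0 1) g" "strict_mono (k :: nat \<Rightarrow> nat)"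
    "\<And>\<epsilon>. 0 < \<epsilon> \<Longrightarrow> \<exists>N. \<forall>n x. n \<ge> N \<and> x \<in> sphere 0 1 \<longrightarrow> norm (h (k n) x - g x) < \<epsilon>"
  proof (rule Arzela_Ascoli[of "sphere (0 :: real ^ 'n) 1" h B])
    show "norm (h n x) \<le> B" if "x \<in> sphere 0 1" for n x using FB[OF h(1) that] by simp
    show "\<exists>d. 0 < d \<and> (\<forall>n y. y \<in> sphere 0 1 \<and> norm (x - y) < d \<longrightarrow> norm (h n x - h n y) < \<epsilon>)"
      if x: "x \<in> sphere 0 1" and \<epsilon>: "0 < \<epsilon>" for x \<epsilon>
    proof -
      obtain d where d: "0 < d" "\<And>y. y \<in> sphere 0 1 \<Longrightarrow> norm (x - y) < d \<Longrightarrow> geodesic_dist x y < \<epsilon>"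
        using geodesic_dist_small[OF x \<epsilon>] by blast
      have "norm (h n x - h n y) < \<epsilon>" if "y \<in> sphere 0 1" "norm (x - y) < d" for n y
        using geodesic_lipschitzD[of "h n" x y] h(1)[of n] d(2)[OF that] x that by (auto simp: F_def)
      then show ?thesis using d(1) by blast
    qed
  qed auto
  have lim: "(\<lambda>n. h (k n) x) \<longlonglongrightarrow> g x" if "x \<in> sphere 0 1" for x
    unfolding LIMSEQ_iff using g(3) that by blast
  have gl: "geodesic_lipschitz 1 g"
    unfolding geodesic_lipschitz_def
  proof (intro ballI)
    fix x y :: "real ^ 'n" assume x: "x \<in> sphere 0 1" and y: "y \<in> sphere 0 1"
    have "(\<lambda>n. \<bar>h (k n) x - h (k n) y\<bar>) \<longlonglongrightarrow> \<bar>g x - g y\<bar>" by (intro tendsto_intros lim x y)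
    then show "\<bar>g x - g y\<bar> \<le> 1 * geodesic_dist x y"
      using geodesic_lipschitzD[OF _ x y] h(1)
      by (intro LIMSEQ_le_const2[of _ "\<bar>g x - g y\<bar>"]) (auto simp: F_def)
  qed
  have ge: "equidistributed f g"
    unfolding equidistributed_def
  proof (intro allI impI)
    fix \<phi> :: "real \<Rightarrow> real" assume \<phi>: "continuous_on UNIV \<phi>"
    have "bounded (\<phi> ` {-B..B})"
      by (intro compact_imp_bounded compact_continuous_image continuous_on_subset[OF \<phi>]) auto
    then obtain C where C: "\<forall>y\<in>{-B..B}. \<bar>\<phi> y\<bar> \<le> C" unfolding bounded_iff by auto
    have c: "continuous_on (sphere 0 1) (\<lambda>x. \<phi> (h' x))" if "continuous_on (sphere 0 1) h'" for h' :: "real ^ 'n \<Rightarrow> real"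
      by (rule continuous_on_compose2[OF \<phi> that]) simp
    have "(\<lambda>n. \<integral>x. \<phi> (h (k n) x) \<partial>\<mu>) \<longlonglongrightarrow> (\<integral>x. \<phi> (g x) \<partial>\<mu>)"
    proof (rule integral_dominated_convergence[where w = "\<lambda>_. C"])
      show "AE x in \<mu>. (\<lambda>n. \<phi> (h (k n) x)) \<longlonglongrightarrow> \<phi> (g x)"
        using lim \<phi> by (intro AE_I2 isCont_tendsto_compose[of _ \<phi>]) (auto simp: continuous_on_eq_continuous_at)
      show "AE x in \<mu>. norm (\<phi> (h (k n) x)) \<le> C" for n
      proof (rule AE_I2)
        fix x assume "x \<in> space \<mu>"
        then have "h (k n) x \<in> {-B..B}" using FB[OF h(1)[of "k n"], of x] by (simp add: abs_le_iff)
        then show "norm (\<phi> (h (k n) x)) \<le> C" using C by simp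
      qed
    qed (auto intro!: measurable_continuous c[OF g(1)] c[OF Fc[OF h(1)]])
    moreover have "(\<integral>x. \<phi> (h (k n) x) \<partial>\<mu>) = (\<integral>x. \<phi> (f x) \<partial>\<mu>)" for n
      using h(1)[of "k n"] \<phi> by (auto simp: F_def equidistributed_def)
    ultimately show "(\<integral>x. \<phi> (f x) \<partial>\<mu>) = (\<integral>x. \<phi> (g x) \<partial>\<mu>)" by (simp add: LIMSEQ_const_iff)
  qed
  have "(\<lambda>n. correlation e (h (k n))) \<longlonglongrightarrow> correlation e g"
    unfolding correlation_def
  proof (rule integral_dominated_convergence[where w = "\<lambda>_. B"])
    show "AE x in \<mu>. (\<lambda>n. h (k n) x * (x \<bullet> e)) \<longlonglongrightarrow> g x * (x \<bullet> e)"
      using lim by (intro AE_I2 tendsto_intros) auto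
    show "AE x in \<mu>. norm (h (k n) x * (x \<bullet> e)) \<le> B" for n
      using wB[OF h(1)[of "k n"]] by (intro AE_I2) auto
  qed (auto intro!: measurable_continuous continuous_intros g(1) Fc[OF h(1)])
  moreover have "(\<lambda>n. s - inverse (real (Suc n))) \<longlonglongrightarrow> s - 0"
    by (intro tendsto_diff tendsto_const LIMSEQ_inverse_real_of_nat)
  then have "(\<lambda>n. s - 1 / (real n + 1)) \<longlonglongrightarrow> s - 0"
    by (simp add: inverse_eq_divide add.commute)
  then have "(\<lambda>n. s - 1 / (real (k n) + 1)) \<longlonglongrightarrow> s - 0"
    by (rule LIMSEQ_subseq_LIMSEQ[OF _ g(2), unfolded o_def])
  ultimately have "s - 0 \<le> correlation e g"
    using h(2) by (intro LIMSEQ_le[of "\<lambda>n. s - 1 / (real (k n) + 1)" _ "\<lambda>n. correlation e (h (k n))"])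
      (auto intro: less_imp_le)
  then have sg: "s \<le> correlation e g" by simp
  show ?thesis
  proof (rule that[OF gl ge])
    fix h' assume "geodesic_lipschitz 1 h'" "equidistributed f h'"
    then have "h' \<in> F" by (simp add: F_def)
    then have "correlation e h' \<le> s" unfolding s_def by (intro cSup_upper bdd) auto
    then show "correlation e h' \<le> correlation e g" using sg by simp
  qed
qed

end

lemma reflect_along_swap:
  fixes x y :: "'a::real_inner"
  assumes "x \<noteq> y" "norm x = norm y"
  shows "reflect_along ((x - y) /\<^sub>R norm (x - y)) x = y"
proof -
  have nz: "norm (x - y) \<noteq> 0" using assms by simp
  have "(norm (x - y))\<^sup>2 = 2 * (x \<bullet> (x - y))"
    unfolding power2_norm_eq_inner using assms(2)
    by (simp add: norm_eq inner_diff_left inner_diff_right inner_commute)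
  then have A: "x \<bullet> (x - y) = norm (x - y) * norm (x - y) / 2" by (simp add: power2_eq_square)
  define u where "u = (x - y) /\<^sub>R norm (x - y)"
  have "x \<bullet> u = inverse (norm (x - y)) * (x \<bullet> (x - y))"
    unfolding u_def by (rule inner_scaleR_right)
  also have "\<dots> = norm (x - y) / 2" unfolding A using nz by simp
  finally have xu: "x \<bullet> u = norm (x - y) / 2" .
  have "(2 * (x \<bullet> u)) *\<^sub>R u = (2 * (norm (x - y) / 2) * inverse (norm (x - y))) *\<^sub>R (x - y)"
    unfolding xu unfolding u_def by (simp only: scaleR_scaleR)
  also have "\<dots> = x - y" using nz by simp
  finally have "(2 * (x \<bullet> u)) *\<^sub>R u = x - y" .
  then show ?thesis unfolding reflect_along_def u_def by simp
qed

context sphere_measure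
begin

text \<open>If the higher point x carried the smaller value, polarize in the mirror that exchanges x
  and y. Summed over a mirror pair, the gain in correlation is a product of two factors of equal
  sign; it is positive at x, and by full support the total gain is positive, against
  maximality.\<close>

lemma correlation_maximizer_mono:
  assumes g: "geodesic_lipschitz 1 g" and e: "norm e = 1"
    and max: "\<And>u. norm u = 1 \<Longrightarrow> correlation e (polarize u g) \<le> correlation e g"
    and x: "x \<in> sphere 0 1" and y: "y \<in> sphere 0 1" and xy: "y \<bullet> e < x \<bullet> e"
  shows "g y \<le> g x"
proof (rule ccontr)
  assume "\<not> ?thesis"
  then have gxy: "g x < g y" by simp
  have neq: "x \<noteq> y" using xy by auto
  define u where "u = (x - y) /\<^sub>R norm (x - y)"
  have u: "norm u = 1" using neq by (simp add: u_def)
  let ?s = "reflect_along u"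
  have sx: "?s x = y" unfolding u_def using neq x y by (intro reflect_along_swap) auto
  have ue: "0 < u \<bullet> e" using xy neq by (simp add: u_def inner_diff_left)
  have swap: "z \<bullet> e - ?s z \<bullet> e = 2 * (z \<bullet> u) * (u \<bullet> e)" for z
    by (simp add: reflect_along_def inner_diff_left)
  have xu: "0 < x \<bullet> u"
  proof -
    have "x \<bullet> e - y \<bullet> e = 2 * (x \<bullet> u) * (u \<bullet> e)" using swap[of x] unfolding sx .
    then have "0 < 2 * (x \<bullet> u) * (u \<bullet> e)" using xy by linarith
    then show ?thesis using ue by (simp add: zero_less_mult_iff)
  qed
  define D where "D z = polarize u g z * (z \<bullet> e) - g z * (z \<bullet> e)" for z
  have gc: "continuous_on (sphere 0 1) g" "continuous_on (sphere 0 1) (polarize u g)"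
    using g polarize_geodesic_lipschitz[OF g u] by (auto intro: geodesic_lipschitz_continuous)
  have Dc: "continuous_on (sphere 0 1) D" unfolding D_def[abs_def] by (intro continuous_intros gc)
  have D2: "D z + D (?s z) = (polarize u g z - g z) * (2 * (z \<bullet> u) * (u \<bullet> e))" for z
  proof -
    have p: "polarize u g (?s z) = g z + g (?s z) - polarize u g z"
      using polarize_pair[OF u, of g z] by auto
    have "D z + D (?s z) = (polarize u g z - g z) * (z \<bullet> e - ?s z \<bullet> e)"
      unfolding D_def p by (simp add: algebra_simps)
    then show ?thesis by (simp only: swap)
  qed
  have "0 < (\<integral>z. D z + D (?s z) \<partial>\<mu>)"
  proof (rule integral_pos[OF _ _ x])
    show "continuous_on (sphere 0 1) (\<lambda>z. D z + D (?s z))"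
      by (intro continuous_intros Dc continuous_on_reflected[OF u])
    show "0 \<le> D z + D (?s z)" for z
    proof (cases "0 \<le> z \<bullet> u")
      case True
      then show ?thesis unfolding D2 using ue by (intro mult_nonneg_nonneg) (auto simp: polarize_def)
    next
      case False
      then have "2 * (z \<bullet> u) \<le> 0" by simp
      then have "2 * (z \<bullet> u) * (u \<bullet> e) \<le> 0" by (rule mult_nonpos_nonneg) (use ue in simp)
      moreover have "polarize u g z - g z \<le> 0" using False by (simp add: polarize_def)
      ultimately show ?thesis unfolding D2 by (rule mult_nonpos_nonpos[rotated])
    qed
    show "0 < D x + D (?s x)"
      unfolding D2 using gxy xu ue by (simp add: polarize_def sx)
  qed
  also have "\<dots> = 2 * (\<integral>z. D z \<partial>\<mu>)" by (rule integral_symmetrize[OF u Dc])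
  also have "(\<integral>z. D z \<partial>\<mu>) = correlation e (polarize u g) - correlation e g"
    unfolding D_def correlation_def
    by (intro Bochner_Integration.integral_diff integrable_continuous continuous_intros gc)
  finally show False using max[OF u] by simp
qed

text \<open>Strict monotonicity in the height is extended to equal heights by moving one of the
  points up its meridian.\<close>

lemma height_monotone_extend:
  assumes gc: "continuous_on (sphere 0 1) g" and e: "norm e = (1::real)"
    and mono: "\<And>x y. x \<in> sphere 0 1 \<Longrightarrow> y \<in> sphere 0 1 \<Longrightarrow> y \<bullet> e < x \<bullet> e \<Longrightarrow> g y \<le> (g x :: real)"
    and x: "x \<in> sphere 0 1" and y: "y \<in> sphere 0 1" and xy: "x \<bullet> e = y \<bullet> (e :: real ^ 'n)"
  shows "g y \<le> g x"
\<comment> \<open>A pole is the only point at its height. Any other point has a nonzero component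
  orthogonal to e, whose direction w determines the meridian.\<close>
proof (cases "\<bar>x \<bullet> e\<bar> = 1")
  case True
  have "z = (z \<bullet> e) *\<^sub>R e" if "z \<in> sphere 0 1" "\<bar>z \<bullet> e\<bar> = 1" for z
  proof -
    have "(norm (z - (z \<bullet> e) *\<^sub>R e))\<^sup>2 = 1 - (z \<bullet> e)\<^sup>2"
      unfolding power2_norm_eq_inner using that e
      by (simp add: inner_diff_left inner_diff_right inner_commute norm_eq_1 power2_eq_square)
    also have "\<dots> = 0" using that(2) by (simp add: abs_square_eq_1)
    finally show ?thesis by simp
  qed
  then have "x = y" using True x y xy by metis
  then show ?thesis by simp
next
  case False
  define c where "c = x \<bullet> e"
  have c: "- 1 < c" "c < 1" using False inner_unit_bounds[OF x, of e] e by (auto simp: c_def)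
  define w where "w = (x - c *\<^sub>R e) /\<^sub>R sqrt (1 - c\<^sup>2)"
  have c2: "0 < 1 - c\<^sup>2" using c by (simp add: abs_square_less_1)
  have n: "(norm (x - c *\<^sub>R e))\<^sup>2 = 1 - c\<^sup>2"
    unfolding power2_norm_eq_inner using x e
    by (simp add: inner_diff_left inner_diff_right inner_commute norm_eq_1 power2_eq_square c_def)
  then have n': "norm (x - c *\<^sub>R e) = sqrt (1 - c\<^sup>2)" by (metis norm_ge_zero real_sqrt_unique)
  have w: "norm w = 1" unfolding w_def using c2 n' by simp
  have we: "w \<bullet> e = 0" using e by (simp add: w_def inner_diff_left c_def norm_eq_1)
  define \<gamma> where "\<gamma> s = sin s *\<^sub>R e + cos s *\<^sub>R w" for s
  have \<gamma>S: "\<gamma> s \<in> sphere 0 1" for s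
  proof -
    have "\<gamma> s \<bullet> \<gamma> s = sin s * sin s + cos s * cos s"
      using e w we by (simp add: \<gamma>_def inner_add_left inner_add_right inner_commute norm_eq_1)
    then show ?thesis using sin_cos_squared_add[of s] by (simp add: norm_eq_1 power2_eq_square)
  qed
  have \<gamma>e: "\<gamma> s \<bullet> e = sin s" for s using e we by (simp add: \<gamma>_def inner_add_left norm_eq_1)
  define a where "a = arcsin c"
  have a: "- (pi/2) < a" "a < pi/2" "sin a = c" "cos a = sqrt (1 - c\<^sup>2)"
    using c arcsin_lt_bounded[of c] by (auto simp: a_def cos_arcsin)
  have \<gamma>a: "\<gamma> a = x" using a c2 by (simp add: \<gamma>_def w_def)
  have "continuous_on {a..pi/2} (\<lambda>s. g (\<gamma> s))"
    by (rule continuous_on_compose2[OF gc]) (use \<gamma>S in \<open>auto simp: \<gamma>_def[abs_def] intro!: continuous_intros\<close>)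
  then have "((\<lambda>s. g (\<gamma> s)) \<longlongrightarrow> g (\<gamma> a)) (at_right a)"
    by (rule continuous_on_Icc_at_rightD) (use a in simp)
  moreover have "\<forall>\<^sub>F s in at_right a. g y \<le> g (\<gamma> s)"
  proof (rule eventually_at_rightI[of a "pi/2"])
    fix s assume s: "s \<in> {a<..<pi/2}"
    then have "sin a < sin s" using a by (intro sin_monotone_2pi) auto
    then show "g y \<le> g (\<gamma> s)" using \<gamma>S \<gamma>e a xy y by (intro mono) (auto simp: c_def)
  qed (use a in auto)
  ultimately show ?thesis unfolding \<gamma>a by (rule tendsto_lowerbound) simp
qed

text \<open>The maximizer g is a function of the height alone, so it can be read off along one
  meridian. The meridian is parametrized by arc length, hence \<psi> inherits the Lipschitz constant
  1; n >= 2 provides the second direction that spans it.\<close>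

theorem monotone_rearrangement:
  fixes f :: "real ^ 'n \<Rightarrow> real"
  assumes f: "geodesic_lipschitz 1 f"
  obtains \<psi> where "mono_on {-(pi/2)..pi/2} \<psi>" "1-lipschitz_on {-(pi/2)..pi/2} \<psi>"
    "\<And>\<phi>. continuous_on UNIV \<phi> \<Longrightarrow> (\<integral>x. \<phi> (f x) \<partial>\<mu>) = lat_mean (CARD('n) - 2) (\<lambda>s. \<phi> (\<psi> s))"
proof -
  let ?I = "{-(pi/2)..pi/2}"
  obtain i j :: 'n where ij: "i \<noteq> j"
    using card_ge_2 by (metis card_2_iff' ex_card numeral_le_iff one_le_numeral UNIV_I)
  define e where "e = (axis i 1 :: real ^ 'n)"
  define e' where "e' = (axis j 1 :: real ^ 'n)"
  have e: "norm e = 1" "norm e' = 1" "e \<bullet> e' = 0"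
    using ij by (simp_all add: e_def e'_def norm_axis_1 inner_axis) (simp add: axis_def)
  obtain g where g: "geodesic_lipschitz 1 g" "equidistributed f g"
    "\<And>h. geodesic_lipschitz 1 h \<Longrightarrow> equidistributed f h \<Longrightarrow> correlation e h \<le> correlation e g"
    using correlation_maximizer_exists[OF f e(1)] by blast
  have gc: "continuous_on (sphere 0 1) g" by (rule geodesic_lipschitz_continuous[OF g(1)])
  have "correlation e (polarize u g) \<le> correlation e g" if "norm u = 1" for u
    using polarize_geodesic_lipschitz[OF g(1) that] polarize_equidistributed[OF g(1) that] g(2)
    by (intro g(3)) (auto simp: equidistributed_def)
  then have mono: "g y \<le> g x" if "x \<in> sphere 0 1" "y \<in> sphere 0 1" "y \<bullet> e < x \<bullet> e" for x y
    using correlation_maximizer_mono[OF g(1) e(1)] that by blast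
  have level: "g x = g y" if "x \<in> sphere 0 1" "y \<in> sphere 0 1" "x \<bullet> e = y \<bullet> e" for x y
    using height_monotone_extend[OF gc e(1) mono, of x y] height_monotone_extend[OF gc e(1) mono, of y x] that
    by force
  define \<gamma> where "\<gamma> s = sin s *\<^sub>R e + cos s *\<^sub>R e'" for s
  have \<gamma>\<gamma>: "\<gamma> s \<bullet> \<gamma> t = cos (s - t)" for s t
    using e by (simp add: \<gamma>_def inner_add_left inner_add_right inner_commute norm_eq_1 cos_diff)
  have \<gamma>S: "\<gamma> s \<in> sphere 0 1" for s using \<gamma>\<gamma>[of s s] by (simp add: norm_eq_1)
  have "e' \<bullet> e = 0" "e \<bullet> e = 1" using e by (simp_all add: inner_commute norm_eq_1)
  then have \<gamma>e: "\<gamma> s \<bullet> e = sin s" for s by (simp add: \<gamma>_def inner_add_left)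
  define \<psi> where "\<psi> s = g (\<gamma> s)" for s
  have g\<psi>: "g x = \<psi> (arcsin (x \<bullet> e))" if x: "x \<in> sphere 0 1" for x
    unfolding \<psi>_def using inner_unit_bounds[OF x, of e] e
    by (intro level x \<gamma>S) (simp add: \<gamma>e)
  have lip: "1-lipschitz_on ?I \<psi>"
  proof (rule lipschitz_onI)
    fix s t assume st: "s \<in> ?I" "t \<in> ?I"
    have "geodesic_dist (\<gamma> s) (\<gamma> t) = arccos (cos \<bar>s - t\<bar>)" by (simp add: geodesic_dist_def \<gamma>\<gamma>)
    also have "\<dots> = \<bar>s - t\<bar>" using st by (intro arccos_cos) (auto simp: abs_le_iff)
    finally show "dist (\<psi> s) (\<psi> t) \<le> 1 * dist s t"
      using geodesic_lipschitzD[OF g(1) \<gamma>S \<gamma>S, of s t] by (simp add: \<psi>_def dist_real_def)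
  qed simp
  have mono\<psi>: "mono_on ?I \<psi>"
  proof (rule mono_onI)
    fix s t assume st: "s \<in> ?I" "t \<in> ?I" "s \<le> t"
    show "\<psi> s \<le> \<psi> t"
    proof (cases "s = t")
      case False
      then have "sin s < sin t" using st by (intro sin_monotone_2pi) auto
      then show ?thesis unfolding \<psi>_def by (intro mono \<gamma>S) (simp add: \<gamma>e)
    qed simp
  qed
  show ?thesis
  proof (rule that[OF mono\<psi> lip])
    fix \<phi> :: "real \<Rightarrow> real" assume \<phi>: "continuous_on UNIV \<phi>"
    have "continuous_on {-1..1} (\<lambda>y. \<psi> (arcsin y))"
      by (rule continuous_on_compose2[OF lipschitz_on_continuous_on[OF lip] continuous_on_arcsin'])
         (use arcsin_bounded in \<open>simp add: image_subset_iff\<close>)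
    then have c: "continuous_on {-1..1} (\<lambda>y. \<phi> (\<psi> (arcsin y)))"
      by (rule continuous_on_compose2[OF \<phi>]) simp
    have "(\<integral>x. \<phi> (f x) \<partial>\<mu>) = (\<integral>x. \<phi> (g x) \<partial>\<mu>)" using g(2) \<phi> by (simp add: equidistributed_def)
    also have "\<dots> = (\<integral>x. \<phi> (\<psi> (arcsin (x \<bullet> e))) \<partial>\<mu>)"
      by (intro Bochner_Integration.integral_cong refl) (simp add: g\<psi>)
    also have "\<dots> = lat_mean (CARD('n) - 2) (\<lambda>s. \<phi> (\<psi> (arcsin (sin s))))"
      by (rule integral_zonal[OF e(1) c])
    also have "\<dots> = lat_mean (CARD('n) - 2) (\<lambda>s. \<phi> (\<psi> s))"
      unfolding lat_mean_def
      by (intro Henstock_Kurzweil_Integration.integral_cong) (simp add: arcsin_sin)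
    finally show "(\<integral>x. \<phi> (f x) \<partial>\<mu>) = lat_mean (CARD('n) - 2) (\<lambda>s. \<phi> (\<psi> s))" .
  qed
qed


section \<open>From test functions to deviation sets\<close>

text \<open>The cutoffs rise linearly from 0 at s to 1 at T, so they dominate the indicator of A and
  vanish below s; then s increases to T in the bound. For T = 0 the claim is that a probability is
  at most 1.\<close>

lemma measure_le_of_cutoffs:
  fixes F M :: "_ \<Rightarrow> real"
  assumes T: "0 \<le> T" and c: "0 \<le> c"
    and meas: "A \<in> sets \<mu>"
    and F: "continuous_on (sphere 0 1) F"
    and A: "\<And>x. x \<in> A \<Longrightarrow> T \<le> F x"
    and cut: "\<And>s \<phi>. 0 < s \<Longrightarrow> s < T \<Longrightarrow> continuous_on UNIV \<phi> \<Longrightarrow> (\<And>y. \<phi> y \<le> (1::real)) \<Longrightarrow>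
        (\<And>y. y < s \<Longrightarrow> \<phi> y \<le> 0) \<Longrightarrow> (\<integral>x. \<phi> (F x) \<partial>\<mu>) \<le> exp (- (c * s\<^sup>2))"
  shows "measure \<mu> A \<le> exp (- (c * T\<^sup>2))"
proof (cases "T = 0")
  case True
  then show ?thesis by simp
next
  case False
  then have T: "0 < T" using T by simp
  have "measure \<mu> A \<le> exp (- (c * s\<^sup>2))" if s: "0 < s" "s < T" for s
  proof -
    define \<phi> where "\<phi> y = max 0 (min 1 ((y - s) / (T - s)))" for y
    have \<phi>c: "continuous_on UNIV \<phi>" unfolding \<phi>_def[abs_def] using s by (intro continuous_intros) auto
    have "measure \<mu> A = (\<integral>x. indicator A x \<partial>\<mu>)"
      using sets.sets_into_space[OF meas] by (simp add: Int_absorb2)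
    also have "\<dots> \<le> (\<integral>x. \<phi> (F x) \<partial>\<mu>)"
    proof (rule integral_mono)
      show "integrable \<mu> (\<lambda>x. \<phi> (F x))"
        by (intro integrable_continuous continuous_on_compose2[OF \<phi>c F]) simp
      show "indicat_real A x \<le> \<phi> (F x)" for x
        using A[of x] s by (auto simp: indicator_def \<phi>_def)
    qed (use meas in \<open>simp add: integrable_real_indicator emeasure_eq_measure\<close>)
    also have "\<dots> \<le> exp (- (c * s\<^sup>2))"
    proof (rule cut[OF s \<phi>c])
      show "\<phi> y \<le> 0" if "y < s" for y
        using that s divide_neg_pos[of "y - s" "T - s"] by (simp add: \<phi>_def)
    qed (simp add: \<phi>_def)
    finally show ?thesis .
  qed
  then have "\<forall>\<^sub>F s in at_left T. measure \<mu> A \<le> exp (- (c * s\<^sup>2))"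
    using T by (intro eventually_at_leftI[of 0]) auto
  moreover have "((\<lambda>s. exp (- (c * s\<^sup>2))) \<longlongrightarrow> exp (- (c * T\<^sup>2))) (at_left T)"
    by (intro tendsto_intros)
  ultimately show ?thesis by (intro tendsto_lowerbound[of _ _ "at_left T"]) auto
qed

lemma deviation_unit_lipschitz:
  fixes f :: "real ^ 'n \<Rightarrow> real"
  assumes f: "geodesic_lipschitz 1 f" and t: "0 \<le> t"
  shows "measure \<mu> {x \<in> sphere 0 1. f x \<ge> (\<integral>y. f y \<partial>\<mu>) + t} \<le> exp (- (real CARD('n) / 2 * t\<^sup>2))"
    and "2 < CARD('n) \<Longrightarrow> measure \<mu> {x \<in> sphere 0 1. \<bar>f x - (\<integral>y. f y \<partial>\<mu>)\<bar> \<ge> t} \<le> exp (- (real CARD('n) / 2 * t\<^sup>2))"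
proof -
  let ?m = "CARD('n) - 2"
  define M where "M = (\<integral>y. f y \<partial>\<mu>)"
  have n: "real (?m + 2) = real CARD('n)" using card_ge_2 by simp
  have fc: "continuous_on (sphere 0 1) f" by (rule geodesic_lipschitz_continuous[OF f])
  have fm: "f \<in> borel_measurable \<mu>" by (rule measurable_continuous[OF fc])
  obtain \<psi> where \<psi>: "mono_on {-(pi/2)..pi/2} \<psi>" "1-lipschitz_on {-(pi/2)..pi/2} \<psi>"
    "\<And>\<phi>. continuous_on UNIV \<phi> \<Longrightarrow> (\<integral>x. \<phi> (f x) \<partial>\<mu>) = lat_mean ?m (\<lambda>s. \<phi> (\<psi> s))"
    using monotone_rearrangement[OF f] by blast
  have M: "M = lat_mean ?m \<psi>" using \<psi>(3)[of "\<lambda>y. y"] by (simp add: M_def continuous_on_id)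
  have comp: "continuous_on {-(pi/2)..pi/2} (\<lambda>s. \<phi> (\<psi> s))" if "continuous_on UNIV \<phi>" for \<phi> :: "real \<Rightarrow> real"
    by (rule continuous_on_compose2[OF that lipschitz_on_continuous_on[OF \<psi>(2)]]) simp
  have "measure \<mu> {x \<in> sphere 0 1. f x \<ge> M + t} \<le> exp (- (real CARD('n) / 2 * t\<^sup>2))"
  proof (rule measure_le_of_cutoffs[OF t, where F = "\<lambda>x. f x - M"])
    have "{x \<in> space \<mu>. f x \<ge> M + t} \<in> sets \<mu>" using fm by measurable
    then show "{x \<in> sphere 0 1. f x \<ge> M + t} \<in> sets \<mu>" by simp
    fix s :: real and \<phi> :: "real \<Rightarrow> real"
    assume s: "0 < s" "s < t" and \<phi>: "continuous_on UNIV \<phi>" "\<And>y. \<phi> y \<le> 1" "\<And>y. y < s \<Longrightarrow> \<phi> y \<le> 0"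
    have \<phi>': "continuous_on UNIV (\<lambda>y. \<phi> (y - M))"
      by (rule continuous_on_compose2[OF \<phi>(1)]) (auto intro!: continuous_intros)
    have "(\<integral>x. \<phi> (f x - M) \<partial>\<mu>) = lat_mean ?m (\<lambda>s. \<phi> (\<psi> s - M))" by (rule \<psi>(3)[OF \<phi>'])
    also have "\<dots> \<le> exp (- ((?m + 2) * s\<^sup>2 / 2))"
      by (rule lat_mean_deviation_upper[OF \<psi>(1,2)]) (use s \<phi> comp[OF \<phi>'] in \<open>auto simp: M\<close>)
    finally show "(\<integral>x. \<phi> (f x - M) \<partial>\<mu>) \<le> exp (- (real CARD('n) / 2 * s\<^sup>2))" using n by simp
  qed (auto intro!: continuous_intros fc)
  then show "measure \<mu> {x \<in> sphere 0 1. f x \<ge> (\<integral>y. f y \<partial>\<mu>) + t} \<le> exp (- (real CARD('n) / 2 * t\<^sup>2))"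
    by (simp add: M_def)
  assume "2 < CARD('n)"
  then have m: "1 \<le> ?m" by simp
  have "measure \<mu> {x \<in> sphere 0 1. \<bar>f x - M\<bar> \<ge> t} \<le> exp (- (real CARD('n) / 2 * t\<^sup>2))"
  proof (rule measure_le_of_cutoffs[OF t, where F = "\<lambda>x. \<bar>f x - M\<bar>"])
    have "{x \<in> space \<mu>. \<bar>f x - M\<bar> \<ge> t} \<in> sets \<mu>" using fm by measurable
    then show "{x \<in> sphere 0 1. \<bar>f x - M\<bar> \<ge> t} \<in> sets \<mu>" by simp
    fix s :: real and \<phi> :: "real \<Rightarrow> real"
    assume s: "0 < s" "s < t" and \<phi>: "continuous_on UNIV \<phi>" "\<And>y. \<phi> y \<le> 1" "\<And>y. y < s \<Longrightarrow> \<phi> y \<le> 0"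
    have \<phi>': "continuous_on UNIV (\<lambda>y. \<phi> \<bar>y - M\<bar>)"
      by (rule continuous_on_compose2[OF \<phi>(1)]) (auto intro!: continuous_intros)
    have "(\<integral>x. \<phi> \<bar>f x - M\<bar> \<partial>\<mu>) = lat_mean ?m (\<lambda>s. \<phi> \<bar>\<psi> s - M\<bar>)" by (rule \<psi>(3)[OF \<phi>'])
    also have "\<dots> \<le> exp (- ((?m + 2) * s\<^sup>2 / 2))"
      by (rule lat_mean_deviation_abs[OF m \<psi>(1,2)]) (use s \<phi> comp[OF \<phi>'] in \<open>auto simp: M\<close>)
    finally show "(\<integral>x. \<phi> \<bar>f x - M\<bar> \<partial>\<mu>) \<le> exp (- (real CARD('n) / 2 * s\<^sup>2))" using n by simp
  qed (auto intro!: continuous_intros fc)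
  then show "measure \<mu> {x \<in> sphere 0 1. \<bar>f x - (\<integral>y. f y \<partial>\<mu>)\<bar> \<ge> t} \<le> exp (- (real CARD('n) / 2 * t\<^sup>2))"
    by (simp add: M_def)
qed

end

theorem theorem3:
  fixes \<mu> :: "(real ^ 'n) measure" and f :: "real ^ 'n \<Rightarrow> real" and L t :: real
  assumes "CARD('n) \<ge> 2"
    and "is_sphere_measure \<mu>"
    and "L > 0"
    and "geodesic_lipschitz L f"
    and "t \<ge> 0"
  shows "measure \<mu> {x \<in> sphere 0 1. f x \<ge> (\<integral>y. f y \<partial>\<mu>) + t}
           \<le> exp (- (real CARD('n) * t\<^sup>2 / (2 * L\<^sup>2))) \<and>
    (CARD('n) > 2 \<longrightarrow>
         measure \<mu> {x \<in> sphere 0 1. \<bar>f x - (\<integral>y. f y \<partial>\<mu>)\<bar> \<ge> t}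
           \<le> exp (- (real CARD('n) * t\<^sup>2 / (2 * L\<^sup>2))))"
proof -
  interpret sphere_measure \<mu>
    using assms(1,2) unfolding sphere_measure_def sphere_measure_axioms_def is_sphere_measure_def by blast
  define g where "g x = f x / L" for x
  have g: "geodesic_lipschitz 1 g"
    using assms(3,4) unfolding geodesic_lipschitz_def g_def
    by (auto simp: field_simps simp flip: diff_divide_distrib)
  have Eg: "(\<integral>y. g y \<partial>\<mu>) = (\<integral>y. f y \<partial>\<mu>) / L" by (simp add: g_def)
  have T: "0 \<le> t / L" using assms by simp
  have e: "real CARD('n) / 2 * (t / L)\<^sup>2 = real CARD('n) * t\<^sup>2 / (2 * L\<^sup>2)" by (simp add: power_divide)
  have "g x \<ge> (\<integral>y. g y \<partial>\<mu>) + t / L \<longleftrightarrow> f x \<ge> (\<integral>y. f y \<partial>\<mu>) + t"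
    and "\<bar>g x - (\<integral>y. g y \<partial>\<mu>)\<bar> \<ge> t / L \<longleftrightarrow> \<bar>f x - (\<integral>y. f y \<partial>\<mu>)\<bar> \<ge> t" for x
  proof -
    show "g x \<ge> (\<integral>y. g y \<partial>\<mu>) + t / L \<longleftrightarrow> f x \<ge> (\<integral>y. f y \<partial>\<mu>) + t"
      unfolding Eg unfolding g_def add_divide_distrib[symmetric] using assms(3) by (simp add: divide_le_cancel)
    have "\<bar>g x - (\<integral>y. g y \<partial>\<mu>)\<bar> = \<bar>f x - (\<integral>y. f y \<partial>\<mu>)\<bar> / L"
      unfolding Eg unfolding g_def diff_divide_distrib[symmetric] using assms(3) by simp
    then show "\<bar>g x - (\<integral>y. g y \<partial>\<mu>)\<bar> \<ge> t / L \<longleftrightarrow> \<bar>f x - (\<integral>y. f y \<partial>\<mu>)\<bar> \<ge> t"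
      using assms(3) by (simp add: divide_le_cancel)
  qed
  then show ?thesis using deviation_unit_lipschitz[OF g T] unfolding e by simp
qed

end
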